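(* Let $a,b,c:\mathbb R\to\mathbb R$ be smooth real-valued functions, $m$ a smooth compactly supported symbol on $\mathbb R^2$, $\phi(\xi,\eta)=-a(\xi+\eta)+b(\xi)+c(\eta)$, and $\Gamma=\{(\xi,\eta)\in\operatorname{Supp}m:\phi(\xi,\eta)=0\}$. Let $q\in[2,\infty]$. Then for $f,g\in L^2(\mathbb R)$ the solution $u$ of the system in the context satisfies $\|u(t)\|_{L^q}\lesssim\alpha(t)\|f\|_{L^2}\|g\|_{L^2}$, where: (a) in general, $\alpha(t)=t$; (b) if $\Gamma$ is empty, $\alpha(t)=1$; (c) if $\Gamma$ is a single point where $\phi$ vanishes at order two, $\alpha(t)=t^{\frac12+\frac1{2q}}$; (d) if $\Gamma$ is a non-characteristic curve on which $\phi$ vanishes at order one, $\alpha(t)=t^{1/q}$ for $2\le q<\infty$ and $\alpha(t)=\langle\log t\rangle$ for $q=\infty$; (e) if $\Gamma$ is a curve with non-vanishing curvature on which $\phi$ vanishes at order one, $\alpha(t)=t^{\frac14+\frac1{2q}}$; (f) if $\Gamma$ is a general smooth curve on which $\phi$ vanishes at order one, $\alpha(t)=t^{1/2}$.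
   Context: $T_m(f,g)(x)=\int_{\mathbb R^2}e^{ix(\xi+\eta)}\widehat f(\xi)\widehat g(\eta)m(\xi,\eta)\,d\xi\,d\eta$; $e^{ita(D)}$ is the Fourier multiplier with symbol $e^{ita(\xi)}$. $u$ solves $i\partial_tu+a(D)u=T_m(v,w)$, $i\partial_tv+b(D)v=0$, $i\partial_tw+c(D)w=0$ with $u(0)=0$, $v(0)=f$, $w(0)=g$, i.e. $u(t)=-ie^{ita(D)}\int_0^tT_{me^{is\phi}}(f,g)\,ds$. "Vanishes at order two at the point" means $\nabla\phi$ also vanishes there and the Hessian of $\phi$ there is definite; "vanishes at order one on the curve" means $\nabla\phi\ne0$ on $\Gamma$. A curve in the $(\xi,\eta)$-plane is characteristic at a point if its tangent there is parallel to $(1,0)$, $(0,1)$ or $(1,-1)$ (i.e. tangent to a line $\xi=$const, $\eta=$const or $\xi+\eta=$const); non-characteristic means characteristic at no point. $\langle x\rangle=\sqrt{1+x^2}$; $A\lesssim B$ means $A\le CB$ with $C$ independent of $t,f,g$. *)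

theory Defs
  imports "HOL-Analysis.Analysis"
begin

definition smooth1 :: "(real \<Rightarrow> real) \<Rightarrow> bool" where
  "smooth1 a \<longleftrightarrow> (\<forall>n x. ((deriv ^^ n) a) differentiable (at x))"

definition pdx :: "(real \<times> real \<Rightarrow> 'b::real_normed_vector) \<Rightarrow> real \<times> real \<Rightarrow> 'b" where
  "pdx h p = vector_derivative (\<lambda>s. h (s, snd p)) (at (fst p))"

definition pdy :: "(real \<times> real \<Rightarrow> 'b::real_normed_vector) \<Rightarrow> real \<times> real \<Rightarrow> 'b" where
  "pdy h p = vector_derivative (\<lambda>s. h (fst p, s)) (at (snd p))"

fun pds :: "bool list \<Rightarrow> (real \<times> real \<Rightarrow> 'b::real_normed_vector) \<Rightarrow> real \<times> real \<Rightarrow> 'b" where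
  "pds [] h = h"
| "pds (d # ds) h = (if d then pdx (pds ds h) else pdy (pds ds h))"

definition smooth2 :: "(real \<times> real \<Rightarrow> 'b::real_normed_vector) \<Rightarrow> bool" where
  "smooth2 h \<longleftrightarrow> (\<forall>ds p. pds ds h differentiable (at p))"

definition Supp :: "(real \<times> real \<Rightarrow> complex) \<Rightarrow> (real \<times> real) set" where
  "Supp m = closure {p. m p \<noteq> 0}"

definition L2 :: "(real \<Rightarrow> complex) \<Rightarrow> bool" where
  "L2 f \<longleftrightarrow> f \<in> borel_measurable lborel \<and> integrable lborel (\<lambda>x. (cmod (f x))\<^sup>2)"

definition L2norm :: "(real \<Rightarrow> complex) \<Rightarrow> real" where
  "L2norm f = sqrt (\<integral>x. (cmod (f x))\<^sup>2 \<partial>lborel)"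

text \<open>\<open>Lq_norm_le q h B\<close>: h is in L^q and its L^q norm is at most B (B \<ge> 0), for q in [1,\<infinity>].\<close>
definition Lq_norm_le :: "ereal \<Rightarrow> (real \<Rightarrow> complex) \<Rightarrow> real \<Rightarrow> bool" where
  "Lq_norm_le q h B \<longleftrightarrow> h \<in> borel_measurable lborel \<and>
     (if q = \<infinity> then (AE x in lborel. cmod (h x) \<le> B)
      else (\<integral>\<^sup>+x. ennreal (cmod (h x) powr real_of_ereal q) \<partial>lborel)
             \<le> ennreal (B powr real_of_ereal q))"

definition fourier_L2 :: "(real \<Rightarrow> complex) \<Rightarrow> (real \<Rightarrow> complex) \<Rightarrow> bool" where
  "fourier_L2 f F \<longleftrightarrow> L2 f \<and> L2 F \<and>
     ((\<lambda>R::real. \<integral>\<^sup>+\<xi>. ennreal ((cmod (F \<xi> -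
          (LINT x:{-R..R}|lborel. exp (- \<i> * of_real (x * \<xi>)) * f x)))\<^sup>2) \<partial>lborel)
       \<longlongrightarrow> 0) at_top"

definition FT :: "(real \<Rightarrow> complex) \<Rightarrow> real \<Rightarrow> complex" where
  "FT f = (SOME F. fourier_L2 f F)"

definition eprop :: "(real \<Rightarrow> real) \<Rightarrow> real \<Rightarrow> (real \<Rightarrow> complex) \<Rightarrow> real \<Rightarrow> complex" where
  "eprop a t h = (SOME k. fourier_L2 k (\<lambda>\<zeta>. exp (\<i> * of_real (t * a \<zeta>)) * FT h \<zeta>))"

definition Tm :: "(real \<times> real \<Rightarrow> complex) \<Rightarrow> (real \<Rightarrow> complex) \<Rightarrow> (real \<Rightarrow> complex) \<Rightarrow> real \<Rightarrow> complex" where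
  "Tm m f g x = (\<integral>p. exp (\<i> * of_real (x * (fst p + snd p))) * FT f (fst p) * FT g (snd p) * m p
                   \<partial>(lborel :: (real \<times> real) measure))"

definition phase :: "(real \<Rightarrow> real) \<Rightarrow> (real \<Rightarrow> real) \<Rightarrow> (real \<Rightarrow> real) \<Rightarrow> real \<times> real \<Rightarrow> real" where
  "phase a b c p = - a (fst p + snd p) + b (fst p) + c (snd p)"

definition sol :: "(real \<Rightarrow> real) \<Rightarrow> (real \<Rightarrow> real) \<Rightarrow> (real \<Rightarrow> real) \<Rightarrow> (real \<times> real \<Rightarrow> complex)
    \<Rightarrow> (real \<Rightarrow> complex) \<Rightarrow> (real \<Rightarrow> complex) \<Rightarrow> real \<Rightarrow> real \<Rightarrow> complex" where
  "sol a b c m f g t = (\<lambda>x. - \<i> * eprop a t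
      (\<lambda>y. LINT s:{0..t}|lborel. Tm (\<lambda>p. m p * exp (\<i> * of_real (s * phase a b c p))) f g y) x)"

definition ResSet :: "(real \<Rightarrow> real) \<Rightarrow> (real \<Rightarrow> real) \<Rightarrow> (real \<Rightarrow> real) \<Rightarrow> (real \<times> real \<Rightarrow> complex)
    \<Rightarrow> (real \<times> real) set" where
  "ResSet a b c m = {p \<in> Supp m. phase a b c p = 0}"

definition grad_zero :: "(real \<times> real \<Rightarrow> real) \<Rightarrow> real \<times> real \<Rightarrow> bool" where
  "grad_zero \<phi> p \<longleftrightarrow> pdx \<phi> p = 0 \<and> pdy \<phi> p = 0"

definition hess_form :: "(real \<times> real \<Rightarrow> real) \<Rightarrow> real \<times> real \<Rightarrow> real \<times> real \<Rightarrow> real" where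
  "hess_form \<phi> p v = pdx (pdx \<phi>) p * (fst v)\<^sup>2 + 2 * pdy (pdx \<phi>) p * fst v * snd v
                      + pdy (pdy \<phi>) p * (snd v)\<^sup>2"

definition hess_definite :: "(real \<times> real \<Rightarrow> real) \<Rightarrow> real \<times> real \<Rightarrow> bool" where
  "hess_definite \<phi> p \<longleftrightarrow> (\<forall>v. v \<noteq> 0 \<longrightarrow> hess_form \<phi> p v > 0) \<or> (\<forall>v. v \<noteq> 0 \<longrightarrow> hess_form \<phi> p v < 0)"

definition vanish_order_two :: "(real \<times> real \<Rightarrow> real) \<Rightarrow> real \<times> real \<Rightarrow> bool" where
  "vanish_order_two \<phi> p \<longleftrightarrow> \<phi> p = 0 \<and> grad_zero \<phi> p \<and> hess_definite \<phi> p"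

definition vanish_order_one_on :: "(real \<times> real \<Rightarrow> real) \<Rightarrow> (real \<times> real) set \<Rightarrow> bool" where
  "vanish_order_one_on \<phi> S \<longleftrightarrow> (\<forall>p\<in>S. \<phi> p = 0 \<and> \<not> grad_zero \<phi> p)"

definition tangent_dir :: "(real \<times> real \<Rightarrow> real) \<Rightarrow> real \<times> real \<Rightarrow> real \<times> real" where
  "tangent_dir \<phi> p = (- pdy \<phi> p, pdx \<phi> p)"

definition parallel :: "real \<times> real \<Rightarrow> real \<times> real \<Rightarrow> bool" where
  "parallel v w \<longleftrightarrow> fst v * snd w - snd v * fst w = 0"

definition characteristic_at :: "(real \<times> real \<Rightarrow> real) \<Rightarrow> real \<times> real \<Rightarrow> bool" where
  "characteristic_at \<phi> p \<longleftrightarrow>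
     parallel (tangent_dir \<phi> p) (1, 0) \<or> parallel (tangent_dir \<phi> p) (0, 1)
     \<or> parallel (tangent_dir \<phi> p) (1, -1)"

definition non_characteristic :: "(real \<times> real \<Rightarrow> real) \<Rightarrow> (real \<times> real) set \<Rightarrow> bool" where
  "non_characteristic \<phi> S \<longleftrightarrow> (\<forall>p\<in>S. \<not> characteristic_at \<phi> p)"

text \<open>Signed curvature of the level curve {\<phi> = 0} at p.\<close>
definition curvature :: "(real \<times> real \<Rightarrow> real) \<Rightarrow> real \<times> real \<Rightarrow> real" where
  "curvature \<phi> p =
     (pdx (pdx \<phi>) p * (pdy \<phi> p)\<^sup>2 - 2 * pdy (pdx \<phi>) p * pdx \<phi> p * pdy \<phi> p
      + pdy (pdy \<phi>) p * (pdx \<phi> p)\<^sup>2) / (sqrt ((pdx \<phi> p)\<^sup>2 + (pdy \<phi> p)\<^sup>2)) ^ 3"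

definition estimate :: "(real \<Rightarrow> real) \<Rightarrow> (real \<Rightarrow> real) \<Rightarrow> (real \<Rightarrow> real) \<Rightarrow> (real \<times> real \<Rightarrow> complex)
    \<Rightarrow> ereal \<Rightarrow> (real \<Rightarrow> real) \<Rightarrow> bool" where
  "estimate a b c m q \<alpha> \<longleftrightarrow> (\<exists>C>0. \<forall>f g t. L2 f \<longrightarrow> L2 g \<longrightarrow> 0 < t \<longrightarrow>
      Lq_norm_le q (sol a b c m f g t) (C * \<alpha> t * L2norm f * L2norm g))"

definition qinv :: "ereal \<Rightarrow> real" where
  "qinv q = (if q = \<infinity> then 0 else 1 / real_of_ereal q)"

definition japanese :: "real \<Rightarrow> real" where
  "japanese x = sqrt (1 + x\<^sup>2)"

end

theory Submission
  imports Defs "HOL-Probability.Probability"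
begin

text \<open>
  By Plancherel and Fubini, \<open>u(t)\<close> is, up to unimodular factors, the inverse Fourier transform of
  \<open>\<zeta> \<mapsto> \<integral> F(\<zeta> - \<eta>) G(\<eta>) M(\<zeta> - \<eta>, \<eta>) d\<eta>\<close> with \<open>F\<close>, \<open>G\<close> the transforms of \<open>f\<close>, \<open>g\<close> and
  \<open>M = m \<integral>\<^sub>0\<^sup>t exp(i s \<phi>) ds\<close>, so that \<open>|M| \<le> |m| min(t, 2/|\<phi>|)\<close>; no oscillation is used beyond this bound.
  Cut \<open>M\<close> dyadically according to the size of \<open>\<phi>\<close>. If the slices of \<open>{|\<phi>| < \<lambda>}\<close> in the directions \<open>\<xi>\<close>
  and \<open>\<eta>\<close> have lengths at most \<open>X\<close> and \<open>Y\<close>, the bilinear form restricted to that set has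
  \<open>L\<^sup>\<infinity>\<close> norm at most \<open>(X Y)\<^bsup>1/2\<^esup>\<close> and \<open>L\<^sup>2\<close> norm at most \<open>min(X, Y)\<^bsup>1/2\<^esup>\<close> by Cauchy-Schwarz. Locally the slices
  are of order \<open>\<lambda>\<close> where the corresponding partial derivative is nonzero, \<open>\<lambda>\<^bsup>1/2\<^esup>\<close> where the pure second
  derivative is nonzero, and empty for small \<open>\<lambda>\<close> away from the zero set. The \<open>L\<^sup>q\<close> norms of the pieces, obtained
  by interpolating between \<open>L\<^sup>2\<close> and \<open>L\<^sup>\<infinity>\<close>, form a geometric series; interpolating before summing
  is what avoids a logarithm for finite \<open>q\<close> in case (d).
\<close>

subsection \<open>Square integrable functions\<close>

text \<open>\<open>FT\<close> and \<open>eprop\<close> are arbitrary choices (\<open>SOME\<close>),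
  constrained only by L2 limits of truncated integrals. Nothing can be computed from them before
  existence, almost everywhere uniqueness and inversion of the transform are available; inversion
  then replaces them by an explicit absolutely convergent integral. No curve is ever parametrised.
  The geometry enters through two exponents at each point of the support, made uniform by
  compactness: powers of \<lambda> bounding the squared sup norm (\<delta>, the sum of the two slice
  powers) and the squared L2 norm (\<gamma>, the larger of them). With e = (1 - 2/q) \<delta>/2 +
  (2/q) \<gamma>/2, the piece where |\<phi>| ~ 2^-i carries a symbol of size 2^i and contributes
  2^(i(1 - e)); the decomposition stops at 2^i ~ t, where the bound |M| <= t |m| takes over. For
  large t the sum is therefore of order t^(1 - e), log t or 1 as e < 1, e = 1 or e > 1. The pairs
  (\<delta>, \<gamma>) = (1, 1/2), (2, 1), (3/2, 1), (1, 1) give (c), (d), (e), (f).\<close>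

definition sqint :: "('a::euclidean_space \<Rightarrow> complex) \<Rightarrow> ennreal" where
  "sqint f = (\<integral>\<^sup>+x. ennreal ((cmod (f x))\<^sup>2) \<partial>lborel)"

lemma L2_iff: "L2 f \<longleftrightarrow> f \<in> borel_measurable borel \<and> sqint f < \<infinity>"
  unfolding L2_def sqint_def
  by (auto simp: integrable_iff_bounded)

lemma L2norm_nonneg [simp]: "L2norm f \<ge> 0"
  by (simp add: L2norm_def)

lemma sqint_L2norm: "L2 f \<Longrightarrow> sqint f = ennreal ((L2norm f)\<^sup>2)"
  unfolding sqint_def L2norm_def
  by (subst nn_integral_eq_integral) (auto simp: L2_def)

lemma sqint_cmult:
  assumes [measurable]: "f \<in> borel_measurable borel"
  shows "sqint (\<lambda>x. c * f x) = ennreal ((cmod c)\<^sup>2) * sqint f"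
  unfolding sqint_def
  by (simp add: norm_mult power_mult_distrib ennreal_mult nn_integral_cmult)

lemma sqint_add_le:
  assumes [measurable]: "f \<in> borel_measurable borel" "g \<in> borel_measurable borel"
  shows "sqint (\<lambda>x. f x + g x) \<le> 2 * sqint f + 2 * sqint g"
proof -
  have "ennreal ((cmod (f x + g x))\<^sup>2) \<le> 2 * ennreal ((cmod (f x))\<^sup>2) + 2 * ennreal ((cmod (g x))\<^sup>2)" for x
  proof -
    have "(cmod (f x + g x))\<^sup>2 \<le> (cmod (f x) + cmod (g x))\<^sup>2"
      by (intro power_mono norm_triangle_ineq) auto
    also have "\<dots> \<le> 2 * (cmod (f x))\<^sup>2 + 2 * (cmod (g x))\<^sup>2"
      using sum_squares_bound[of "cmod (f x)" "cmod (g x)"] by (simp add: power2_sum)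
    finally show ?thesis
      by (simp flip: ennreal_plus ennreal_mult add: ennreal_leI ennreal_mult'[symmetric] flip: ennreal_numeral)
  qed
  then have "sqint (\<lambda>x. f x + g x) \<le> (\<integral>\<^sup>+x. 2 * ennreal ((cmod (f x))\<^sup>2) + 2 * ennreal ((cmod (g x))\<^sup>2) \<partial>lborel)"
    unfolding sqint_def by (intro nn_integral_mono)
  also have "\<dots> = 2 * sqint f + 2 * sqint g"
    unfolding sqint_def by (subst nn_integral_add) (auto simp: nn_integral_cmult)
  finally show ?thesis .
qed

lemma L2_cmult: "L2 f \<Longrightarrow> L2 (\<lambda>x. c * f x)"
  by (auto simp: L2_iff sqint_cmult ennreal_mult_less_top)

lemma L2_add:
  assumes "L2 f" "L2 g" shows "L2 (\<lambda>x. f x + g x)"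
proof -
  have "sqint (\<lambda>x. f x + g x) \<le> 2 * sqint f + 2 * sqint g"
    using assms by (intro sqint_add_le) (auto simp: L2_iff)
  also have "\<dots> < \<infinity>" using assms by (auto simp: L2_iff ennreal_mult_less_top)
  finally show ?thesis using assms by (auto simp: L2_iff)
qed

lemma L2_diff: "L2 f \<Longrightarrow> L2 g \<Longrightarrow> L2 (\<lambda>x. f x - g x)"
  using L2_add[of f "\<lambda>x. (-1) * g x"] L2_cmult[of g "-1"] by simp

lemma L2_cnj:
  assumes "L2 f" shows "L2 (\<lambda>x. cnj (f x))"
proof -
  have "(\<lambda>x. cnj (f x)) \<in> borel_measurable borel"
    using assms by (intro borel_measurable_continuous_on[where f = cnj] continuous_intros) (simp add: L2_iff)
  then show ?thesis using assms by (simp add: L2_iff sqint_def)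
qed

lemma integrable_L2_mult:
  assumes "L2 f" "L2 g" shows "integrable lborel (\<lambda>x. f x * g x)"
proof (rule Bochner_Integration.integrable_bound)
  show "integrable lborel (\<lambda>x. (cmod (f x))\<^sup>2 + (cmod (g x))\<^sup>2)"
    using assms by (auto simp: L2_def)
  show "AE x in lborel. norm (f x * g x) \<le> norm ((cmod (f x))\<^sup>2 + (cmod (g x))\<^sup>2)"
  proof (rule AE_I2)
    fix x
    have "0 \<le> cmod (f x) * cmod (g x)" by simp
    then have "cmod (f x) * cmod (g x) \<le> (cmod (f x))\<^sup>2 + (cmod (g x))\<^sup>2"
      using sum_squares_bound[of "cmod (f x)" "cmod (g x)"] by linarith
    then show "norm (f x * g x) \<le> norm ((cmod (f x))\<^sup>2 + (cmod (g x))\<^sup>2)"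
      by (simp add: norm_mult)
  qed
qed (use assms in \<open>auto simp: L2_def\<close>)

lemma L2norm_power2: "L2 f \<Longrightarrow> (L2norm f)\<^sup>2 = (LBINT x. (cmod (f x))\<^sup>2)"
  unfolding L2norm_def by simp

lemma integral_Re_mult_cnj_le:
  assumes "L2 f" "L2 g"
  shows "(LBINT x. Re (f x * cnj (g x))) \<le> L2norm f * L2norm g"
proof -
  have [measurable]: "f \<in> borel_measurable borel" "g \<in> borel_measurable borel"
    using assms by (auto simp: L2_iff)
  have g': "L2 (\<lambda>x. cnj (g x))" by (rule L2_cnj[OF assms(2)])
  have int: "integrable lborel (\<lambda>x. f x * cnj (g x))" by (rule integrable_L2_mult[OF assms(1) g'])
  have "(LBINT x. Re (f x * cnj (g x))) \<le> (LBINT x. cmod (f x) * cmod (g x))"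
  proof (rule integral_mono)
    show "integrable lborel (\<lambda>x. Re (f x * cnj (g x)))" using int by (rule integrable_Re)
    show "integrable lborel (\<lambda>x. cmod (f x) * cmod (g x))"
      using integrable_norm[OF int] by (simp add: norm_mult)
    show "Re (f x * cnj (g x)) \<le> cmod (f x) * cmod (g x)" for x
      using complex_Re_le_cmod[of "f x * cnj (g x)"] by (simp add: norm_mult)
  qed
  also have "(LBINT x. cmod (f x) * cmod (g x)) \<le> L2norm f * L2norm g"
  proof (rule power2_le_imp_le)
    have "ennreal (LBINT x. cmod (f x) * cmod (g x)) = (\<integral>\<^sup>+x. ennreal (cmod (f x)) * ennreal (cmod (g x)) \<partial>lborel)"
      using integrable_norm[OF int] by (subst nn_integral_eq_integral[symmetric]) (auto simp: norm_mult ennreal_mult)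
    then have "(ennreal (LBINT x. cmod (f x) * cmod (g x)))\<^sup>2
       \<le> (\<integral>\<^sup>+x. (ennreal (cmod (f x)))^2 \<partial>lborel) * (\<integral>\<^sup>+x. (ennreal (cmod (g x)))^2 \<partial>lborel)"
      using Cauchy_Schwarz_nn_integral[of "\<lambda>x. ennreal (cmod (f x))" lborel "\<lambda>x. ennreal (cmod (g x))"] by simp
    also have "\<dots> = ennreal ((L2norm f * L2norm g)\<^sup>2)"
      using sqint_L2norm[OF assms(1)] sqint_L2norm[OF assms(2)]
      by (simp add: sqint_def ennreal_power power_mult_distrib ennreal_mult)
    finally show "(LBINT x. cmod (f x) * cmod (g x))\<^sup>2 \<le> (L2norm f * L2norm g)\<^sup>2"
      by (subst (asm) ennreal_power) auto
  qed simp
  finally show ?thesis .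
qed

lemma L2norm_triangle:
  assumes "L2 f" "L2 g"
  shows "L2norm (\<lambda>x. f x + g x) \<le> L2norm f + L2norm g"
proof (rule power2_le_imp_le)
  have g': "L2 (\<lambda>x. cnj (g x))" by (rule L2_cnj[OF assms(2)])
  have int: "integrable lborel (\<lambda>x. Re (f x * cnj (g x)))"
    by (intro integrable_Re integrable_L2_mult assms g')
  have "(L2norm (\<lambda>x. f x + g x))\<^sup>2 = (LBINT x. (cmod (f x))\<^sup>2 + (cmod (g x))\<^sup>2 + 2 * Re (f x * cnj (g x)))"
    unfolding L2norm_power2[OF L2_add[OF assms]] by (intro Bochner_Integration.integral_cong refl)
      (simp only: cmod_power2, simp add: power2_eq_square algebra_simps)
  also have "\<dots> = (L2norm f)\<^sup>2 + (L2norm g)\<^sup>2 + 2 * (LBINT x. Re (f x * cnj (g x)))"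
    using assms int by (simp add: L2norm_power2 L2_def del: times_complex.sel)
  also have "\<dots> \<le> (L2norm f + L2norm g)\<^sup>2"
    using integral_Re_mult_cnj_le[OF assms] by (simp add: power2_sum)
  finally show "(L2norm (\<lambda>x. f x + g x))\<^sup>2 \<le> (L2norm f + L2norm g)\<^sup>2" .
qed simp

lemma L2norm_minus_commute: "L2norm (\<lambda>x. f x - g x) = L2norm (\<lambda>x. g x - f x)"
  unfolding L2norm_def by (simp add: norm_minus_commute)

lemma L2norm_diff_abs:
  assumes "L2 f" "L2 g"
  shows "\<bar>L2norm f - L2norm g\<bar> \<le> L2norm (\<lambda>x. f x - g x)"
  using L2norm_triangle[OF L2_diff[OF assms] assms(2)] L2norm_triangle[OF L2_diff[OF assms(2,1)] assms(1)]
  by (simp add: L2norm_minus_commute[of f])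

text \<open>This is the reverse triangle inequality, applied to the real numbers
  \<open>L2norm\<close> because differences of \<open>ennreal\<close> values are truncated at
  0.\<close>

lemma sqint_tendsto:
  assumes f: "L2 f" and g: "\<And>n. L2 (g n)" and lim: "(\<lambda>n. sqint (\<lambda>x. f x - g n x)) \<longlonglongrightarrow> 0"
  shows "(\<lambda>n. sqint (g n)) \<longlonglongrightarrow> sqint f"
proof -
  have "(\<lambda>n. ennreal ((L2norm (\<lambda>x. f x - g n x))\<^sup>2)) \<longlonglongrightarrow> ennreal 0"
    using lim sqint_L2norm[OF L2_diff[OF f g]] by simp
  then have "(\<lambda>n. (L2norm (\<lambda>x. f x - g n x))\<^sup>2) \<longlonglongrightarrow> 0"
    by (subst (asm) tendsto_ennreal_iff) auto
  then have "(\<lambda>n. L2norm (\<lambda>x. f x - g n x)) \<longlonglongrightarrow> 0"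
    using tendsto_real_sqrt by fastforce
  then have "(\<lambda>n. L2norm f - L2norm (g n)) \<longlonglongrightarrow> 0"
    by (rule Lim_null_comparison[rotated]) (use L2norm_diff_abs[OF f g] in auto)
  from tendsto_diff[OF tendsto_const[of "L2norm f"] this] have "(\<lambda>n. L2norm (g n)) \<longlonglongrightarrow> L2norm f" by simp
  then show ?thesis
    unfolding sqint_L2norm[OF f] sqint_L2norm[OF g] by (intro tendsto_ennrealI tendsto_power)
qed

text \<open>The integrand is dominated by \<open>B\<close> times a product of integrable functions.
  Every exchange of oscillatory integrals below is an instance, with an exponential as kernel and
  \<open>B\<close> equal to 1.\<close>

lemma fubini_kernel:
  fixes p :: "'a::euclidean_space \<Rightarrow> complex" and q :: "'b::euclidean_space \<Rightarrow> complex" and k :: "'a \<Rightarrow> 'b \<Rightarrow> complex"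
  assumes p: "integrable lborel p" and q: "integrable lborel q"
    and k[measurable]: "(\<lambda>z. k (fst z) (snd z)) \<in> borel_measurable (borel \<Otimes>\<^sub>M borel)" and B: "\<And>x y. cmod (k x y) \<le> B"
  shows "(LBINT x. p x * (LBINT y. k x y * q y)) = (LBINT y. q y * (LBINT x. k x y * p x))"
proof -
  have [measurable]: "p \<in> borel_measurable borel" "q \<in> borel_measurable borel" using p q by auto
  have "integrable (lborel \<Otimes>\<^sub>M lborel) (\<lambda>(x, y). p x * q y * k x y)"
  proof (rule Bochner_Integration.integrable_bound)
    show "integrable (lborel \<Otimes>\<^sub>M lborel) (\<lambda>(x, y). B *\<^sub>R (p x * q y))"
    proof (rule lborel_pair.Fubini_integrable)
      have "integrable lborel (\<lambda>x. cmod (p x) * (\<bar>B\<bar> * (LBINT y. cmod (q y))))"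
        using p by (intro integrable_mult_left integrable_norm)
      then show "integrable lborel (\<lambda>x. LBINT y. norm (case (x, y) of (x, y) \<Rightarrow> B *\<^sub>R (p x * q y)))"
        by (simp add: norm_mult mult_ac)
      show "AE x in lborel. integrable lborel (\<lambda>y. case (x, y) of (x, y) \<Rightarrow> B *\<^sub>R (p x * q y))"
        using q by auto
    qed measurable
    show "AE x in lborel \<Otimes>\<^sub>M lborel. norm (case x of (x, y) \<Rightarrow> p x * q y * k x y) \<le> norm (case x of (x, y) \<Rightarrow> B *\<^sub>R (p x * q y))"
    proof (intro AE_I2, clarsimp simp: norm_mult)
      fix x y show "cmod (p x) * cmod (q y) * cmod (k x y) \<le> \<bar>B\<bar> * (cmod (p x) * cmod (q y))"
        using B[of x y] by (subst mult.commute) (intro mult_right_mono, auto)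
    qed
  qed (use k in \<open>simp add: case_prod_beta\<close>)
  then have "(LBINT y. (LBINT x. p x * q y * k x y)) = (LBINT x. (LBINT y. p x * q y * k x y))"
    by (rule lborel_pair.Fubini_integral)
  moreover have "(LBINT x. p x * q y * k x y) = q y * (LBINT x. k x y * p x)" for y
    by (subst integral_mult_right_zero[symmetric]) (simp add: mult_ac)
  moreover have "(LBINT y. p x * q y * k x y) = p x * (LBINT y. k x y * q y)" for x
    by (subst integral_mult_right_zero[symmetric]) (simp add: mult_ac)
  ultimately show ?thesis by simp
qed

text \<open>The normalisation is that of \<open>fourier_L2\<close>, without a power of 2 pi. Hence
  the factor 2 pi in Plancherel, and the inverse transform of \<open>H\<close> is
  \<open>fourier_int H (- x)\<close> divided by 2 pi.\<close>

definition fourier_int :: "(real \<Rightarrow> complex) \<Rightarrow> real \<Rightarrow> complex" where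
  "fourier_int f \<xi> = (LBINT x. exp (- \<i> * of_real (x * \<xi>)) * f x)"

lemma fourier_int_measurable [measurable]:
  assumes [measurable]: "f \<in> borel_measurable borel"
  shows "fourier_int f \<in> borel_measurable borel"
  unfolding fourier_int_def by measurable

lemma fourier_int_integrable: "integrable lborel f \<Longrightarrow> integrable lborel (\<lambda>x. exp (- \<i> * of_real (x * \<xi>)) * f x)"
  by (rule Bochner_Integration.integrable_bound[of _ f]) (auto simp: norm_mult)

lemma fourier_int_norm_le: "cmod (fourier_int f \<xi>) \<le> (LBINT x. cmod (f x))"
  unfolding fourier_int_def by (rule order_trans[OF integral_norm_bound]) (simp add: norm_mult)

lemma fourier_int_diff: "integrable lborel f \<Longrightarrow> integrable lborel g \<Longrightarrow> fourier_int (\<lambda>x. f x - g x) \<xi> = fourier_int f \<xi> - fourier_int g \<xi>"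
  unfolding fourier_int_def Bochner_Integration.integral_diff[OF fourier_int_integrable fourier_int_integrable, symmetric]
  by (simp only: right_diff_distrib)

subsection \<open>The Plancherel identity\<close>

lemma borel_measurable_cnj [measurable (raw)]:
  "f \<in> borel_measurable M \<Longrightarrow> (\<lambda>x. cnj (f x)) \<in> borel_measurable M"
  by (intro borel_measurable_continuous_on[where f = cnj] continuous_intros)

text \<open>Rescaling by \<open>s\<close> turns the integral into the characteristic function of the
  standard normal law at -z/s.\<close>

lemma gauss_FT:
  assumes "0 < s"
  shows "(LBINT \<xi>. exp (- \<i> * of_real (\<xi> * z)) * of_real (exp (- (s * \<xi>)\<^sup>2 / 2)))
     = of_real (sqrt (2 * pi) / s * exp (- (z / s)\<^sup>2 / 2))"
proof -
  have "(LBINT \<xi>. exp (- \<i> * of_real (\<xi> * z)) * of_real (exp (- (s * \<xi>)\<^sup>2 / 2)))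
      = (1 / s) *\<^sub>R (LBINT u. exp (- \<i> * of_real (u / s * z)) * of_real (exp (- u\<^sup>2 / 2)))"
    using assms by (subst lborel_integral_real_affine[where c="1 / s" and t=0]) auto
  also have "(LBINT u. exp (- \<i> * of_real (u / s * z)) * of_real (exp (- u\<^sup>2 / 2)))
      = sqrt (2 * pi) * (LBINT u. std_normal_density u *\<^sub>R exp (\<i> * of_real (- z / s) * of_real u))"
    by (subst integral_mult_right_zero[symmetric], intro Bochner_Integration.integral_cong refl)
       (simp add: std_normal_density_def scaleR_conv_of_real field_simps)
  also have "(LBINT u. std_normal_density u *\<^sub>R exp (\<i> * of_real (- z / s) * of_real u)) = char std_normal_distribution (- z / s)"
    unfolding char_def by (subst integral_density) (auto simp: mult.assoc)
  also have "\<dots> = of_real (exp (- (z / s)\<^sup>2 / 2))"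
    by (simp add: char_std_normal_distribution power_divide)
  finally show ?thesis by (simp add: scaleR_conv_of_real)
qed

lemma gauss_integrable:
  assumes "0 < s" shows "integrable lborel (\<lambda>x::real. exp (- (s * x)\<^sup>2 / 2))"
proof -
  have "integrable lborel (\<lambda>u. sqrt (2 * pi) * std_normal_density u)"
    by (intro integrable_mult_right integrable_normal_density) simp
  then have "integrable lborel (\<lambda>u::real. exp (- u\<^sup>2 / 2))"
    by (simp add: std_normal_density_def)
  from lborel_integrable_real_affine[OF this, of s 0] assms show ?thesis by simp
qed

lemma gauss_integral: "(LBINT u. exp (- (u::real)\<^sup>2 / 2)) = sqrt (2 * pi)"
  using gauss_FT[of 1 0] by (simp flip: of_real_eq_iff[where 'a=complex] integral_complex_of_real add: exp_of_real)

text \<open>The square of the transform is damped by a wide Gaussian. Fubini then rewrites the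
  damped integral as a double integral of f(x) times the conjugate of f(y) against a Gaussian
  concentrating on x = y, and the damping is removed in the limit.\<close>

lemma plancherel_continuous:
  fixes f :: "real \<Rightarrow> complex"
  assumes cont: "continuous_on UNIV f" and supp: "\<And>x. \<bar>x\<bar> > R \<Longrightarrow> f x = 0"
  shows "sqint (fourier_int f) = ennreal (2 * pi) * sqint f"
proof -
  have [measurable]: "f \<in> borel_measurable borel" by (rule borel_measurable_continuous_onI[OF cont])
  obtain B where B: "\<And>x. cmod (f x) \<le> B"
  proof -
    have "compact (f ` {-R..R})" by (intro compact_continuous_image continuous_on_subset[OF cont]) auto
    then have "bounded (f ` {-R..R})" by (rule compact_imp_bounded)
    then obtain b where b: "b > 0" "\<And>x. x \<in> {-R..R} \<Longrightarrow> cmod (f x) \<le> b"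
      unfolding bounded_pos by blast
    have "x \<notin> {-R..R} \<Longrightarrow> f x = 0" for x using supp[of x] by (auto simp: abs_if)
    with b show thesis by (intro that[of b]) (metis norm_zero less_imp_le)
  qed
  have B0: "B \<ge> 0" using B[of 0] norm_ge_zero order_trans by blast
  have int: "integrable lborel f"
  proof (rule Bochner_Integration.integrable_bound)
    show "integrable lborel (\<lambda>x. indicator {-R..R} x * B)"
      by (intro integrable_mult_left integrable_real_indicator) (auto simp: emeasure_lborel_Icc_eq)
    show "AE x in lborel. norm (f x) \<le> norm (indicator {-R..R} x * B)"
    proof (rule AE_I2)
      fix x show "norm (f x) \<le> norm (indicator {-R..R} x * B)"
        using B[of x] supp[of x] B0 by (cases "\<bar>x\<bar> \<le> R") (auto simp: indicator_def)
    qed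
  qed simp
  have intc: "integrable lborel (\<lambda>x. cnj (f x))" using int by simp
  have L2: "L2 f"
    unfolding L2_def
  proof
    have "integrable lborel (\<lambda>x. cmod (f x) * cmod (f x))"
      by (rule Bochner_Integration.integrable_bound[of _ "\<lambda>x. B *\<^sub>R f x"])
         (use int B B0 in \<open>auto intro!: mult_right_mono\<close>)
    then show "integrable lborel (\<lambda>x. (cmod (f x))\<^sup>2)" by (simp add: power2_eq_square)
  qed simp
  \<comment> \<open>After Fubini the Gaussian weight has become a kernel in x - y; the substitution
    y = x - s u freezes that kernel and moves \<open>s\<close> into the argument of
    \<open>f\<close>, where continuity can act.\<close>
  have key: "(\<integral>\<^sup>+\<xi>. ennreal ((cmod (fourier_int f \<xi>))\<^sup>2 * exp (- (s * \<xi>)\<^sup>2 / 2)) \<partial>lborel)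
     = ennreal (sqrt (2 * pi) * Re (LBINT x. LBINT u. f x * cnj (f (x - s * u)) * of_real (exp (- u\<^sup>2 / 2))))"
    if s: "0 < s" for s
  proof -
    let ?w = "\<lambda>\<xi>. of_real (exp (- (s * \<xi>)\<^sup>2 / 2)) :: complex"
    let ?g = "\<lambda>x y. of_real (sqrt (2 * pi) / s * exp (- ((x - y) / s)\<^sup>2 / 2)) :: complex"
    have w: "integrable lborel ?w" using gauss_integrable[OF s] by (rule integrable_of_real)
    have wF: "integrable lborel (\<lambda>\<xi>. ?w \<xi> * cnj (fourier_int f \<xi>))"
      by (rule Bochner_Integration.integrable_bound[of _ "\<lambda>\<xi>. (LBINT x. cmod (f x)) *\<^sub>R ?w \<xi>"])
         (use w fourier_int_norm_le[of f] in \<open>auto simp: norm_mult mult.commute intro!: mult_right_mono integrable_scaleR_right\<close>)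
    have fub1: "(LBINT \<xi>. (?w \<xi> * cnj (fourier_int f \<xi>)) * fourier_int f \<xi>)
      = (LBINT x. f x * (LBINT \<xi>. exp (- \<i> * of_real (x * \<xi>)) * (?w \<xi> * cnj (fourier_int f \<xi>))))"
      unfolding fourier_int_def[of f] by (rule fubini_kernel[of _ _ _ 1, OF wF[unfolded fourier_int_def] int]) simp_all
    have fub2: "(LBINT \<xi>. exp (- \<i> * of_real (x * \<xi>)) * (?w \<xi> * cnj (fourier_int f \<xi>)))
      = (LBINT y. cnj (f y) * ?g x y)" for x
    proof -
      have "integrable lborel (\<lambda>\<xi>. exp (- \<i> * of_real (x * \<xi>)) * ?w \<xi>)"
        by (rule Bochner_Integration.integrable_bound[OF w]) (auto simp: norm_mult)
      from fubini_kernel[OF this intc, of "\<lambda>\<xi> y. exp (\<i> * of_real (y * \<xi>))" 1]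
      have "(LBINT \<xi>. (exp (- \<i> * of_real (x * \<xi>)) * ?w \<xi>) * (LBINT y. exp (\<i> * of_real (y * \<xi>)) * cnj (f y)))
        = (LBINT y. cnj (f y) * (LBINT \<xi>. exp (\<i> * of_real (y * \<xi>)) * (exp (- \<i> * of_real (x * \<xi>)) * ?w \<xi>)))"
        by simp
      also have "(\<lambda>\<xi>. (LBINT y. exp (\<i> * of_real (y * \<xi>)) * cnj (f y))) = (\<lambda>\<xi>. cnj (fourier_int f \<xi>))"
      proof
        fix \<xi>
        have "(\<lambda>y. exp (\<i> * of_real (y * \<xi>)) * cnj (f y)) = (\<lambda>y. cnj (exp (- \<i> * of_real (y * \<xi>)) * f y))"
          by (simp add: exp_cnj)
        then show "(LBINT y. exp (\<i> * of_real (y * \<xi>)) * cnj (f y)) = cnj (fourier_int f \<xi>)"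
          unfolding fourier_int_def by (simp only: Bochner_Integration.integral_cnj)
      qed
      also have "(\<lambda>y. LBINT \<xi>. exp (\<i> * of_real (y * \<xi>)) * (exp (- \<i> * of_real (x * \<xi>)) * ?w \<xi>))
        = (\<lambda>y. ?g x y)"
      proof
        fix y
        have "\<i> * of_real (y * \<xi>) + - \<i> * of_real (x * \<xi>) = - \<i> * of_real (\<xi> * (x - y))" for \<xi> :: real
          by (simp add: algebra_simps)
        then have "exp (\<i> * of_real (y * \<xi>)) * (exp (- \<i> * of_real (x * \<xi>)) * ?w \<xi>) = exp (- \<i> * of_real (\<xi> * (x - y))) * ?w \<xi>" for \<xi>
          by (simp only: mult.assoc[symmetric] exp_add[symmetric])
        then show "(LBINT \<xi>. exp (\<i> * of_real (y * \<xi>)) * (exp (- \<i> * of_real (x * \<xi>)) * ?w \<xi>))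
          = ?g x y"
          by (simp only: gauss_FT[OF s])
      qed
      finally show ?thesis by (simp only: mult.assoc)
    qed
    have sub: "(LBINT y. cnj (f y) * ?g x y)
      = of_real (sqrt (2 * pi)) * (LBINT u. cnj (f (x - s * u)) * of_real (exp (- u\<^sup>2 / 2)))" for x
    proof -
      have "(LBINT y. cnj (f y) * ?g x y)
        = s *\<^sub>R (LBINT u. cnj (f (x - s * u)) * of_real (sqrt (2 * pi) / s * exp (- u\<^sup>2 / 2)))"
        using s by (subst lborel_integral_real_affine[where c="- s" and t=x]) simp_all
      also have "\<dots> = (LBINT u. of_real s * (cnj (f (x - s * u)) * of_real (sqrt (2 * pi) / s * exp (- u\<^sup>2 / 2))))"
        by (simp only: scaleR_conv_of_real integral_mult_right_zero)
      also have "\<dots> = (LBINT u. of_real (sqrt (2 * pi)) * (cnj (f (x - s * u)) * of_real (exp (- u\<^sup>2 / 2))))"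
        using s by (intro Bochner_Integration.integral_cong refl) (simp add: field_simps)
      finally show ?thesis by (simp only: integral_mult_right_zero)
    qed
    have "(LBINT \<xi>. of_real ((cmod (fourier_int f \<xi>))\<^sup>2 * exp (- (s * \<xi>)\<^sup>2 / 2))) = (LBINT \<xi>. (?w \<xi> * cnj (fourier_int f \<xi>)) * fourier_int f \<xi>)"
      by (intro Bochner_Integration.integral_cong refl) (simp only: of_real_mult complex_norm_square mult_ac)
    also have "\<dots> = of_real (sqrt (2 * pi)) * (LBINT x. LBINT u. f x * cnj (f (x - s * u)) * of_real (exp (- u\<^sup>2 / 2)))"
      unfolding fub1 fub2 sub
      by (subst integral_mult_right_zero[symmetric])+ (simp add: mult_ac)
    finally have "(LBINT \<xi>. (cmod (fourier_int f \<xi>))\<^sup>2 * exp (- (s * \<xi>)\<^sup>2 / 2)) = sqrt (2 * pi) * Re (LBINT x. LBINT u. f x * cnj (f (x - s * u)) * of_real (exp (- u\<^sup>2 / 2)))"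
      by (subst (asm) integral_complex_of_real, drule_tac arg_cong[where f = Re]) simp
    moreover have "integrable lborel (\<lambda>\<xi>. (cmod (fourier_int f \<xi>))\<^sup>2 * exp (- (s * \<xi>)\<^sup>2 / 2))"
    proof (rule Bochner_Integration.integrable_bound)
      show "integrable lborel (\<lambda>\<xi>. (LBINT x. cmod (f x))\<^sup>2 * exp (- (s * \<xi>)\<^sup>2 / 2))"
        by (intro integrable_mult_right gauss_integrable s)
    qed (auto intro!: mult_right_mono power_mono fourier_int_norm_le simp: abs_mult)
    ultimately show ?thesis by (subst nn_integral_eq_integral) auto
  qed
  define s where "s n = 1 / real (Suc n)" for n
  have s0: "0 < s n" for n by (simp add: s_def)
  have slim: "s \<longlonglongrightarrow> 0" unfolding s_def using LIMSEQ_inverse_real_of_nat by (simp add: inverse_eq_divide)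
  let ?k = "\<lambda>n x u. f x * cnj (f (x - s n * u)) * of_real (exp (- u\<^sup>2 / 2))"
  \<comment> \<open>As \<open>s n\<close> decreases the Gaussians increase to 1, so monotone
    convergence applies although the transform is not yet known to be square integrable.\<close>
  have incs: "incseq (\<lambda>n \<xi>. ennreal ((cmod (fourier_int f \<xi>))\<^sup>2 * exp (- (s n * \<xi>)\<^sup>2 / 2)))"
  proof (intro incseq_SucI le_funI ennreal_leI mult_left_mono)
    fix n \<xi>
    have "(s (Suc n) * \<xi>)\<^sup>2 \<le> (s n * \<xi>)\<^sup>2"
      unfolding power_mult_distrib by (intro mult_right_mono power_mono) (auto simp: s_def field_simps)
    then show "exp (- (s n * \<xi>)\<^sup>2 / 2) \<le> exp (- (s (Suc n) * \<xi>)\<^sup>2 / 2)" by simp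
  qed auto
  have "(\<lambda>n. \<integral>\<^sup>+\<xi>. ennreal ((cmod (fourier_int f \<xi>))\<^sup>2 * exp (- (s n * \<xi>)\<^sup>2 / 2)) \<partial>lborel) \<longlonglongrightarrow> sqint (fourier_int f)"
    unfolding sqint_def
  proof (rule nn_integral_LIMSEQ[OF incs])
    fix \<xi> show "(\<lambda>n. ennreal ((cmod (fourier_int f \<xi>))\<^sup>2 * exp (- (s n * \<xi>)\<^sup>2 / 2))) \<longlonglongrightarrow> ennreal ((cmod (fourier_int f \<xi>))\<^sup>2)"
      by (intro tendsto_ennrealI) (rule tendsto_eq_intros slim refl | simp)+
  qed measurable
  moreover have "(\<lambda>n. \<integral>\<^sup>+\<xi>. ennreal ((cmod (fourier_int f \<xi>))\<^sup>2 * exp (- (s n * \<xi>)\<^sup>2 / 2)) \<partial>lborel) \<longlonglongrightarrow> ennreal (2 * pi) * sqint f"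
  proof -
    \<comment> \<open>Two dominated convergences are nested: here at fixed x, dominated by B^2 times
      the Gaussian, and then in x, dominated by a multiple of |f|.\<close>
    have inn: "(\<lambda>n. LBINT u. ?k n x u)
        \<longlonglongrightarrow> (LBINT u. f x * cnj (f x) * of_real (exp (- u\<^sup>2 / 2)))" for x
    proof (rule integral_dominated_convergence)
      show "integrable lborel (\<lambda>u. B * B * exp (- u\<^sup>2 / 2))"
        using gauss_integrable[of 1] by (intro integrable_mult_right) auto
      show "AE u in lborel. (\<lambda>n. ?k n x u) \<longlonglongrightarrow> f x * cnj (f x) * of_real (exp (- u\<^sup>2 / 2))"
      proof (rule AE_I2)
        fix u
        have "(\<lambda>n. x - s n * u) \<longlonglongrightarrow> x - 0 * u" by (intro tendsto_intros slim)
        then have "(\<lambda>n. f (x - s n * u)) \<longlonglongrightarrow> f x"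
          using cont by (intro continuous_on_tendsto_compose[where s=UNIV and f=f]) auto
        then show "(\<lambda>n. ?k n x u) \<longlonglongrightarrow> f x * cnj (f x) * of_real (exp (- u\<^sup>2 / 2))"
          by (intro tendsto_intros)
      qed
      show "AE u in lborel. norm (?k n x u) \<le> B * B * exp (- u\<^sup>2 / 2)" for n
        using B B0 by (auto simp: norm_mult intro!: mult_mono)
    qed measurable
    have inner_eq: "(LBINT u. f x * cnj (f x) * of_real (exp (- u\<^sup>2 / 2))) = of_real (sqrt (2 * pi)) * (f x * cnj (f x))" for x
      by (subst integral_mult_right_zero, subst integral_complex_of_real, subst gauss_integral) simp
    have "(\<lambda>n. LBINT x. LBINT u. ?k n x u)
        \<longlonglongrightarrow> (LBINT x. of_real (sqrt (2 * pi)) * (f x * cnj (f x)))"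
    proof (rule integral_dominated_convergence)
      show "integrable lborel (\<lambda>x. cmod (f x) * (B * sqrt (2 * pi)))"
        using int by (intro integrable_mult_left integrable_norm)
      show "AE x in lborel. (\<lambda>n. LBINT u. ?k n x u) \<longlonglongrightarrow> of_real (sqrt (2 * pi)) * (f x * cnj (f x))"
        by (rule AE_I2, rule inn[unfolded inner_eq])
      show "AE x in lborel. norm (LBINT u. ?k n x u) \<le> cmod (f x) * (B * sqrt (2 * pi))" for n
      proof (rule AE_I2)
        fix x
        have "norm (LBINT u. ?k n x u)
          \<le> (LBINT u. (cmod (f x) * B) * exp (- u\<^sup>2 / 2))"
        proof (rule order_trans[OF integral_norm_bound integral_mono'])
          show "integrable lborel (\<lambda>u. (cmod (f x) * B) * exp (- u\<^sup>2 / 2))"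
            by (rule integrable_mult_right) (use gauss_integrable[of 1] in simp)
        qed (use B B0 in \<open>auto simp: norm_mult intro!: mult_right_mono mult_left_mono\<close>)
        also have "\<dots> = cmod (f x) * (B * sqrt (2 * pi))"
          by (simp only: integral_mult_right_zero gauss_integral mult.assoc)
        finally show "norm (LBINT u. ?k n x u) \<le> cmod (f x) * (B * sqrt (2 * pi))" .
      qed
    qed measurable
    \<comment> \<open>Two factors sqrt(2 pi) multiply to 2 pi: one from the transform of the
      Gaussian, one from its total mass.\<close>
    from tendsto_ennrealI[OF tendsto_mult_left[OF tendsto_Re[OF this], of "sqrt (2 * pi)"]]
    have "(\<lambda>n. \<integral>\<^sup>+\<xi>. ennreal ((cmod (fourier_int f \<xi>))\<^sup>2 * exp (- (s n * \<xi>)\<^sup>2 / 2)) \<partial>lborel)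
      \<longlonglongrightarrow> ennreal (sqrt (2 * pi) * Re (LBINT x. of_real (sqrt (2 * pi)) * (f x * cnj (f x))))"
      unfolding key[OF s0] .
    also have "(LBINT x. of_real (sqrt (2 * pi)) * (f x * cnj (f x))) = of_real (sqrt (2 * pi) * (L2norm f)\<^sup>2)"
      unfolding L2norm_power2[OF L2] complex_norm_square[symmetric] by (simp only: integral_mult_right_zero integral_complex_of_real of_real_mult)
    also have "ennreal (sqrt (2 * pi) * Re (of_real (sqrt (2 * pi) * (L2norm f)\<^sup>2))) = ennreal (2 * pi) * sqint f"
      unfolding sqint_L2norm[OF L2] by (simp add: ennreal_mult[symmetric] mult.assoc[symmetric] del: real_sqrt_mult)
    finally show ?thesis .
  qed
  ultimately show ?thesis by (rule LIMSEQ_unique)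
qed

lemma L2_dominated:
  assumes [measurable]: "f \<in> borel_measurable borel" and w: "integrable lborel (\<lambda>x. (w x)\<^sup>2)"
    and bd: "AE x in lborel. cmod (f x) \<le> w x"
  shows "L2 f"
  unfolding L2_def
proof
  show "integrable lborel (\<lambda>x. (cmod (f x))\<^sup>2)"
    by (rule Bochner_Integration.integrable_bound[OF w], measurable) (use bd in \<open>eventually_elim, auto intro: power_mono\<close>)
qed simp

text \<open>The almost everywhere limit inherits the bound \<open>w\<close>, so the squared
  differences are dominated by 4 w^2.\<close>

lemma sqint_dominated_tendsto:
  fixes w :: "real \<Rightarrow> real"
  assumes [measurable]: "f \<in> borel_measurable borel" "\<And>n. g n \<in> borel_measurable borel"
    and w: "integrable lborel (\<lambda>x. (w x)\<^sup>2)" and [measurable]: "w \<in> borel_measurable borel"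
    and bd: "\<And>n x. cmod (g n x) \<le> w x"
    and lim: "AE x in lborel. (\<lambda>n. g n x) \<longlonglongrightarrow> f x"
  shows "(\<lambda>n. sqint (\<lambda>x. f x - g n x)) \<longlonglongrightarrow> 0"
proof -
  have "(\<lambda>n. sqint (\<lambda>x. f x - g n x)) \<longlonglongrightarrow> (\<integral>\<^sup>+x. 0 \<partial>(lborel :: real measure))"
    unfolding sqint_def
  proof (rule nn_integral_dominated_convergence)
    show "AE x in lborel. ennreal ((cmod (f x - g n x))\<^sup>2) \<le> ennreal (4 * (w x)\<^sup>2)" for n
      using lim
    proof eventually_elim
      fix x assume "(\<lambda>n. g n x) \<longlonglongrightarrow> f x"
      then have "cmod (f x) \<le> w x"
        using bd by (intro Lim_bounded[OF tendsto_norm]) auto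
      then have "cmod (f x - g n x) \<le> 2 * w x"
        using bd[of n x] norm_triangle_ineq4[of "f x" "g n x"] by linarith
      then have "(cmod (f x - g n x))\<^sup>2 \<le> (2 * w x)\<^sup>2" by (intro power_mono) auto
      then show "ennreal ((cmod (f x - g n x))\<^sup>2) \<le> ennreal (4 * (w x)\<^sup>2)"
        by (intro ennreal_leI) (simp add: power_mult_distrib)
    qed
    show "(\<integral>\<^sup>+x. ennreal (4 * (w x)\<^sup>2) \<partial>lborel) < \<infinity>"
      by (subst nn_integral_eq_integral) (use w in auto)
    show "AE x in lborel. (\<lambda>i. ennreal ((cmod (f x - g i x))\<^sup>2)) \<longlonglongrightarrow> 0"
      using lim
    proof eventually_elim
      fix x assume "(\<lambda>n. g n x) \<longlonglongrightarrow> f x"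
      then have "(\<lambda>n. ennreal ((cmod (f x - g n x))\<^sup>2)) \<longlonglongrightarrow> ennreal ((cmod (f x - f x))\<^sup>2)"
        by (intro tendsto_intros)
      then show "(\<lambda>i. ennreal ((cmod (f x - g i x))\<^sup>2)) \<longlonglongrightarrow> 0" by simp
    qed
  qed measurable
  then show ?thesis by simp
qed

text \<open>Domination in L1 makes the transforms converge at every point, and Fatou upgrades this
  to L2 convergence. The identity for differences of approximants controls the right-hand side of
  Fatou.\<close>

lemma plancherel_limit:
  fixes w :: "real \<Rightarrow> real"
  assumes [measurable]: "f \<in> borel_measurable borel" "\<And>n. g n \<in> borel_measurable borel"
    and w: "integrable lborel w" and w2: "integrable lborel (\<lambda>x. (w x)\<^sup>2)"
    and bd: "\<And>n x. cmod (g n x) \<le> w x"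
    and lim: "AE x in lborel. (\<lambda>n. g n x) \<longlonglongrightarrow> f x"
    and iso: "\<And>n. sqint (fourier_int (g n)) = ennreal (2 * pi) * sqint (g n)"
    and iso_diff: "\<And>n m. sqint (fourier_int (\<lambda>x. g m x - g n x)) = ennreal (2 * pi) * sqint (\<lambda>x. g m x - g n x)"
  shows "sqint (fourier_int f) = ennreal (2 * pi) * sqint f"
proof -
  have [measurable]: "w \<in> borel_measurable borel" using borel_measurable_integrable[OF w] by simp
  have bdf: "AE x in lborel. cmod (f x) \<le> w x"
    using lim
  proof eventually_elim
    fix x assume "(\<lambda>n. g n x) \<longlonglongrightarrow> f x"
    then show "cmod (f x) \<le> w x" using bd by (intro Lim_bounded[OF tendsto_norm]) auto
  qed
  have f1: "integrable lborel f"
    by (rule Bochner_Integration.integrable_bound[OF w], measurable) (use bdf in \<open>eventually_elim, auto\<close>)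
  have g1: "integrable lborel (g n)" for n
    by (rule Bochner_Integration.integrable_bound[OF w], measurable) (use order_trans[OF bd abs_ge_self] in simp)
  have f2: "L2 f" by (rule L2_dominated[OF _ w2 bdf]) simp
  have g2: "L2 (g n)" for n by (rule L2_dominated[OF _ w2]) (use bd in auto)
  have FIlim: "(\<lambda>n. fourier_int (g n) \<xi>) \<longlonglongrightarrow> fourier_int f \<xi>" for \<xi>
    unfolding fourier_int_def
  proof (rule integral_dominated_convergence[OF _ _ w])
    show "AE x in lborel. (\<lambda>i. exp (- \<i> * of_real (x * \<xi>)) * g i x) \<longlonglongrightarrow> exp (- \<i> * of_real (x * \<xi>)) * f x"
      using lim by eventually_elim (intro tendsto_intros)
  qed (use bd in \<open>auto simp: norm_mult\<close>)
  have lim0: "(\<lambda>n. sqint (\<lambda>x. f x - g n x)) \<longlonglongrightarrow> 0"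
    by (rule sqint_dominated_tendsto[OF _ _ w2]) (use bd lim in auto)
  have FIg2: "L2 (fourier_int (g n))" for n
    using g2[of n] by (auto simp: L2_iff iso ennreal_mult_less_top)
  \<comment> \<open>Fatou in \<open>m\<close> at fixed \<open>n\<close>: the transform of
    \<open>f\<close> is the pointwise limit of the transforms of \<open>g m\<close>.\<close>
  have bound: "sqint (\<lambda>\<xi>. fourier_int f \<xi> - fourier_int (g n) \<xi>) \<le> ennreal (2 * pi) * sqint (\<lambda>x. f x - g n x)" for n
  proof -
    have "sqint (\<lambda>\<xi>. fourier_int f \<xi> - fourier_int (g n) \<xi>) = (\<integral>\<^sup>+\<xi>. liminf (\<lambda>m. ennreal ((cmod (fourier_int (g m) \<xi> - fourier_int (g n) \<xi>))\<^sup>2)) \<partial>lborel)"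
      unfolding sqint_def
    proof (intro nn_integral_cong)
      fix \<xi>
      have "(\<lambda>m. ennreal ((cmod (fourier_int (g m) \<xi> - fourier_int (g n) \<xi>))\<^sup>2)) \<longlonglongrightarrow> ennreal ((cmod (fourier_int f \<xi> - fourier_int (g n) \<xi>))\<^sup>2)"
        by (intro tendsto_intros FIlim)
      then show "ennreal ((cmod (fourier_int f \<xi> - fourier_int (g n) \<xi>))\<^sup>2) = liminf (\<lambda>m. ennreal ((cmod (fourier_int (g m) \<xi> - fourier_int (g n) \<xi>))\<^sup>2))"
        by (intro lim_imp_Liminf[symmetric]) auto
    qed
    also have "\<dots> \<le> liminf (\<lambda>m. sqint (\<lambda>\<xi>. fourier_int (g m) \<xi> - fourier_int (g n) \<xi>))"
      unfolding sqint_def by (intro nn_integral_liminf) measurable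
    also have "(\<lambda>m. sqint (\<lambda>\<xi>. fourier_int (g m) \<xi> - fourier_int (g n) \<xi>)) = (\<lambda>m. ennreal (2 * pi) * sqint (\<lambda>x. g m x - g n x))"
    proof
      fix m
      have "fourier_int (\<lambda>x. g m x - g n x) = (\<lambda>\<xi>. fourier_int (g m) \<xi> - fourier_int (g n) \<xi>)"
        by (rule ext, rule fourier_int_diff[OF g1 g1])
      then show "sqint (\<lambda>\<xi>. fourier_int (g m) \<xi> - fourier_int (g n) \<xi>) = ennreal (2 * pi) * sqint (\<lambda>x. g m x - g n x)"
        by (simp only: iso_diff[symmetric])
    qed
    also have "liminf (\<lambda>m. ennreal (2 * pi) * sqint (\<lambda>x. g m x - g n x)) = ennreal (2 * pi) * sqint (\<lambda>x. f x - g n x)"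
    proof (intro lim_imp_Liminf ennreal_tendsto_cmult)
      show "(\<lambda>m. sqint (\<lambda>x. g m x - g n x)) \<longlonglongrightarrow> sqint (\<lambda>x. f x - g n x)"
        by (rule sqint_tendsto) (use f2 g2 lim0 in \<open>auto intro: L2_diff\<close>)
    qed auto
    finally show ?thesis .
  qed
  have FIlim0: "(\<lambda>n. sqint (\<lambda>\<xi>. fourier_int f \<xi> - fourier_int (g n) \<xi>)) \<longlonglongrightarrow> 0"
  proof (rule tendsto_sandwich[OF _ _ tendsto_const])
    show "(\<lambda>n. ennreal (2 * pi) * sqint (\<lambda>x. f x - g n x)) \<longlonglongrightarrow> 0"
      using ennreal_tendsto_cmult[OF _ lim0, of "ennreal (2 * pi)"] by simp
  qed (use bound in auto)
  \<comment> \<open>The transform of \<open>f\<close> is square integrable because it lies at finite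
    L2 distance from that of \<open>g 0\<close>.\<close>
  have FIf2: "L2 (fourier_int f)"
  proof -
    have "sqint (\<lambda>\<xi>. fourier_int f \<xi> - fourier_int (g 0) \<xi>) < \<infinity>"
      using bound[of 0] L2_diff[OF f2 g2[of 0]] by (auto simp: L2_iff ennreal_mult_less_top intro: le_less_trans)
    then have "L2 (\<lambda>\<xi>. fourier_int f \<xi> - fourier_int (g 0) \<xi>)" by (simp add: L2_iff)
    from L2_add[OF this FIg2[of 0]] show ?thesis by simp
  qed
  have "(\<lambda>n. sqint (fourier_int (g n))) \<longlonglongrightarrow> sqint (fourier_int f)" by (rule sqint_tendsto[OF FIf2 FIg2 FIlim0])
  moreover have "(\<lambda>n. sqint (fourier_int (g n))) \<longlonglongrightarrow> ennreal (2 * pi) * sqint f"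
    unfolding iso by (intro ennreal_tendsto_cmult sqint_tendsto[OF f2 g2 lim0]) auto
  ultimately show ?thesis by (rule LIMSEQ_unique)
qed

text \<open>\<open>measurable_on\<close> provides continuous functions converging off a negligible
  set; passing through the completion turns this into an almost everywhere statement for
  \<open>lborel\<close>.\<close>

lemma measurable_approx_continuous:
  fixes f :: "real \<Rightarrow> complex"
  assumes "f \<in> borel_measurable borel"
  obtains g where "\<And>n::nat. continuous_on UNIV (g n)" "AE x in lborel. (\<lambda>n. g n x) \<longlonglongrightarrow> f x"
proof -
  have "f \<in> borel_measurable lebesgue" using assms by (simp add: measurable_completion)
  then have "f measurable_on UNIV" by (rule lebesgue_measurable_imp_measurable_on) simp
  then obtain N g where N: "negligible N" "\<And>n::nat. continuous_on UNIV (g n)" "\<And>x. x \<notin> N \<Longrightarrow> (\<lambda>n. g n x) \<longlonglongrightarrow> f x"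
    unfolding measurable_on_def by auto
  have "AE x in lebesgue. (\<lambda>n. g n x) \<longlonglongrightarrow> f x"
    by (rule AE_I'[of N]) (use N in \<open>auto simp: negligible_iff_null_sets\<close>)
  then show thesis by (intro that[of g] N(2)) (simp add: AE_completion_iff)
qed

text \<open>The continuous approximants may be unbounded and have unbounded support. Two continuous
  corrections, in height and in space, repair this without changing the limit, since both leave
  \<open>f\<close> fixed.\<close>

lemma plancherel_bounded:
  fixes f :: "real \<Rightarrow> complex"
  assumes [measurable]: "f \<in> borel_measurable borel"
    and bd: "\<And>x. cmod (f x) \<le> M" and supp: "\<And>x. \<bar>x\<bar> > R \<Longrightarrow> f x = 0"
  shows "sqint (fourier_int f) = ennreal (2 * pi) * sqint f"
proof -
  \<comment> \<open>The maximum with 1 keeps \<open>K\<close> positive, as \<open>clip\<close>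
    divides by it.\<close>
  define K where "K = max M 1"
  have K: "K > 0" "\<And>x. cmod (f x) \<le> K" using bd by (auto simp: K_def intro: le_max_iff_disj[THEN iffD2])
  obtain g where g: "\<And>n::nat. continuous_on UNIV (g n)" and lim: "AE x in lborel. (\<lambda>n. g n x) \<longlonglongrightarrow> f x"
    using measurable_approx_continuous[OF assms(1)] by blast
  \<comment> \<open>The radial retraction onto the closed disc of radius \<open>K\<close>; the
    denominator is at least 1, which makes it continuous.\<close>
  define clip where "clip z = (1 / max 1 (cmod z / K)) *\<^sub>R z" for z :: complex
  \<comment> \<open>A piecewise linear cutoff, equal to 1 for |x| <= R and to 0 for |x| >= R +
    1.\<close>
  define cut where "cut x = max 0 (min 1 (R + 1 - \<bar>x\<bar>))" for x :: real
  define h where "h n x = cut x *\<^sub>R clip (g n x)" for n x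
  have clip_cont: "continuous_on UNIV clip"
    unfolding clip_def using K by (intro continuous_intros) (auto simp: max_def)
  have clip_le: "cmod (clip z) \<le> K" for z
    using K by (auto simp: clip_def max_def field_simps)
  have clip_id: "cmod z \<le> K \<Longrightarrow> clip z = z" for z using K by (simp add: clip_def max_def field_simps)
  have cut_cont: "continuous_on UNIV cut" unfolding cut_def by (intro continuous_intros)
  have cut01: "0 \<le> cut x" "cut x \<le> 1" for x by (auto simp: cut_def)
  have h_cont: "continuous_on UNIV (h n)" for n
    unfolding h_def by (intro continuous_intros cut_cont continuous_on_compose2[OF clip_cont] g) auto
  have h_supp: "\<bar>x\<bar> > R + 1 \<Longrightarrow> h n x = 0" for n x by (simp add: h_def cut_def)
  let ?w = "\<lambda>x. indicator {- (R + 1)..R + 1} x * K"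
  have ind: "integrable lborel (\<lambda>x. indicator {- (R + 1)..R + 1} x * c)" for c :: real
    by (intro integrable_mult_left integrable_real_indicator) (auto simp: emeasure_lborel_Icc_eq)
  show ?thesis
  proof (rule plancherel_limit[where g = h and w = ?w])
    show "h n \<in> borel_measurable borel" for n by (rule borel_measurable_continuous_onI[OF h_cont])
    show "integrable lborel (\<lambda>x. (?w x)\<^sup>2)"
    proof -
      have "(\<lambda>x. (?w x)\<^sup>2) = (\<lambda>x. indicator {- (R + 1)..R + 1} x * K\<^sup>2)"
        by (auto simp: indicator_def)
      then show ?thesis by (simp only: ind)
    qed
    show "cmod (h n x) \<le> ?w x" for n x
    proof (cases "\<bar>x\<bar> > R + 1")
      case True then show ?thesis using h_supp[of x n] K by simp
    next
      case False
      then have "x \<in> {- (R + 1)..R + 1}" by auto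
      moreover have "cmod (h n x) \<le> 1 * K"
        unfolding h_def norm_scaleR using cut01[of x] clip_le by (intro mult_mono) auto
      ultimately show ?thesis by simp
    qed
    show "AE x in lborel. (\<lambda>n. h n x) \<longlonglongrightarrow> f x"
      using lim
    proof eventually_elim
      fix x assume "(\<lambda>n. g n x) \<longlonglongrightarrow> f x"
      then have "(\<lambda>n. clip (g n x)) \<longlonglongrightarrow> clip (f x)"
        by (intro continuous_on_tendsto_compose[OF clip_cont]) auto
      then have "(\<lambda>n. h n x) \<longlonglongrightarrow> cut x *\<^sub>R f x"
        unfolding h_def clip_id[OF K(2)] by (intro tendsto_intros)
      moreover have "cut x *\<^sub>R f x = f x"
        using supp[of x] by (cases "\<bar>x\<bar> > R") (auto simp: cut_def)
      ultimately show "(\<lambda>n. h n x) \<longlonglongrightarrow> f x" by simp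
    qed
    show "sqint (fourier_int (h n)) = ennreal (2 * pi) * sqint (h n)" for n
      by (rule plancherel_continuous[OF h_cont h_supp])
    show "sqint (fourier_int (\<lambda>x. h m x - h n x)) = ennreal (2 * pi) * sqint (\<lambda>x. h m x - h n x)" for m n
    proof (rule plancherel_continuous[where R = "R + 1"])
      show "continuous_on UNIV (\<lambda>x. h m x - h n x)" by (intro continuous_on_diff h_cont)
    qed (simp add: h_supp)
  qed (simp_all only: ind assms(1))
qed

text \<open>Truncating in space and in height at level \<open>n\<close> reduces to the bounded case;
  |f| itself dominates, which is where integrability and square integrability both enter.\<close>

theorem plancherel:
  fixes f :: "real \<Rightarrow> complex"
  assumes f1: "integrable lborel f" and f2: "L2 f"
  shows "sqint (fourier_int f) = ennreal (2 * pi) * sqint f"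
proof -
  have [measurable]: "f \<in> borel_measurable borel" using f1 by auto
  define g where "g n x = (if \<bar>x\<bar> \<le> real n \<and> cmod (f x) \<le> real n then f x else 0)" for n x
  have g_meas[measurable]: "g n \<in> borel_measurable borel" for n unfolding g_def by measurable
  have g_bd: "cmod (g n x) \<le> real n" "\<bar>x\<bar> > real n \<Longrightarrow> g n x = 0" for n x by (auto simp: g_def)
  show ?thesis
  proof (rule plancherel_limit[where g = g and w = "\<lambda>x. cmod (f x)"])
    show "integrable lborel (\<lambda>x. (cmod (f x))\<^sup>2)" using f2 by (simp add: L2_def)
    show "cmod (g n x) \<le> cmod (f x)" for n x by (simp add: g_def)
    show "AE x in lborel. (\<lambda>n. g n x) \<longlonglongrightarrow> f x"
    proof (intro AE_I2 tendsto_eventually)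
      fix x
      have "eventually (\<lambda>n. max \<bar>x\<bar> (cmod (f x)) \<le> real n) sequentially"
        by (rule eventually_sequentiallyI[of "nat \<lceil>max \<bar>x\<bar> (cmod (f x))\<rceil>"]) linarith
      then show "eventually (\<lambda>n. g n x = f x) sequentially" by eventually_elim (simp add: g_def)
    qed
    show "sqint (fourier_int (g n)) = ennreal (2 * pi) * sqint (g n)" for n
      by (rule plancherel_bounded[OF g_meas g_bd])
    show "sqint (fourier_int (\<lambda>x. g m x - g n x)) = ennreal (2 * pi) * sqint (\<lambda>x. g m x - g n x)" for m n
    proof (rule plancherel_bounded[where R = "real (max m n)" and M = "real m + real n"])
      show "cmod (g m x - g n x) \<le> real m + real n" for x
        using norm_triangle_ineq4[of "g m x" "g n x"] g_bd(1)[of m x] g_bd(1)[of n x] by linarith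
    qed (simp_all add: g_bd)
  qed (use f1 in simp_all)
qed

subsection \<open>The Fourier transform on square integrable functions\<close>

text \<open>The set integral over [-R, R] in \<open>fourier_L2\<close> becomes an integral over the
  line of an L2 function times an indicator, hence of an integrable function to which
  \<open>plancherel\<close> applies.\<close>

definition trunc :: "real \<Rightarrow> (real \<Rightarrow> complex) \<Rightarrow> real \<Rightarrow> complex" where
  "trunc R f x = indicator {-R..R} x * f x"

lemma trunc_measurable [measurable]:
  "f \<in> borel_measurable borel \<Longrightarrow> trunc R f \<in> borel_measurable borel"
  unfolding trunc_def[abs_def] by measurable

lemma L2_indicator: "L2 (indicator {-R..R})"
proof -
  have "integrable lborel (\<lambda>x. indicator {-R..R} x :: real)"
    by (intro integrable_real_indicator) (auto simp: emeasure_lborel_Icc_eq)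
  moreover have "(\<lambda>x. indicator {-R..R} x :: real) = (\<lambda>x. (cmod (indicator {-R..R} x))\<^sup>2)"
    by (auto simp: indicator_def)
  ultimately show ?thesis unfolding L2_def by simp
qed

lemma L2_trunc: "L2 f \<Longrightarrow> L2 (trunc R f)"
  by (rule L2_dominated[where w = "\<lambda>x. cmod (f x)"]) (auto simp: L2_def trunc_def indicator_def)

lemma integrable_trunc: "L2 f \<Longrightarrow> integrable lborel (trunc R f)"
  unfolding trunc_def[abs_def] by (rule integrable_L2_mult[OF L2_indicator])

lemma sqint_fourier_int_trunc: "L2 f \<Longrightarrow> sqint (fourier_int (trunc R f)) = ennreal (2 * pi) * sqint (trunc R f)"
  by (intro plancherel integrable_trunc L2_trunc)

lemma L2_fourier_int_trunc: "L2 f \<Longrightarrow> L2 (fourier_int (trunc R f))"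
  using L2_trunc[of f R] by (auto simp: L2_iff sqint_fourier_int_trunc ennreal_mult_less_top)

lemma fourier_int_trunc_eq:
  "(LINT x:{-R..R}|lborel. exp (- \<i> * of_real (x * \<xi>)) * f x) = fourier_int (trunc R f) \<xi>"
  unfolding set_lebesgue_integral_def fourier_int_def trunc_def
  by (intro Bochner_Integration.integral_cong refl) (simp add: indicator_def)

abbreviation fourier_err :: "real \<Rightarrow> (real \<Rightarrow> complex) \<Rightarrow> (real \<Rightarrow> complex) \<Rightarrow> ennreal" where
  "fourier_err R f F \<equiv> sqint (\<lambda>\<xi>. F \<xi> - fourier_int (trunc R f) \<xi>)"

abbreviation tail_err :: "real \<Rightarrow> (real \<Rightarrow> complex) \<Rightarrow> ennreal" where
  "tail_err R f \<equiv> sqint (\<lambda>x. f x - trunc R f x)"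

lemma fourier_L2_iff:
  "fourier_L2 f F \<longleftrightarrow> L2 f \<and> L2 F \<and> ((\<lambda>R. fourier_err R f F) \<longlongrightarrow> 0) at_top"
  unfolding fourier_L2_def fourier_int_trunc_eq sqint_def ..

lemma trunc_tendsto:
  assumes "L2 f" shows "((\<lambda>R. tail_err R f) \<longlongrightarrow> 0) at_top"
proof (rule tendsto_at_topI_sequentially)
  fix X :: "nat \<Rightarrow> real" assume X: "filterlim X at_top sequentially"
  have [measurable]: "f \<in> borel_measurable borel" using assms by (simp add: L2_iff)
  show "(\<lambda>n. tail_err (X n) f) \<longlonglongrightarrow> 0"
  proof (rule sqint_dominated_tendsto[where w = "\<lambda>x. cmod (f x)"])
    show "integrable lborel (\<lambda>x. (cmod (f x))\<^sup>2)" using assms by (simp add: L2_def)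
    show "cmod (trunc (X n) f x) \<le> cmod (f x)" for n x by (simp add: trunc_def indicator_def)
    show "AE x in lborel. (\<lambda>n. trunc (X n) f x) \<longlonglongrightarrow> f x"
    proof (intro AE_I2 tendsto_eventually)
      fix x
      have "eventually (\<lambda>n. \<bar>x\<bar> \<le> X n) sequentially" using X by (simp add: filterlim_at_top)
      then show "eventually (\<lambda>n. trunc (X n) f x = f x) sequentially"
        by eventually_elim (auto simp: trunc_def indicator_def)
    qed
  qed measurable
qed

lemma fourier_L2_seq:
  assumes "fourier_L2 f F"
  shows "(\<lambda>n. fourier_err (real n) f F) \<longlonglongrightarrow> 0"
  using filterlim_compose[OF _ filterlim_real_sequentially, of "\<lambda>R. fourier_err R f F" "nhds 0"]
    assms unfolding fourier_L2_iff by simp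

lemma fourier_L2_norm:
  assumes "fourier_L2 f F"
  shows "sqint F = ennreal (2 * pi) * sqint f"
proof -
  have f: "L2 f" "L2 F" using assms by (auto simp: fourier_L2_iff)
  have "(\<lambda>n. sqint (fourier_int (trunc (real n) f))) \<longlonglongrightarrow> sqint F"
    by (rule sqint_tendsto[OF f(2) L2_fourier_int_trunc fourier_L2_seq]) (use f assms in auto)
  moreover have "(\<lambda>n. sqint (trunc (real n) f)) \<longlonglongrightarrow> sqint f"
    by (rule sqint_tendsto[OF f(1) L2_trunc]) (use f filterlim_compose[OF trunc_tendsto filterlim_real_sequentially] in auto)
  then have "(\<lambda>n. sqint (fourier_int (trunc (real n) f))) \<longlonglongrightarrow> ennreal (2 * pi) * sqint f"
    unfolding sqint_fourier_int_trunc[OF f(1)] by (intro ennreal_tendsto_cmult) auto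
  ultimately show ?thesis by (rule LIMSEQ_unique)
qed

lemma fourier_int_trunc_diff:
  assumes "L2 f" "L2 g"
  shows "fourier_int (trunc R (\<lambda>x. f x - g x)) \<xi> = fourier_int (trunc R f) \<xi> - fourier_int (trunc R g) \<xi>"
proof -
  have "trunc R (\<lambda>x. f x - g x) = (\<lambda>x. trunc R f x - trunc R g x)"
    by (auto simp: trunc_def algebra_simps)
  then show ?thesis using fourier_int_diff[OF integrable_trunc[OF assms(1), of R] integrable_trunc[OF assms(2), of R]] by simp
qed

lemma sqint_diff_le:
  assumes "f \<in> borel_measurable borel" "g \<in> borel_measurable borel"
  shows "sqint (\<lambda>x. f x - g x) \<le> 2 * sqint f + 2 * sqint g"
  using sqint_add_le[of f "\<lambda>x. - 1 * g x"] sqint_cmult[of g "-1"] assms by simp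

lemma sqint_eq_0_iff:
  assumes [measurable]: "f \<in> borel_measurable borel"
  shows "sqint f = 0 \<longleftrightarrow> (AE x in lborel. f x = 0)"
  unfolding sqint_def by (subst nn_integral_0_iff_AE) (auto simp: ennreal_eq_0_iff)

lemma fourier_L2_diff:
  assumes "fourier_L2 f F" "fourier_L2 g G"
  shows "fourier_L2 (\<lambda>x. f x - g x) (\<lambda>\<xi>. F \<xi> - G \<xi>)"
proof -
  have fg: "L2 f" "L2 F" "L2 g" "L2 G" using assms by (auto simp: fourier_L2_iff)
  have [measurable]: "f \<in> borel_measurable borel" "F \<in> borel_measurable borel"
    "g \<in> borel_measurable borel" "G \<in> borel_measurable borel"
    using fg by (auto simp: L2_iff)
  have "((\<lambda>R. sqint (\<lambda>\<xi>. (F \<xi> - G \<xi>) - fourier_int (trunc R (\<lambda>x. f x - g x)) \<xi>)) \<longlongrightarrow> 0) at_top"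
  proof (rule tendsto_sandwich[OF _ _ tendsto_const])
    have "sqint (\<lambda>\<xi>. (F \<xi> - G \<xi>) - fourier_int (trunc R (\<lambda>x. f x - g x)) \<xi>)
      \<le> 2 * fourier_err R f F + 2 * fourier_err R g G" for R
      using sqint_diff_le[of "\<lambda>\<xi>. F \<xi> - fourier_int (trunc R f) \<xi>" "\<lambda>\<xi>. G \<xi> - fourier_int (trunc R g) \<xi>"]
      by (simp add: fourier_int_trunc_diff[OF fg(1,3)] algebra_simps)
    then show "\<forall>\<^sub>F R in at_top. sqint (\<lambda>\<xi>. (F \<xi> - G \<xi>) - fourier_int (trunc R (\<lambda>x. f x - g x)) \<xi>)
      \<le> 2 * fourier_err R f F + 2 * fourier_err R g G" by simp
    have "((\<lambda>R. 2 * fourier_err R f F + 2 * fourier_err R g G) \<longlongrightarrow> 2 * 0 + 2 * 0) at_top"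
      using assms unfolding fourier_L2_iff by (intro tendsto_add ennreal_tendsto_cmult) auto
    then show "((\<lambda>R. 2 * fourier_err R f F + 2 * fourier_err R g G) \<longlongrightarrow> 0) at_top" by simp
  qed auto
  then show ?thesis using fg by (auto simp: fourier_L2_iff intro: L2_diff)
qed

text \<open>The transform of the zero function has norm 0. Together with its counterpart for the
  left argument, this makes the choices in \<open>FT\<close> and \<open>eprop\<close> harmless: any
  two admissible ones agree almost everywhere.\<close>

lemma fourier_L2_unique_right:
  assumes "fourier_L2 f F" "fourier_L2 f G" shows "AE \<xi> in lborel. F \<xi> = G \<xi>"
proof -
  have "sqint (\<lambda>\<xi>. F \<xi> - G \<xi>) = 0"
    using fourier_L2_norm[OF fourier_L2_diff[OF assms]] by (simp add: sqint_def)
  then show ?thesis using assms by (subst (asm) sqint_eq_0_iff) (auto simp: fourier_L2_iff L2_iff)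
qed

lemma fourier_L2_unique_left:
  assumes "fourier_L2 f F" "fourier_L2 g F" shows "AE x in lborel. f x = g x"
proof -
  have "sqint (\<lambda>x. f x - g x) = 0"
    using fourier_L2_norm[OF fourier_L2_diff[OF assms]] pi_gt_zero by (auto simp: sqint_def ennreal_eq_0_iff not_le[symmetric])
  then show ?thesis using assms by (subst (asm) sqint_eq_0_iff) (auto simp: fourier_L2_iff L2_iff)
qed

lemma sqint_cong_AE: "AE x in lborel. f x = g x \<Longrightarrow> sqint f = sqint g"
  unfolding sqint_def by (intro nn_integral_cong_AE) (auto elim!: eventually_mono)

lemma fourier_L2_cong_AE:
  assumes "fourier_L2 f F" "AE x in lborel. F x = G x" and [measurable]: "G \<in> borel_measurable borel"
  shows "fourier_L2 f G"
proof -
  have "fourier_err R f G = fourier_err R f F" for R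
    using assms(2) by (intro sqint_cong_AE) (auto elim!: eventually_mono)
  moreover have "L2 G" using assms sqint_cong_AE[OF assms(2)] by (simp add: fourier_L2_iff L2_iff)
  ultimately show ?thesis using assms(1) by (simp add: fourier_L2_iff)
qed

text \<open>A Riesz-Fischer argument: along fast growing radii the truncated transforms converge
  almost everywhere, and Fatou compares their limit with the truncated transform at any
  radius.\<close>

theorem fourier_L2_exists:
  assumes f: "L2 f" shows "\<exists>F. fourier_L2 f F"
proof -
  have [measurable]: "f \<in> borel_measurable borel" using f by (simp add: L2_iff)
  \<comment> \<open>Tails below 4^-k make the squared norms of successive differences O(4^-k), small
    enough to survive the weight 2^k used below.\<close>
  have "\<exists>N. tail_err N f < ennreal ((1/4) ^ k)" for k
    using order_tendstoD(2)[OF trunc_tendsto[OF f], of "ennreal ((1/4) ^ k)"]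
    by (auto simp: eventually_at_top_linorder)
  then obtain N where N: "\<And>k. tail_err (N k) f < ennreal ((1/4) ^ k)" by metis
  define \<Psi> where "\<Psi> k = fourier_int (trunc (N k) f)" for k :: nat
  have [measurable]: "\<Psi> k \<in> borel_measurable borel" for k unfolding \<Psi>_def by measurable
  have diff: "sqint (\<lambda>\<xi>. fourier_int (trunc a f) \<xi> - fourier_int (trunc b f) \<xi>)
     \<le> ennreal (2 * pi) * (2 * tail_err a f + 2 * tail_err b f)" for a b
  proof -
    have "sqint (\<lambda>\<xi>. fourier_int (trunc a f) \<xi> - fourier_int (trunc b f) \<xi>) = sqint (fourier_int (\<lambda>x. trunc a f x - trunc b f x))"
      by (intro arg_cong[where f = sqint] ext fourier_int_diff[symmetric] integrable_trunc f)
    also have "\<dots> = ennreal (2 * pi) * sqint (\<lambda>x. trunc a f x - trunc b f x)"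
      by (intro plancherel L2_diff Bochner_Integration.integrable_diff integrable_trunc L2_trunc f)
    also have "sqint (\<lambda>x. trunc a f x - trunc b f x) = sqint (\<lambda>x. (f x - trunc b f x) - (f x - trunc a f x))"
      by (simp add: sqint_def)
    also have "\<dots> \<le> 2 * tail_err b f + 2 * tail_err a f"
      by (rule sqint_diff_le) measurable
    finally show ?thesis by (simp add: add.commute mult_left_mono)
  qed
  have step: "sqint (\<lambda>\<xi>. \<Psi> (Suc k) \<xi> - \<Psi> k \<xi>) \<le> ennreal (8 * pi * (1/4) ^ k)" for k
  proof -
    have "sqint (\<lambda>\<xi>. \<Psi> (Suc k) \<xi> - \<Psi> k \<xi>)
      \<le> ennreal (2 * pi) * (2 * ennreal ((1/4) ^ Suc k) + 2 * ennreal ((1/4) ^ k))"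
      unfolding \<Psi>_def using N[of k] N[of "Suc k"]
      by (intro order_trans[OF diff] mult_left_mono add_mono) auto
    also have "\<dots> = ennreal (2 * pi * (2 * (1/4) ^ Suc k + 2 * (1/4) ^ k))"
    proof -
      have two: "2 * ennreal a = ennreal (2 * a)" for a
        by (metis ennreal_mult' ennreal_numeral zero_le_numeral)
      show ?thesis
        unfolding two by (subst ennreal_plus[symmetric], simp, simp, subst ennreal_mult'[symmetric], simp_all)
    qed
    also have "\<dots> \<le> ennreal (8 * pi * (1/4) ^ k)" by (intro ennreal_leI) simp
    finally show ?thesis .
  qed
  \<comment> \<open>With weight 2^k the integrated series is still geometric of ratio 1/2, while its
    finiteness at a point forces the differences there to decay like 2^(-k/2), so the telescoping
    series converges absolutely.\<close>
  have "AE \<xi> in lborel. (\<Sum>k. ennreal (2 ^ k * (cmod (\<Psi> (Suc k) \<xi> - \<Psi> k \<xi>))\<^sup>2)) \<noteq> \<infinity>"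
  proof (rule nn_integral_PInf_AE)
    have "(\<integral>\<^sup>+\<xi>. (\<Sum>k. ennreal (2 ^ k * (cmod (\<Psi> (Suc k) \<xi> - \<Psi> k \<xi>))\<^sup>2)) \<partial>lborel)
      = (\<Sum>k. ennreal (2 ^ k) * sqint (\<lambda>\<xi>. \<Psi> (Suc k) \<xi> - \<Psi> k \<xi>))"
      unfolding sqint_def by (subst nn_integral_suminf) (simp_all add: ennreal_mult nn_integral_cmult)
    also have "\<dots> \<le> (\<Sum>k. ennreal (8 * pi * (1/2) ^ k))"
    proof (intro suminf_le)
      fix k
      have "ennreal (2 ^ k) * sqint (\<lambda>\<xi>. \<Psi> (Suc k) \<xi> - \<Psi> k \<xi>) \<le> ennreal (2 ^ k) * ennreal (8 * pi * (1/4) ^ k)"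
        by (intro mult_left_mono step) auto
      also have "\<dots> = ennreal (8 * pi * (2 ^ k * (1/4) ^ k))" by (simp add: ennreal_mult'[symmetric] mult_ac)
      also have "(2::real) ^ k * (1/4) ^ k = (1/2) ^ k" by (simp add: power_mult_distrib[symmetric])
      finally show "ennreal (2 ^ k) * sqint (\<lambda>\<xi>. \<Psi> (Suc k) \<xi> - \<Psi> k \<xi>) \<le> ennreal (8 * pi * (1/2) ^ k)" .
    qed auto
    also have "\<dots> < \<infinity>"
      by (subst suminf_ennreal2) (auto intro!: summable_mult)
    finally show "(\<integral>\<^sup>+\<xi>. (\<Sum>k. ennreal (2 ^ k * (cmod (\<Psi> (Suc k) \<xi> - \<Psi> k \<xi>))\<^sup>2)) \<partial>lborel) \<noteq> \<infinity>" by simp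
  qed measurable
  then have conv: "AE \<xi> in lborel. convergent (\<lambda>k. \<Psi> k \<xi>)"
  proof eventually_elim
    fix \<xi> assume fin: "(\<Sum>k. ennreal (2 ^ k * (cmod (\<Psi> (Suc k) \<xi> - \<Psi> k \<xi>))\<^sup>2)) \<noteq> \<infinity>"
    have "summable (\<lambda>k. 2 ^ k * (cmod (\<Psi> (Suc k) \<xi> - \<Psi> k \<xi>))\<^sup>2)"
      using fin by (intro summable_suminf_not_top) auto
    then have "bounded (range (\<lambda>k. 2 ^ k * (cmod (\<Psi> (Suc k) \<xi> - \<Psi> k \<xi>))\<^sup>2))"
      using summable_imp_Bseq Bseq_eq_bounded by blast
    then obtain B where B: "\<And>k. 2 ^ k * (cmod (\<Psi> (Suc k) \<xi> - \<Psi> k \<xi>))\<^sup>2 \<le> B"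
      by (auto simp: bounded_iff)
    have geo: "cmod (\<Psi> (Suc k) \<xi> - \<Psi> k \<xi>) \<le> sqrt B * (sqrt (1/2)) ^ k" for k
    proof -
      have "(cmod (\<Psi> (Suc k) \<xi> - \<Psi> k \<xi>))\<^sup>2 \<le> B * (1/2) ^ k"
        using B[of k] by (simp add: field_simps power_divide)
      then have "cmod (\<Psi> (Suc k) \<xi> - \<Psi> k \<xi>) \<le> sqrt (B * (1/2) ^ k)" by (rule real_le_rsqrt)
      then show ?thesis by (simp add: real_sqrt_mult real_sqrt_power)
    qed
    have "summable (\<lambda>k. sqrt B * (sqrt (1/2)) ^ k)"
      by (intro summable_mult summable_geometric) simp
    then have "summable (\<lambda>k. \<Psi> (Suc k) \<xi> - \<Psi> k \<xi>)"
      by (rule summable_comparison_test'[where N = 0]) (rule geo)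
    then have "convergent (\<lambda>n. \<Sum>k<n. \<Psi> (Suc k) \<xi> - \<Psi> k \<xi>)" by (simp add: summable_iff_convergent)
    then have "convergent (\<lambda>n. (\<Psi> n \<xi> - \<Psi> 0 \<xi>) + \<Psi> 0 \<xi>)"
      unfolding sum_lessThan_telescope[of "\<lambda>k. \<Psi> k \<xi>"] by (intro convergent_add convergent_const)
    then show "convergent (\<lambda>k. \<Psi> k \<xi>)" by simp
  qed
  define F where "F \<xi> = lim (\<lambda>k. \<Psi> k \<xi>)" for \<xi>
  have [measurable]: "F \<in> borel_measurable borel" unfolding F_def[abs_def] by measurable
  have lim: "AE \<xi> in lborel. (\<lambda>k. \<Psi> k \<xi>) \<longlonglongrightarrow> F \<xi>"
    using conv unfolding F_def convergent_LIMSEQ_iff .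
  \<comment> \<open>Letting k tend to infinity removes the tail along the sequence; 4 pi is the 2 pi
    of Plancherel times the 2 of \<open>sqint_diff_le\<close>.\<close>
  have bound: "fourier_err R f F \<le> ennreal (4 * pi) * tail_err R f" for R
  proof -
    have "fourier_err R f F = (\<integral>\<^sup>+\<xi>. liminf (\<lambda>k. ennreal ((cmod (\<Psi> k \<xi> - fourier_int (trunc R f) \<xi>))\<^sup>2)) \<partial>lborel)"
      unfolding sqint_def
    proof (intro nn_integral_cong_AE, use lim in eventually_elim)
      fix \<xi> assume l: "(\<lambda>k. \<Psi> k \<xi>) \<longlonglongrightarrow> F \<xi>"
      have "(\<lambda>k. ennreal ((cmod (\<Psi> k \<xi> - fourier_int (trunc R f) \<xi>))\<^sup>2)) \<longlonglongrightarrow> ennreal ((cmod (F \<xi> - fourier_int (trunc R f) \<xi>))\<^sup>2)"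
        by (intro tendsto_intros l)
      then show "ennreal ((cmod (F \<xi> - fourier_int (trunc R f) \<xi>))\<^sup>2) = liminf (\<lambda>k. ennreal ((cmod (\<Psi> k \<xi> - fourier_int (trunc R f) \<xi>))\<^sup>2))"
        by (intro lim_imp_Liminf[symmetric]) auto
    qed
    also have "\<dots> \<le> liminf (\<lambda>k. sqint (\<lambda>\<xi>. \<Psi> k \<xi> - fourier_int (trunc R f) \<xi>))"
      unfolding sqint_def by (intro nn_integral_liminf) measurable
    also have "\<dots> \<le> liminf (\<lambda>k. ennreal (2 * pi) * (2 * ennreal ((1/4) ^ k) + 2 * tail_err R f))"
      unfolding \<Psi>_def
      by (intro Liminf_mono always_eventually allI order_trans[OF diff] mult_left_mono add_mono) (auto intro: less_imp_le N)
    also have "\<dots> = ennreal (2 * pi) * (2 * ennreal 0 + 2 * tail_err R f)"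
      by (intro lim_imp_Liminf ennreal_tendsto_cmult tendsto_add tendsto_const tendsto_ennrealI LIMSEQ_realpow_zero) auto
    also have "\<dots> = (ennreal (2 * pi) * 2) * tail_err R f" by (simp add: mult_ac)
    also have "ennreal (2 * pi) * 2 = ennreal (4 * pi)"
      by (simp add: ennreal_mult'[symmetric] flip: ennreal_numeral)
    finally show ?thesis .
  qed
  have tends: "((\<lambda>R. fourier_err R f F) \<longlongrightarrow> 0) at_top"
  proof (rule tendsto_sandwich[OF _ _ tendsto_const])
    show "((\<lambda>R. ennreal (4 * pi) * tail_err R f) \<longlongrightarrow> 0) at_top"
      using ennreal_tendsto_cmult[OF _ trunc_tendsto[OF f], of "ennreal (4 * pi)"] by simp
  qed (use bound in auto)
  have "L2 F"
  proof -
    have "fourier_err 0 f F < \<infinity>"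
      using bound[of 0] L2_diff[OF f L2_trunc[OF f, of 0]] by (auto simp: L2_iff ennreal_mult_less_top intro: le_less_trans)
    then have "L2 (\<lambda>\<xi>. F \<xi> - fourier_int (trunc 0 f) \<xi>)" by (simp add: L2_iff)
    from L2_add[OF this L2_fourier_int_trunc[OF f, of 0]] show ?thesis by simp
  qed
  with f tends show ?thesis by (auto simp: fourier_L2_iff)
qed

text \<open>Expanding the square of the error gives an exact formula: it equals 2 pi times the
  squared mass of k(x) = \<open>fourier_int H (- x)\<close> outside [-R, R]. Inversion thus follows
  from Plancherel and one application of Fubini.\<close>

theorem fourier_L2_inverse:
  assumes H1: "integrable lborel H" and H2: "L2 H"
  shows "fourier_L2 (\<lambda>x. fourier_int H (- x)) (\<lambda>\<xi>. of_real (2 * pi) * H \<xi>)"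
proof -
  have [measurable]: "H \<in> borel_measurable borel" using H1 by auto
  define k where "k x = fourier_int H (- x)" for x
  have [measurable]: "k \<in> borel_measurable borel" unfolding k_def[abs_def] by measurable
  have sk: "sqint k = ennreal (2 * pi) * sqint H"
  proof -
    have "sqint k = sqint (fourier_int H)"
      unfolding sqint_def k_def
      by (subst nn_integral_real_affine[where c="-1" and t=0 and f = "\<lambda>x. ennreal ((cmod (fourier_int H x))\<^sup>2)"]) auto
    then show ?thesis by (simp add: plancherel[OF H1 H2])
  qed
  have k2: "L2 k" using H2 by (auto simp: L2_iff sk ennreal_mult_less_top)
  have H2': "L2 (\<lambda>\<xi>. of_real (2 * pi) * H \<xi>)" by (rule L2_cmult[OF H2])
  have normk: "(L2norm k)\<^sup>2 = 2 * pi * (L2norm H)\<^sup>2"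
    using sk unfolding sqint_L2norm[OF k2] sqint_L2norm[OF H2] by (simp add: ennreal_mult'[symmetric])
  \<comment> \<open>By Plancherel the two square terms are 2 pi |k|^2 and 2 pi |trunc R k|^2 in
    norm; Fubini evaluates the cross term as 4 pi |trunc R k|^2, leaving the difference.\<close>
  have ident: "(L2norm (\<lambda>\<xi>. of_real (2 * pi) * H \<xi> - fourier_int (trunc R k) \<xi>))\<^sup>2
     = 2 * pi * ((L2norm k)\<^sup>2 - (L2norm (trunc R k))\<^sup>2)" for R
  proof -
    let ?K = "fourier_int (trunc R k)"
    have K2: "L2 ?K" by (rule L2_fourier_int_trunc[OF k2])
    have normK: "(L2norm ?K)\<^sup>2 = 2 * pi * (L2norm (trunc R k))\<^sup>2"
      using sqint_fourier_int_trunc[OF k2, of R] unfolding sqint_L2norm[OF K2] sqint_L2norm[OF L2_trunc[OF k2]]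
      by (simp add: ennreal_mult'[symmetric])
    have "(LBINT \<xi>. cnj (H \<xi>) * ?K \<xi>) = (LBINT x. trunc R k x * (LBINT \<xi>. exp (- \<i> * of_real (x * \<xi>)) * cnj (H \<xi>)))"
      unfolding fourier_int_def[of "trunc R k"]
      by (rule fubini_kernel[where B = 1]) (use H1 integrable_trunc[OF k2] in simp_all)
    also have "(\<lambda>x. LBINT \<xi>. exp (- \<i> * of_real (x * \<xi>)) * cnj (H \<xi>)) = (\<lambda>x. cnj (k x))"
    proof
      fix x
      have "(\<lambda>\<xi>. exp (- \<i> * of_real (x * \<xi>)) * cnj (H \<xi>)) = (\<lambda>\<xi>. cnj (exp (- \<i> * of_real (\<xi> * - x)) * H \<xi>))"
        by (simp add: exp_cnj mult.commute)
      then show "(LBINT \<xi>. exp (- \<i> * of_real (x * \<xi>)) * cnj (H \<xi>)) = cnj (k x)"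
        unfolding fourier_int_def k_def by (simp only: Bochner_Integration.integral_cnj)
    qed
    \<comment> \<open>Pointwise \<open>trunc R k\<close> is either \<open>k\<close> or 0, so
      multiplying by the conjugate of \<open>k\<close> already yields its squared modulus.\<close>
    also have "(LBINT x. trunc R k x * cnj (k x)) = (LBINT x. of_real ((cmod (trunc R k x))\<^sup>2))"
    proof (intro Bochner_Integration.integral_cong refl)
      fix x show "trunc R k x * cnj (k x) = of_real ((cmod (trunc R k x))\<^sup>2)"
        unfolding complex_norm_square by (simp add: trunc_def indicator_def)
    qed
    also have "\<dots> = of_real ((L2norm (trunc R k))\<^sup>2)"
      unfolding L2norm_power2[OF L2_trunc[OF k2]] by (simp only: integral_complex_of_real)
    finally have inner: "(LBINT \<xi>. cnj (H \<xi>) * ?K \<xi>) = of_real ((L2norm (trunc R k))\<^sup>2)" .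
    have int: "integrable lborel (\<lambda>\<xi>. cnj (H \<xi>) * ?K \<xi>)" by (intro integrable_L2_mult L2_cnj H2 K2)
    have "(L2norm (\<lambda>\<xi>. of_real (2 * pi) * H \<xi> - ?K \<xi>))\<^sup>2
      = (LBINT \<xi>. (2 * pi)\<^sup>2 * (cmod (H \<xi>))\<^sup>2 + (cmod (?K \<xi>))\<^sup>2 - 4 * pi * Re (cnj (H \<xi>) * ?K \<xi>))"
      unfolding L2norm_power2[OF L2_diff[OF H2' K2]]
      by (intro Bochner_Integration.integral_cong refl) (simp only: cmod_power2, simp add: power2_eq_square algebra_simps)
    also have "\<dots> = (2 * pi)\<^sup>2 * (L2norm H)\<^sup>2 + (L2norm ?K)\<^sup>2 - 4 * pi * (LBINT \<xi>. Re (cnj (H \<xi>) * ?K \<xi>))"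
      using H2 K2 integrable_Re[OF int] by (simp add: L2norm_power2 L2_def del: times_complex.sel)
    also have "(LBINT \<xi>. Re (cnj (H \<xi>) * ?K \<xi>)) = (L2norm (trunc R k))\<^sup>2"
      using integral_Re[OF int] inner by (simp del: times_complex.sel)
    finally show ?thesis unfolding normK normk by (simp add: power2_eq_square algebra_simps)
  qed
  have "((\<lambda>R. sqint (\<lambda>\<xi>. of_real (2 * pi) * H \<xi> - fourier_int (trunc R k) \<xi>)) \<longlongrightarrow> 0) at_top"
  proof (rule tendsto_at_topI_sequentially)
    fix X :: "nat \<Rightarrow> real" assume X: "filterlim X at_top sequentially"
    have "(\<lambda>n. sqint (trunc (X n) k)) \<longlonglongrightarrow> sqint k"
      by (rule sqint_tendsto[OF k2 L2_trunc[OF k2] filterlim_compose[OF trunc_tendsto[OF k2] X]])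
    then have "(\<lambda>n. (L2norm (trunc (X n) k))\<^sup>2) \<longlonglongrightarrow> (L2norm k)\<^sup>2"
      unfolding sqint_L2norm[OF k2] sqint_L2norm[OF L2_trunc[OF k2]] by (subst (asm) tendsto_ennreal_iff) auto
    then have "(\<lambda>n. ennreal (2 * pi * ((L2norm k)\<^sup>2 - (L2norm (trunc (X n) k))\<^sup>2))) \<longlonglongrightarrow> ennreal (2 * pi * ((L2norm k)\<^sup>2 - (L2norm k)\<^sup>2))"
      by (intro tendsto_ennrealI tendsto_mult_left tendsto_diff tendsto_const)
    then show "(\<lambda>n. sqint (\<lambda>\<xi>. of_real (2 * pi) * H \<xi> - fourier_int (trunc (X n) k) \<xi>)) \<longlonglongrightarrow> 0"
      unfolding sqint_L2norm[OF L2_diff[OF H2' L2_fourier_int_trunc[OF k2]]] ident by simp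
  qed
  with k2 H2' show ?thesis by (simp add: fourier_L2_iff k_def[abs_def])
qed

lemma fourier_L2_FT: "L2 f \<Longrightarrow> fourier_L2 f (FT f)"
  unfolding FT_def by (rule someI_ex[OF fourier_L2_exists])

subsection \<open>Bilinear Fourier multipliers\<close>

text \<open>The variables become \<zeta> = \<xi> + \<eta> and \<eta>. At fixed \<eta> this is a
  translation, so Tonelli on both sides suffices.\<close>

lemma nn_integral_shear:
  fixes h :: "real \<times> real \<Rightarrow> ennreal"
  assumes [measurable]: "h \<in> borel_measurable borel"
  shows "(\<integral>\<^sup>+\<zeta>. \<integral>\<^sup>+\<eta>. h (\<zeta> - \<eta>, \<eta>) \<partial>lborel \<partial>lborel) = (\<integral>\<^sup>+p. h p \<partial>lborel)"
proof -
  have [measurable]: "h \<in> borel_measurable (borel \<Otimes>\<^sub>M borel)" by (simp add: borel_prod)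
  have "(\<integral>\<^sup>+\<zeta>. \<integral>\<^sup>+\<eta>. h (\<zeta> - \<eta>, \<eta>) \<partial>lborel \<partial>lborel) = (\<integral>\<^sup>+\<eta>. \<integral>\<^sup>+\<zeta>. h (\<zeta> - \<eta>, \<eta>) \<partial>lborel \<partial>lborel)"
    by (rule lborel_pair.Fubini'[symmetric]) measurable
  also have "\<dots> = (\<integral>\<^sup>+\<eta>. \<integral>\<^sup>+\<xi>. h (\<xi>, \<eta>) \<partial>lborel \<partial>lborel)"
  proof (rule nn_integral_cong)
    fix \<eta> :: real
    show "(\<integral>\<^sup>+\<zeta>. h (\<zeta> - \<eta>, \<eta>) \<partial>lborel) = (\<integral>\<^sup>+\<xi>. h (\<xi>, \<eta>) \<partial>lborel)"
      by (subst nn_integral_real_affine[where c = 1 and t = "- \<eta>" and f = "\<lambda>\<xi>. h (\<xi>, \<eta>)"]) simp_all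
  qed
  also have "\<dots> = (\<integral>\<^sup>+p. h p \<partial>lborel)"
    unfolding lborel_prod[symmetric] by (rule lborel_pair.nn_integral_snd) measurable
  finally show ?thesis .
qed

text \<open>Stating invariance for the measure transfers the change of variables to Bochner
  integrals, including integrability.\<close>

lemma distr_shear:
  "distr lborel lborel (\<lambda>p :: real \<times> real. (fst p - snd p, snd p)) = lborel" (is "distr _ _ ?S = _")
proof (rule measure_eqI)
  fix A assume "A \<in> sets (distr lborel lborel ?S)"
  then have A[measurable]: "A \<in> sets borel" by simp
  then have [measurable]: "A \<in> sets (borel \<Otimes>\<^sub>M borel)" unfolding borel_prod .
  have "emeasure (distr lborel lborel ?S) A = (\<integral>\<^sup>+p. indicator A p \<partial>distr lborel lborel ?S)"
    by simp
  also have "\<dots> = (\<integral>\<^sup>+p. indicator A (?S p) \<partial>lborel)"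
    by (rule nn_integral_distr) (auto simp: borel_prod[symmetric])
  also have "\<dots> = (\<integral>\<^sup>+\<zeta>. \<integral>\<^sup>+\<eta>. indicator A (\<zeta> - \<eta>, \<eta>) \<partial>lborel \<partial>lborel)"
    unfolding lborel_prod[symmetric]
    by (subst lborel.nn_integral_fst[symmetric]) simp_all
  also have "\<dots> = emeasure lborel A"
    by (subst nn_integral_shear) auto
  finally show "emeasure (distr lborel lborel ?S) A = emeasure lborel A" .
qed simp

lemma integral_shear:
  fixes h :: "real \<times> real \<Rightarrow> complex"
  assumes "integrable lborel h"
  shows "(LBINT p. h p) = (LBINT \<zeta>. LBINT \<eta>. h (\<zeta> - \<eta>, \<eta>))"
proof -
  let ?S = "\<lambda>p :: real \<times> real. (fst p - snd p, snd p)"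
  have S: "?S \<in> lborel \<rightarrow>\<^sub>M lborel" by (auto simp: borel_prod[symmetric])
  have [measurable]: "h \<in> borel_measurable borel" using assms by auto
  have int: "integrable lborel (\<lambda>p. h (?S p))"
    using assms integrable_distr_eq[OF S, of h] unfolding distr_shear by simp
  have "(LBINT p. h p) = (LBINT p. h (?S p))"
    using integral_distr[OF S, of h] unfolding distr_shear by simp
  also have "\<dots> = (LBINT \<zeta>. LBINT \<eta>. h (\<zeta> - \<eta>, \<eta>))"
    using lborel_pair.integral_fst'[of "\<lambda>p. h (?S p)"] int unfolding lborel_prod by simp
  finally show ?thesis .
qed

text \<open>The contribution of the line \<xi> + \<eta> = \<zeta> to the frequency integral of
  \<open>Tm\<close>: evaluating \<open>fourier_int\<close> of this function at -x recovers the
  double integral.\<close>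

definition bilin :: "(real \<Rightarrow> complex) \<Rightarrow> (real \<Rightarrow> complex) \<Rightarrow> (real \<times> real \<Rightarrow> complex) \<Rightarrow> real \<Rightarrow> complex" where
  "bilin F G M \<zeta> = (LBINT \<eta>. F (\<zeta> - \<eta>) * G \<eta> * M (\<zeta> - \<eta>, \<eta>))"

text \<open>Smoothness is given up because the dyadic pieces are cut off sharply; boundedness and a
  common bounded support survive such cuts and suffice for integrability.\<close>

definition box_symbol :: "(real \<times> real \<Rightarrow> complex) \<Rightarrow> bool" where
  "box_symbol M \<longleftrightarrow> M \<in> borel_measurable borel \<and>
     (\<exists>K R. \<forall>p. cmod (M p) \<le> K \<and> (\<bar>fst p\<bar> > R \<or> \<bar>snd p\<bar> > R \<longrightarrow> M p = 0))"

lemma L2_reflect_shift: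
  assumes "L2 F" shows "L2 (\<lambda>\<eta>. F (\<zeta> - \<eta>))"
proof -
  have [measurable]: "F \<in> borel_measurable borel" using assms by (simp add: L2_iff)
  have "sqint (\<lambda>\<eta>. F (\<zeta> - \<eta>)) = sqint F"
    unfolding sqint_def by (subst nn_integral_real_affine[where c = "-1" and t = \<zeta> and f = "\<lambda>x. ennreal ((cmod (F x))\<^sup>2)"]) simp_all
  then show ?thesis using assms by (simp add: L2_iff)
qed

lemma L2norm_reflect_shift:
  "L2norm (\<lambda>\<eta>. F (\<zeta> - \<eta>)) = L2norm F"
  unfolding L2norm_def by (subst lborel_integral_real_affine[where c = "-1" and t = \<zeta> and f = "\<lambda>x. (cmod (F x))\<^sup>2"]) simp_all

abbreviation form_abs :: "(real \<times> real \<Rightarrow> complex) \<Rightarrow> (real \<Rightarrow> complex) \<Rightarrow> (real \<Rightarrow> complex) \<Rightarrow> ennreal" where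
  "form_abs M F G \<equiv> \<integral>\<^sup>+p. ennreal (cmod (F (fst p))) * ennreal (cmod (G (snd p))) * ennreal (cmod (M p)) \<partial>lborel"

abbreviation conv_abs :: "(real \<times> real \<Rightarrow> complex) \<Rightarrow> (real \<Rightarrow> complex) \<Rightarrow> (real \<Rightarrow> complex) \<Rightarrow> real \<Rightarrow> ennreal" where
  "conv_abs M F G \<zeta> \<equiv> \<integral>\<^sup>+\<eta>. ennreal (cmod (F (\<zeta> - \<eta>))) * ennreal (cmod (G \<eta>)) * ennreal (cmod (M (\<zeta> - \<eta>, \<eta>))) \<partial>lborel"

text \<open>For each \<zeta> the absolute integral is at most K (|F|^2 + |G|^2) in L2 norms, and it
  vanishes for |\<zeta>| > 2 |R| since one of \<zeta> - \<eta> and \<eta> then leaves the box. A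
  bounded function of compact support lies in L1 and in L2.\<close>

lemma
  assumes F: "L2 F" and G: "L2 G" and M: "box_symbol M"
  shows bilin_integrable: "integrable lborel (\<lambda>\<eta>. F (\<zeta> - \<eta>) * G \<eta> * M (\<zeta> - \<eta>, \<eta>))"
    and bilin_measurable: "bilin F G M \<in> borel_measurable borel"
    and bilin_norm_le: "ennreal (cmod (bilin F G M \<zeta>)) \<le> conv_abs M F G \<zeta>"
    and integrable_bilin: "integrable lborel (bilin F G M)"
    and L2_bilin: "L2 (bilin F G M)"
    and integrable_bilin_plane: "integrable lborel (\<lambda>p. F (fst p) * G (snd p) * M p)"
proof -
  have [measurable]: "F \<in> borel_measurable borel" "G \<in> borel_measurable borel" "M \<in> borel_measurable (borel \<Otimes>\<^sub>M borel)"
    using F G M by (auto simp: L2_iff box_symbol_def borel_prod)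
  obtain K R where K: "\<And>p. cmod (M p) \<le> K" and R: "\<And>p. \<bar>fst p\<bar> > R \<or> \<bar>snd p\<bar> > R \<Longrightarrow> M p = 0"
    using M unfolding box_symbol_def by blast
  have K0: "K \<ge> 0" using K[of 0] norm_ge_zero order_trans by blast
  have base: "integrable lborel (\<lambda>\<eta>. F (\<zeta> - \<eta>) * G \<eta>)" for \<zeta>
    by (rule integrable_L2_mult[OF L2_reflect_shift[OF F] G])
  have bnd: "cmod (F (\<zeta> - \<eta>) * G \<eta> * M (\<zeta> - \<eta>, \<eta>)) \<le> K * cmod (F (\<zeta> - \<eta>) * G \<eta>)" for \<zeta> \<eta>
    using K[of "(\<zeta> - \<eta>, \<eta>)"] by (subst norm_mult, subst mult.commute) (intro mult_right_mono, auto)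
  show int: "integrable lborel (\<lambda>\<eta>. F (\<zeta> - \<eta>) * G \<eta> * M (\<zeta> - \<eta>, \<eta>))" for \<zeta>
    by (rule Bochner_Integration.integrable_bound[of _ "\<lambda>\<eta>. K *\<^sub>R (F (\<zeta> - \<eta>) * G \<eta>)"])
       (use base K0 bnd in auto)
  show meas[measurable]: "bilin F G M \<in> borel_measurable borel"
    unfolding bilin_def[abs_def] by measurable
  show le: "ennreal (cmod (bilin F G M \<zeta>)) \<le>
      (conv_abs M F G \<zeta>)" for \<zeta>
    unfolding bilin_def using integral_norm_bound_ennreal[OF int[of \<zeta>]] by (simp add: norm_mult ennreal_mult)
  define B where "B = K * ((L2norm F)\<^sup>2 + (L2norm G)\<^sup>2)"
  define J where "J \<zeta> = (LBINT \<eta>. cmod (F (\<zeta> - \<eta>) * G \<eta> * M (\<zeta> - \<eta>, \<eta>)))" for \<zeta>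
  have B: "J \<zeta> \<le> B" for \<zeta>
  proof -
    have "J \<zeta> \<le> (LBINT \<eta>. K * ((cmod (F (\<zeta> - \<eta>)))\<^sup>2 + (cmod (G \<eta>))\<^sup>2))"
      unfolding J_def
    proof (rule integral_mono')
      show "integrable lborel (\<lambda>\<eta>. K * ((cmod (F (\<zeta> - \<eta>)))\<^sup>2 + (cmod (G \<eta>))\<^sup>2))"
        using L2_reflect_shift[OF F, of \<zeta>] G by (simp add: L2_def)
      show "cmod (F (\<zeta> - \<eta>) * G \<eta> * M (\<zeta> - \<eta>, \<eta>)) \<le> K * ((cmod (F (\<zeta> - \<eta>)))\<^sup>2 + (cmod (G \<eta>))\<^sup>2)" for \<eta>
      proof (rule order_trans[OF bnd mult_left_mono[OF _ K0]])
        have "0 \<le> cmod (F (\<zeta> - \<eta>)) * cmod (G \<eta>)" by simp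
        with sum_squares_bound[of "cmod (F (\<zeta> - \<eta>))" "cmod (G \<eta>)"]
        show "cmod (F (\<zeta> - \<eta>) * G \<eta>) \<le> (cmod (F (\<zeta> - \<eta>)))\<^sup>2 + (cmod (G \<eta>))\<^sup>2"
          unfolding norm_mult by linarith
      qed
    qed (use K0 in auto)
    also have "\<dots> = B"
      using L2_reflect_shift[OF F, of \<zeta>] G
      by (simp add: B_def L2norm_power2[OF G] L2norm_power2[OF L2_reflect_shift[OF F, of \<zeta>], symmetric] L2norm_reflect_shift[of F \<zeta>, symmetric] L2_def)
    finally show ?thesis .
  qed
  have supp: "J \<zeta> = 0" if "\<bar>\<zeta>\<bar> > 2 * \<bar>R\<bar>" for \<zeta>
  proof -
    have "M (\<zeta> - \<eta>, \<eta>) = 0" for \<eta> by (rule R) (use that in auto)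
    then show ?thesis by (simp add: J_def)
  qed
  have ind: "integrable lborel (\<lambda>x. indicator {- (2 * \<bar>R\<bar>)..2 * \<bar>R\<bar>} x * c)" for c :: real
    by (intro integrable_mult_left integrable_real_indicator) (auto simp: emeasure_lborel_Icc_eq)
  have domJ: "J \<zeta> \<le> indicator {- (2 * \<bar>R\<bar>)..2 * \<bar>R\<bar>} \<zeta> * B" for \<zeta>
    using B[of \<zeta>] supp[of \<zeta>] by (cases "\<bar>\<zeta>\<bar> > 2 * \<bar>R\<bar>") (auto simp: indicator_def)
  then have dom: "cmod (bilin F G M \<zeta>) \<le> indicator {- (2 * \<bar>R\<bar>)..2 * \<bar>R\<bar>} \<zeta> * B" for \<zeta>
    unfolding bilin_def J_def by (rule order_trans[OF integral_norm_bound])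
  show "integrable lborel (bilin F G M)"
    by (rule Bochner_Integration.integrable_bound[OF ind[of B]]) (use order_trans[OF dom abs_ge_self] in simp_all)
  have eq: "(\<lambda>x. (indicator {- (2 * \<bar>R\<bar>)..2 * \<bar>R\<bar>} x * B)\<^sup>2) = (\<lambda>x. indicator {- (2 * \<bar>R\<bar>)..2 * \<bar>R\<bar>} x * B\<^sup>2)"
    by (auto simp: indicator_def)
  show "L2 (bilin F G M)"
    by (rule L2_dominated[OF meas, where w = "\<lambda>x. indicator {- (2 * \<bar>R\<bar>)..2 * \<bar>R\<bar>} x * B"])
       (simp_all only: eq ind dom AE_I2)
  show "integrable lborel (\<lambda>p. F (fst p) * G (snd p) * M p)"
  proof (rule integrableI_bounded)
    show "(\<lambda>p. F (fst p) * G (snd p) * M p) \<in> borel_measurable lborel"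
      by (simp add: borel_prod[symmetric])
    have "(\<integral>\<^sup>+p. ennreal (cmod (F (fst p) * G (snd p) * M p)) \<partial>lborel)
      = (\<integral>\<^sup>+\<zeta>. \<integral>\<^sup>+\<eta>. ennreal (cmod (F (\<zeta> - \<eta>) * G \<eta> * M (\<zeta> - \<eta>, \<eta>))) \<partial>lborel \<partial>lborel)"
      by (subst nn_integral_shear[symmetric]) (simp_all add: borel_prod[symmetric])
    also have "\<dots> \<le> (\<integral>\<^sup>+\<zeta>. ennreal (indicator {- (2 * \<bar>R\<bar>)..2 * \<bar>R\<bar>} \<zeta> * B) \<partial>lborel)"
    proof (rule nn_integral_mono)
      fix \<zeta>
      show "(\<integral>\<^sup>+\<eta>. ennreal (cmod (F (\<zeta> - \<eta>) * G \<eta> * M (\<zeta> - \<eta>, \<eta>))) \<partial>lborel) \<le> ennreal (indicator {- (2 * \<bar>R\<bar>)..2 * \<bar>R\<bar>} \<zeta> * B)"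
        using integrable_norm[OF int[of \<zeta>]] domJ[of \<zeta>]
        by (subst nn_integral_eq_integral) (auto simp: J_def intro: ennreal_leI)
    qed
    also have "\<dots> < \<infinity>" using ind[of B] by (subst nn_integral_eq_integral) (auto simp: B_def K0)
    finally show "(\<integral>\<^sup>+p. ennreal (cmod (F (fst p) * G (snd p) * M p)) \<partial>lborel) < \<infinity>" .
  qed
qed

section \<open>The time integrated symbol and the Duhamel formula\<close>

definition time_symbol :: "(real \<times> real \<Rightarrow> complex) \<Rightarrow> (real \<times> real \<Rightarrow> real) \<Rightarrow> real \<Rightarrow> real \<times> real \<Rightarrow> complex" where
  "time_symbol m \<phi> t p = m p * (LBINT s. exp (\<i> * of_real (s * \<phi> p)) * indicator {0..t} s)"

lemma integrable_indicator_Icc: "integrable lborel (\<lambda>x. indicator {u..v::real} x :: complex)"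
proof -
  have "integrable lborel (\<lambda>x. indicator {u..v} x :: real)"
    by (intro integrable_real_indicator) (auto simp: emeasure_lborel_Icc_eq)
  from integrable_of_real[OF this, where 'a = complex]
  have "integrable lborel (\<lambda>x. of_real (indicator {u..v} x) :: complex)" .
  moreover have "(\<lambda>x. of_real (indicator {u..v} x) :: complex) = indicator {u..v}"
    by (auto simp: indicator_def)
  ultimately show ?thesis by simp
qed

lemma time_symbol_norm_le1:
  assumes "0 \<le> t" shows "cmod (time_symbol m \<phi> t p) \<le> cmod (m p) * t"
proof -
  have "cmod (LBINT s. exp (\<i> * of_real (s * \<phi> p)) * indicator {0..t} s)
    \<le> (LBINT s. cmod (exp (\<i> * of_real (s * \<phi> p)) * indicator {0..t} s))"
    by (rule integral_norm_bound)
  also have "\<dots> = (LBINT s. indicator {0..t} s)"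
    by (intro Bochner_Integration.integral_cong refl) (simp add: norm_mult indicator_def)
  also have "\<dots> = t" using assms by simp
  finally show ?thesis unfolding time_symbol_def norm_mult by (intro mult_left_mono) auto
qed

lemma time_symbol_norm_le2:
  assumes "0 \<le> t" "\<phi> p \<noteq> 0" shows "cmod (time_symbol m \<phi> t p) \<le> cmod (m p) * (2 / \<bar>\<phi> p\<bar>)"
proof -
  let ?E = "\<lambda>s. exp (\<i> * of_real (s * \<phi> p))"
  have "(LBINT s. indicator {0..t} s *\<^sub>R ?E s) = ?E t / (\<i> * of_real (\<phi> p)) - ?E 0 / (\<i> * of_real (\<phi> p))"
  proof (rule integral_FTC_Icc)
    show "((\<lambda>s. ?E s / (\<i> * of_real (\<phi> p))) has_vector_derivative ?E x) (at x within {0..t})" for x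
    proof -
      have "((\<lambda>z. exp (\<i> * (z * of_real (\<phi> p))) / (\<i> * of_real (\<phi> p))) has_field_derivative ?E x) (at (of_real x))"
        using assms(2) by (auto intro!: derivative_eq_intros simp: mult.commute[of _ \<i>])
      from has_vector_derivative_real_field[OF this] show ?thesis by simp
    qed
    show "continuous_on {0..t} ?E" by (intro continuous_intros)
  qed (use assms in auto)
  moreover have "(\<lambda>s. indicator {0..t} s *\<^sub>R ?E s) = (\<lambda>s. ?E s * indicator {0..t} s)"
    by (auto simp: indicator_def)
  ultimately have "(LBINT s. ?E s * indicator {0..t} s) = (?E t - 1) / (\<i> * of_real (\<phi> p))"
    by (simp add: diff_divide_distrib)
  moreover have "cmod (?E t - 1) \<le> 2"
    using norm_triangle_ineq4[of "?E t" 1] by simp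
  ultimately have "cmod (LBINT s. ?E s * indicator {0..t} s) \<le> 2 / \<bar>\<phi> p\<bar>"
    by (simp add: norm_divide norm_mult divide_right_mono)
  then show ?thesis unfolding time_symbol_def norm_mult by (intro mult_left_mono) auto
qed

lemma box_symbol_time_symbol:
  assumes m: "box_symbol m" and [measurable]: "\<phi> \<in> borel_measurable borel" and "0 \<le> t"
  shows "box_symbol (time_symbol m \<phi> t)"
proof -
  obtain K R where K: "\<And>p. cmod (m p) \<le> K" and R: "\<And>p. \<bar>fst p\<bar> > R \<or> \<bar>snd p\<bar> > R \<Longrightarrow> m p = 0"
    using m unfolding box_symbol_def by blast
  have [measurable]: "m \<in> borel_measurable borel" using m by (simp add: box_symbol_def)
  have "time_symbol m \<phi> t \<in> borel_measurable borel"
    unfolding time_symbol_def[abs_def] by measurable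
  moreover have "cmod (time_symbol m \<phi> t p) \<le> K * t" for p
    using time_symbol_norm_le1[OF assms(3)] K mult_right_mono[OF K assms(3)] order_trans by blast
  moreover have "\<bar>fst p\<bar> > R \<or> \<bar>snd p\<bar> > R \<longrightarrow> time_symbol m \<phi> t p = 0" for p
    using R[of p] by (auto simp: time_symbol_def)
  ultimately show ?thesis unfolding box_symbol_def by blast
qed

text \<open>Time enters only through the exponential in the symbol, so Fubini lets the time integral
  act on the symbol alone; the shear then exposes the outer frequency \<zeta>.\<close>

lemma duhamel_integral:
  assumes f: "L2 f" and g: "L2 g" and m: "box_symbol m"
    and [measurable]: "\<phi> \<in> borel_measurable borel" and t: "0 \<le> t"
  shows "(LINT s:{0..t}|lborel. Tm (\<lambda>p. m p * exp (\<i> * of_real (s * \<phi> p))) f g y)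
     = fourier_int (bilin (FT f) (FT g) (time_symbol m \<phi> t)) (- y)"
proof -
  define F G where "F = FT f" and "G = FT g"
  have F: "L2 F" and G: "L2 G" using fourier_L2_FT[OF f] fourier_L2_FT[OF g] by (auto simp: fourier_L2_iff F_def G_def)
  have [measurable]: "F \<in> borel_measurable borel" "G \<in> borel_measurable borel" "m \<in> borel_measurable (borel \<Otimes>\<^sub>M borel)"
    using F G m by (auto simp: L2_iff box_symbol_def borel_prod)
  let ?e = "\<lambda>p :: real \<times> real. exp (\<i> * of_real (y * (fst p + snd p)))"
  define q where "q p = ?e p * (F (fst p) * G (snd p) * m p)" for p
  have modulate: "integrable lborel (\<lambda>p. ?e p * Q p)" if "integrable lborel Q" for Q
    by (rule Bochner_Integration.integrable_bound[OF that])
       (use borel_measurable_integrable[OF that] in \<open>auto simp: norm_mult borel_prod[symmetric]\<close>)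
  have q: "integrable lborel q" unfolding q_def[abs_def] by (intro modulate integrable_bilin_plane F G m)
  have "(LINT s:{0..t}|lborel. Tm (\<lambda>p. m p * exp (\<i> * of_real (s * \<phi> p))) f g y)
    = (LBINT s. indicator {0..t} s * (LBINT p. exp (\<i> * of_real (s * \<phi> p)) * q p))"
    unfolding set_lebesgue_integral_def Tm_def F_def[symmetric] G_def[symmetric] q_def
    by (intro Bochner_Integration.integral_cong refl) (simp add: indicator_def mult_ac)
  also have "\<dots> = (LBINT p. q p * (LBINT s. exp (\<i> * of_real (s * \<phi> p)) * indicator {0..t} s))"
    by (rule fubini_kernel[where B = 1]) (auto simp: q integrable_indicator_Icc)
  also have "\<dots> = (LBINT p. ?e p * (F (fst p) * G (snd p) * time_symbol m \<phi> t p))"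
    unfolding q_def time_symbol_def by (simp only: mult_ac)
  also have "\<dots> = (LBINT \<zeta>. LBINT \<eta>. exp (\<i> * of_real (y * \<zeta>)) * (F (\<zeta> - \<eta>) * G \<eta> * time_symbol m \<phi> t (\<zeta> - \<eta>, \<eta>)))"
    by (subst integral_shear[OF modulate[OF integrable_bilin_plane[OF F G box_symbol_time_symbol[OF m _ t]]]]) simp_all
  also have "\<dots> = (LBINT \<zeta>. exp (\<i> * of_real (y * \<zeta>)) * bilin F G (time_symbol m \<phi> t) \<zeta>)"
    unfolding bilin_def by (simp only: integral_mult_right_zero)
  also have "\<dots> = fourier_int (bilin F G (time_symbol m \<phi> t)) (- y)"
    unfolding fourier_int_def by (simp add: mult.commute)
  finally show ?thesis by (simp add: F_def G_def)
qed

text \<open>Inversion exhibits an explicit function with the transform prescribed in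
  \<open>eprop\<close>; this proves that the choice there is meaningful, and uniqueness identifies
  the two almost everywhere.\<close>

lemma sol_AE_eq:
  assumes f: "L2 f" and g: "L2 g" and m: "box_symbol m" and t: "0 \<le> t"
    and [measurable]: "a \<in> borel_measurable borel" "phase a b c \<in> borel_measurable borel"
  defines "H \<equiv> bilin (FT f) (FT g) (time_symbol m (phase a b c) t)"
  shows "sol a b c m f g t \<in> borel_measurable borel"
    and "AE x in lborel. sol a b c m f g t x = - \<i> * fourier_int (\<lambda>\<zeta>. exp (\<i> * of_real (t * a \<zeta>)) * H \<zeta>) (- x)"
proof -
  have FG: "L2 (FT f)" "L2 (FT g)" using fourier_L2_FT f g by (auto simp: fourier_L2_iff)
  have M: "box_symbol (time_symbol m (phase a b c) t)" by (intro box_symbol_time_symbol m t) simp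
  have H1: "integrable lborel H" and H2: "L2 H" unfolding H_def by (intro integrable_bilin L2_bilin FG M)+
  have [measurable]: "H \<in> borel_measurable borel" using H1 by auto
  let ?th = "\<lambda>\<zeta>. exp (\<i> * of_real (t * a \<zeta>))"
  have tH1: "integrable lborel (\<lambda>\<zeta>. ?th \<zeta> * H \<zeta>)"
    by (rule Bochner_Integration.integrable_bound[OF H1]) (auto simp: norm_mult)
  have tH2: "L2 (\<lambda>\<zeta>. ?th \<zeta> * H \<zeta>)"
    by (rule L2_dominated[where w = "\<lambda>x. cmod (H x)"]) (use H2 in \<open>auto simp: norm_mult L2_def\<close>)
  define h where "h = (\<lambda>x. fourier_int H (- x))"
  have "fourier_L2 h (\<lambda>\<xi>. of_real (2 * pi) * H \<xi>)" unfolding h_def by (rule fourier_L2_inverse[OF H1 H2])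
  moreover from this have hF: "fourier_L2 h (FT h)" by (intro fourier_L2_FT) (simp add: fourier_L2_iff)
  \<comment> \<open>The factor 2 pi is carried along and cancels: inverting the modulated function
    produces the same one.\<close>
  ultimately have FTh: "AE \<xi> in lborel. of_real (2 * pi) * H \<xi> = FT h \<xi>" by (rule fourier_L2_unique_right)
  have [measurable]: "FT h \<in> borel_measurable borel" using hF by (simp add: fourier_L2_iff L2_iff)
  let ?k = "\<lambda>x. fourier_int (\<lambda>\<zeta>. ?th \<zeta> * H \<zeta>) (- x)"
  have "fourier_L2 ?k (\<lambda>\<xi>. of_real (2 * pi) * (?th \<xi> * H \<xi>))" by (rule fourier_L2_inverse[OF tH1 tH2])
  then have k: "fourier_L2 ?k (\<lambda>\<xi>. ?th \<xi> * FT h \<xi>)"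
  proof (rule fourier_L2_cong_AE)
    show "AE \<xi> in lborel. of_real (2 * pi) * (?th \<xi> * H \<xi>) = ?th \<xi> * FT h \<xi>"
      using FTh
    proof eventually_elim
      fix \<xi> assume e: "of_real (2 * pi) * H \<xi> = FT h \<xi>"
      show "of_real (2 * pi) * (?th \<xi> * H \<xi>) = ?th \<xi> * FT h \<xi>"
        unfolding e[symmetric] by (simp only: mult_ac)
    qed
  qed simp
  then have e: "fourier_L2 (eprop a t h) (\<lambda>\<xi>. ?th \<xi> * FT h \<xi>)"
    unfolding eprop_def by (rule someI[where P = "\<lambda>k. fourier_L2 k (\<lambda>\<xi>. ?th \<xi> * FT h \<xi>)"])
  have sol: "sol a b c m f g t = (\<lambda>x. - \<i> * eprop a t h x)"
    unfolding sol_def h_def H_def using duhamel_integral[OF f g m _ t, of "phase a b c"] by simp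
  show "sol a b c m f g t \<in> borel_measurable borel"
  proof -
    have [measurable]: "eprop a t h \<in> borel_measurable borel" using e by (simp add: fourier_L2_iff L2_iff)
    show ?thesis unfolding sol by measurable
  qed
  show "AE x in lborel. sol a b c m f g t x = - \<i> * ?k x"
    using fourier_L2_unique_left[OF e k] unfolding sol by eventually_elim simp
qed

text \<open>\<open>\<theta>\<close> stands for the propagator exp(i t a). It drops out because the
  sup norm is bounded by the L1 norm of the transform and the L2 norm is computed by Plancherel,
  both of which see only its modulus.\<close>

lemma fourier_int_bound_and_sqint:
  assumes F: "L2 F" and G: "L2 G" and M: "box_symbol M" and [measurable]: "\<theta> \<in> borel_measurable borel"
    and \<theta>: "\<And>\<zeta>. cmod (\<theta> \<zeta>) = 1"
  defines "u \<equiv> \<lambda>x. fourier_int (\<lambda>\<zeta>. \<theta> \<zeta> * bilin F G M \<zeta>) (- x)"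
  shows "ennreal (cmod (u x)) \<le> (form_abs M F G)"
    and "sqint u \<le> ennreal (2 * pi) *
       (\<integral>\<^sup>+\<zeta>. (conv_abs M F G \<zeta>)\<^sup>2 \<partial>lborel)"
    and "u \<in> borel_measurable borel"
proof -
  note [measurable] = bilin_measurable[OF F G M]
  have [measurable]: "F \<in> borel_measurable borel" "G \<in> borel_measurable borel" "M \<in> borel_measurable (borel \<Otimes>\<^sub>M borel)"
    using F G M by (auto simp: L2_iff box_symbol_def borel_prod)
  let ?H = "\<lambda>\<zeta>. \<theta> \<zeta> * bilin F G M \<zeta>"
  have H1: "integrable lborel ?H"
    by (rule Bochner_Integration.integrable_bound[OF integrable_bilin[OF F G M]]) (auto simp: norm_mult \<theta>)
  have H2: "L2 ?H"
    by (rule L2_dominated[where w = "\<lambda>x. cmod (bilin F G M x)"]) (use L2_bilin[OF F G M] in \<open>auto simp: norm_mult L2_def \<theta>\<close>)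
  show "u \<in> borel_measurable borel" unfolding u_def by measurable
  have "ennreal (cmod (u x)) \<le> ennreal (LBINT \<zeta>. cmod (bilin F G M \<zeta>))"
    unfolding u_def by (rule ennreal_leI, rule order_trans[OF fourier_int_norm_le]) (simp add: norm_mult \<theta>)
  also have "\<dots> = (\<integral>\<^sup>+\<zeta>. ennreal (cmod (bilin F G M \<zeta>)) \<partial>lborel)"
    using integrable_bilin[OF F G M] by (subst nn_integral_eq_integral) auto
  also have "\<dots> \<le> (\<integral>\<^sup>+\<zeta>. \<integral>\<^sup>+\<eta>. ennreal (cmod (F (\<zeta> - \<eta>))) * ennreal (cmod (G \<eta>)) * ennreal (cmod (M (\<zeta> - \<eta>, \<eta>))) \<partial>lborel \<partial>lborel)"
    by (intro nn_integral_mono bilin_norm_le F G M)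
  also have "\<dots> = (form_abs M F G)"
    by (subst nn_integral_shear[symmetric]) (simp_all add: borel_prod[symmetric])
  finally show "ennreal (cmod (u x)) \<le> (form_abs M F G)" .
  have "sqint u = sqint (fourier_int ?H)"
    unfolding sqint_def u_def
    by (subst (2) nn_integral_real_affine[where c="-1" and t=0]) auto
  also have "\<dots> = ennreal (2 * pi) * (\<integral>\<^sup>+\<zeta>. (ennreal (cmod (bilin F G M \<zeta>)))\<^sup>2 \<partial>lborel)"
    unfolding plancherel[OF H1 H2] by (simp add: sqint_def norm_mult \<theta> ennreal_power)
  also have "\<dots> \<le> ennreal (2 * pi) *
       (\<integral>\<^sup>+\<zeta>. (conv_abs M F G \<zeta>)\<^sup>2 \<partial>lborel)"
    by (intro mult_left_mono nn_integral_mono power_mono bilin_norm_le F G M) auto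
  finally show "sqint u \<le> \<dots>" .
qed

subsection \<open>Size of the bilinear form on a set of frequencies\<close>

abbreviation nnsq :: "(real \<Rightarrow> ennreal) \<Rightarrow> ennreal" where
  "nnsq F \<equiv> \<integral>\<^sup>+x. (F x)\<^sup>2 \<partial>lborel"

abbreviation form_on :: "(real \<times> real) set \<Rightarrow> (real \<Rightarrow> ennreal) \<Rightarrow> (real \<Rightarrow> ennreal) \<Rightarrow> ennreal" where
  "form_on E F G \<equiv> \<integral>\<^sup>+p. F (fst p) * G (snd p) * indicator E p \<partial>lborel"

abbreviation conv_on :: "(real \<times> real) set \<Rightarrow> (real \<Rightarrow> ennreal) \<Rightarrow> (real \<Rightarrow> ennreal) \<Rightarrow> real \<Rightarrow> ennreal" where
  "conv_on E F G \<zeta> \<equiv> \<integral>\<^sup>+\<eta>. F (\<zeta> - \<eta>) * G \<eta> * indicator E (\<zeta> - \<eta>, \<eta>) \<partial>lborel"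

text \<open>In both definitions \<open>K\<close> bounds the square of the operator norm.\<close>

definition sup_bd :: "(real \<times> real) set \<Rightarrow> real \<Rightarrow> bool" where
  "sup_bd E K \<longleftrightarrow> (\<forall>F G. F \<in> borel_measurable borel \<longrightarrow> G \<in> borel_measurable borel \<longrightarrow>
     (form_on E F G)\<^sup>2
       \<le> ennreal K * ((nnsq F) * (nnsq G)))"

definition sq_bd :: "(real \<times> real) set \<Rightarrow> real \<Rightarrow> bool" where
  "sq_bd E K \<longleftrightarrow> (\<forall>F G. F \<in> borel_measurable borel \<longrightarrow> G \<in> borel_measurable borel \<longrightarrow>
     (nnsq F) < \<infinity> \<longrightarrow> (nnsq G) < \<infinity> \<longrightarrow>
     (\<integral>\<^sup>+\<zeta>. (conv_on E F G \<zeta>)\<^sup>2 \<partial>lborel)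
       \<le> ennreal K * ((nnsq F) * (nnsq G)))"

lemma ennreal_power2_add_le: "(a + b :: ennreal)\<^sup>2 \<le> 2 * a\<^sup>2 + 2 * b\<^sup>2"
proof (cases a; cases b)
  fix x y :: real assume xy: "0 \<le> x" "0 \<le> y" "a = ennreal x" "b = ennreal y"
  have "(x + y)\<^sup>2 \<le> 2 * x\<^sup>2 + 2 * y\<^sup>2" using sum_squares_bound[of x y] by (simp add: power2_sum)
  then have "ennreal ((x + y)\<^sup>2) \<le> ennreal (2 * x\<^sup>2 + 2 * y\<^sup>2)" by (rule ennreal_leI)
  also have "ennreal (2 * x\<^sup>2 + 2 * y\<^sup>2) = ennreal 2 * ennreal (x\<^sup>2) + ennreal 2 * ennreal (y\<^sup>2)"
    by (subst ennreal_plus) (simp_all add: ennreal_mult)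
  also have "ennreal ((x + y)\<^sup>2) = (a + b)\<^sup>2"
    using xy by (simp add: ennreal_power flip: ennreal_plus)
  finally show ?thesis using xy by (simp add: ennreal_power)
qed (auto simp: power2_eq_square ennreal_mult_top ennreal_top_mult ennreal_mult_eq_top_iff)

lemma indicator_Un_le: "indicator (A \<union> B) x \<le> (indicator A x + indicator B x :: ennreal)"
  by (auto simp: indicator_def)

lemma sup_bd_mono:
  assumes "sup_bd E K" "E' \<subseteq> E" "K \<le> K'" shows "sup_bd E' K'"
  unfolding sup_bd_def
proof (intro allI impI)
  fix F G :: "real \<Rightarrow> ennreal" assume m: "F \<in> borel_measurable borel" "G \<in> borel_measurable borel"
  have "(form_on E' F G) \<le> (form_on E F G)"
    using assms(2) by (intro nn_integral_mono mult_left_mono) (auto simp: indicator_def)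
  then have "(form_on E' F G)\<^sup>2 \<le> (form_on E F G)\<^sup>2"
    by (rule power_mono) simp
  also have "\<dots> \<le> ennreal K * ((nnsq F) * (nnsq G))"
    using assms(1) m by (auto simp: sup_bd_def)
  also have "\<dots> \<le> ennreal K' * ((nnsq F) * (nnsq G))"
    by (intro mult_right_mono ennreal_leI assms(3)) simp
  finally show "(form_on E' F G)\<^sup>2 \<le> \<dots>" .
qed

lemma sq_bd_mono:
  assumes "sq_bd E K" "E' \<subseteq> E" "K \<le> K'" shows "sq_bd E' K'"
  unfolding sq_bd_def
proof (intro allI impI)
  fix F G :: "real \<Rightarrow> ennreal" assume m: "F \<in> borel_measurable borel" "G \<in> borel_measurable borel"
    "(nnsq F) < \<infinity>" "(nnsq G) < \<infinity>"
  have "(\<integral>\<^sup>+\<zeta>. (conv_on E' F G \<zeta>)\<^sup>2 \<partial>lborel)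
     \<le> (\<integral>\<^sup>+\<zeta>. (conv_on E F G \<zeta>)\<^sup>2 \<partial>lborel)"
    using assms(2) by (intro nn_integral_mono power_mono mult_left_mono) (auto simp: indicator_def)
  also have "\<dots> \<le> ennreal K * ((nnsq F) * (nnsq G))"
    using assms(1) m unfolding sq_bd_def by blast
  also have "\<dots> \<le> ennreal K' * ((nnsq F) * (nnsq G))"
    by (intro mult_right_mono ennreal_leI assms(3)) simp
  finally show "(\<integral>\<^sup>+\<zeta>. (conv_on E' F G \<zeta>)\<^sup>2 \<partial>lborel) \<le> \<dots>" .
qed

text \<open>The bounds are for squares, hence (a + b)^2 <= 2 a^2 + 2 b^2. The loss is harmless
  because only finite covers are assembled this way, never the dyadic pieces.\<close>

lemma sup_bd_Un:
  assumes "sup_bd A K" "sup_bd B L" "0 \<le> K" "0 \<le> L" and [measurable]: "A \<in> sets borel" "B \<in> sets borel"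
  shows "sup_bd (A \<union> B) (2 * K + 2 * L)"
  unfolding sup_bd_def
proof (intro allI impI)
  fix F G :: "real \<Rightarrow> ennreal" assume m[measurable]: "F \<in> borel_measurable borel" "G \<in> borel_measurable borel"
  let ?I = "\<lambda>E. (form_on E F G)"
  let ?N = "(nnsq F) * (nnsq G)"
  have [measurable]: "(\<lambda>p. F (fst p)) \<in> borel_measurable (borel :: (real \<times> real) measure)"
     "(\<lambda>p. G (snd p)) \<in> borel_measurable (borel :: (real \<times> real) measure)"
    by (simp_all add: borel_prod[symmetric])
  have "?I (A \<union> B) \<le> (\<integral>\<^sup>+p. F (fst p) * G (snd p) * indicator A p + F (fst p) * G (snd p) * indicator B p \<partial>lborel)"
    by (intro nn_integral_mono) (simp add: distrib_left[symmetric] mult_left_mono indicator_Un_le)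
  also have "\<dots> = ?I A + ?I B" by (rule nn_integral_add) measurable
  finally have "(?I (A \<union> B))\<^sup>2 \<le> (?I A + ?I B)\<^sup>2" by (rule power_mono) simp
  also have "\<dots> \<le> 2 * (?I A)\<^sup>2 + 2 * (?I B)\<^sup>2" by (rule ennreal_power2_add_le)
  also have "\<dots> \<le> 2 * (ennreal K * ?N) + 2 * (ennreal L * ?N)"
    using assms(1,2) m unfolding sup_bd_def by (intro add_mono mult_left_mono) auto
  also have "\<dots> = (ennreal 2 * ennreal K + ennreal 2 * ennreal L) * ?N" by (simp add: distrib_right mult.assoc)
  also have "ennreal 2 * ennreal K + ennreal 2 * ennreal L = ennreal (2 * K + 2 * L)"
    using assms by (subst ennreal_plus) (simp_all add: ennreal_mult)
  finally show "(?I (A \<union> B))\<^sup>2 \<le> ennreal (2 * K + 2 * L) * ?N" .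
qed

lemma sq_bd_Un:
  assumes "sq_bd A K" "sq_bd B L" "0 \<le> K" "0 \<le> L" and A: "A \<in> sets borel" and B: "B \<in> sets borel"
  shows "sq_bd (A \<union> B) (2 * K + 2 * L)"
  unfolding sq_bd_def
proof (intro allI impI)
  fix F G :: "real \<Rightarrow> ennreal" assume m[measurable]: "F \<in> borel_measurable borel" "G \<in> borel_measurable borel"
    and fin: "(nnsq F) < \<infinity>" "(nnsq G) < \<infinity>"
  have [measurable]: "A \<in> sets (borel \<Otimes>\<^sub>M borel)" "B \<in> sets (borel \<Otimes>\<^sub>M borel)"
    using A B unfolding borel_prod .
  let ?I = "\<lambda>E \<zeta>. (conv_on E F G \<zeta>)"
  let ?N = "(nnsq F) * (nnsq G)"
  have pt: "(?I (A \<union> B) \<zeta>)\<^sup>2 \<le> 2 * (?I A \<zeta>)\<^sup>2 + 2 * (?I B \<zeta>)\<^sup>2" for \<zeta>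
  proof -
    have "?I (A \<union> B) \<zeta> \<le> (\<integral>\<^sup>+\<eta>. F (\<zeta> - \<eta>) * G \<eta> * indicator A (\<zeta> - \<eta>, \<eta>) + F (\<zeta> - \<eta>) * G \<eta> * indicator B (\<zeta> - \<eta>, \<eta>) \<partial>lborel)"
      by (intro nn_integral_mono) (simp add: distrib_left[symmetric] mult_left_mono indicator_Un_le)
    also have "\<dots> = ?I A \<zeta> + ?I B \<zeta>" by (rule nn_integral_add) measurable
    finally have "(?I (A \<union> B) \<zeta>)\<^sup>2 \<le> (?I A \<zeta> + ?I B \<zeta>)\<^sup>2" by (rule power_mono) simp
    also have "\<dots> \<le> 2 * (?I A \<zeta>)\<^sup>2 + 2 * (?I B \<zeta>)\<^sup>2" by (rule ennreal_power2_add_le)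
    finally show ?thesis .
  qed
  have "(\<integral>\<^sup>+\<zeta>. (?I (A \<union> B) \<zeta>)\<^sup>2 \<partial>lborel) \<le> (\<integral>\<^sup>+\<zeta>. 2 * (?I A \<zeta>)\<^sup>2 + 2 * (?I B \<zeta>)\<^sup>2 \<partial>lborel)"
    by (intro nn_integral_mono pt)
  also have "\<dots> = 2 * (\<integral>\<^sup>+\<zeta>. (?I A \<zeta>)\<^sup>2 \<partial>lborel) + 2 * (\<integral>\<^sup>+\<zeta>. (?I B \<zeta>)\<^sup>2 \<partial>lborel)"
    by (subst nn_integral_add) (simp_all add: nn_integral_cmult)
  also have "\<dots> \<le> 2 * (ennreal K * ?N) + 2 * (ennreal L * ?N)"
    using assms(1,2) m fin unfolding sq_bd_def by (intro add_mono mult_left_mono) auto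
  also have "\<dots> = (ennreal 2 * ennreal K + ennreal 2 * ennreal L) * ?N" by (simp add: distrib_right mult.assoc)
  also have "ennreal 2 * ennreal K + ennreal 2 * ennreal L = ennreal (2 * K + 2 * L)"
    using assms by (subst ennreal_plus) (simp_all add: ennreal_mult)
  finally show "(\<integral>\<^sup>+\<zeta>. (?I (A \<union> B) \<zeta>)\<^sup>2 \<partial>lborel) \<le> ennreal (2 * K + 2 * L) * ?N" .
qed

definition slice1_le :: "(real \<times> real) set \<Rightarrow> real \<Rightarrow> bool" where
  "slice1_le E X \<longleftrightarrow> (\<forall>\<eta>. emeasure lborel {\<xi>. (\<xi>, \<eta>) \<in> E} \<le> ennreal X)"

definition slice2_le :: "(real \<times> real) set \<Rightarrow> real \<Rightarrow> bool" where
  "slice2_le E Y \<longleftrightarrow> (\<forall>\<xi>. emeasure lborel {\<eta>. (\<xi>, \<eta>) \<in> E} \<le> ennreal Y)"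

lemma slice1_integral_le:
  assumes "slice1_le E X" and E: "E \<in> sets borel" and [measurable]: "G \<in> borel_measurable borel"
  shows "(\<integral>\<^sup>+p. (G (snd p) * indicator E p)\<^sup>2 \<partial>lborel) \<le> ennreal X * (nnsq G)"
proof -
  have [measurable]: "E \<in> sets (borel \<Otimes>\<^sub>M borel)" using E unfolding borel_prod .
  have "(\<integral>\<^sup>+p. (G (snd p) * indicator E p)\<^sup>2 \<partial>lborel) = (\<integral>\<^sup>+\<eta>. \<integral>\<^sup>+\<xi>. (G \<eta> * indicator E (\<xi>, \<eta>))\<^sup>2 \<partial>lborel \<partial>lborel)"
    unfolding lborel_prod[symmetric] by (subst lborel_pair.nn_integral_snd[symmetric]) simp_all
  also have "\<dots> \<le> (\<integral>\<^sup>+\<eta>. ennreal X * (G \<eta>)\<^sup>2 \<partial>lborel)"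
  proof (rule nn_integral_mono)
    fix \<eta>
    have [measurable]: "{\<xi>. (\<xi>, \<eta>) \<in> E} \<in> sets borel" by measurable
    have "(\<integral>\<^sup>+\<xi>. (G \<eta> * indicator E (\<xi>, \<eta>))\<^sup>2 \<partial>lborel) = (\<integral>\<^sup>+\<xi>. (G \<eta>)\<^sup>2 * indicator {\<xi>. (\<xi>, \<eta>) \<in> E} \<xi> \<partial>lborel)"
      by (intro nn_integral_cong) (auto simp: indicator_def)
    also have "\<dots> = (G \<eta>)\<^sup>2 * emeasure lborel {\<xi>. (\<xi>, \<eta>) \<in> E}" by (rule nn_integral_cmult_indicator) simp
    also have "\<dots> \<le> (G \<eta>)\<^sup>2 * ennreal X" using assms(1) by (intro mult_left_mono) (auto simp: slice1_le_def)
    finally show "(\<integral>\<^sup>+\<xi>. (G \<eta> * indicator E (\<xi>, \<eta>))\<^sup>2 \<partial>lborel) \<le> ennreal X * (G \<eta>)\<^sup>2" by (simp add: mult.commute)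
  qed
  also have "\<dots> = ennreal X * (nnsq G)" by (rule nn_integral_cmult) simp
  finally show ?thesis .
qed

lemma slice2_integral_le:
  assumes "slice2_le E Y" and E: "E \<in> sets borel" and [measurable]: "F \<in> borel_measurable borel"
  shows "(\<integral>\<^sup>+p. (F (fst p) * indicator E p)\<^sup>2 \<partial>lborel) \<le> ennreal Y * (nnsq F)"
proof -
  have [measurable]: "E \<in> sets (borel \<Otimes>\<^sub>M borel)" using E unfolding borel_prod .
  have "(\<integral>\<^sup>+p. (F (fst p) * indicator E p)\<^sup>2 \<partial>lborel) = (\<integral>\<^sup>+\<xi>. \<integral>\<^sup>+\<eta>. (F \<xi> * indicator E (\<xi>, \<eta>))\<^sup>2 \<partial>lborel \<partial>lborel)"
    unfolding lborel_prod[symmetric] by (subst lborel.nn_integral_fst[symmetric]) simp_all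
  also have "\<dots> \<le> (\<integral>\<^sup>+\<xi>. ennreal Y * (F \<xi>)\<^sup>2 \<partial>lborel)"
  proof (rule nn_integral_mono)
    fix \<xi>
    have [measurable]: "{\<eta>. (\<xi>, \<eta>) \<in> E} \<in> sets borel" by measurable
    have "(\<integral>\<^sup>+\<eta>. (F \<xi> * indicator E (\<xi>, \<eta>))\<^sup>2 \<partial>lborel) = (\<integral>\<^sup>+\<eta>. (F \<xi>)\<^sup>2 * indicator {\<eta>. (\<xi>, \<eta>) \<in> E} \<eta> \<partial>lborel)"
      by (intro nn_integral_cong) (auto simp: indicator_def)
    also have "\<dots> = (F \<xi>)\<^sup>2 * emeasure lborel {\<eta>. (\<xi>, \<eta>) \<in> E}" by (rule nn_integral_cmult_indicator) simp
    also have "\<dots> \<le> (F \<xi>)\<^sup>2 * ennreal Y" using assms(1) by (intro mult_left_mono) (auto simp: slice2_le_def)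
    finally show "(\<integral>\<^sup>+\<eta>. (F \<xi> * indicator E (\<xi>, \<eta>))\<^sup>2 \<partial>lborel) \<le> ennreal Y * (F \<xi>)\<^sup>2" by (simp add: mult.commute)
  qed
  also have "\<dots> = ennreal Y * (nnsq F)" by (rule nn_integral_cmult) simp
  finally show ?thesis .
qed

text \<open>An indicator is its own square, so Cauchy-Schwarz can give one copy to \<open>F\<close>
  and one to \<open>G\<close>. Integrating out the variable absent from each factor leaves a slice
  length.\<close>

lemma sup_bd_slices:
  assumes "slice1_le E X" "slice2_le E Y" and E[measurable]: "E \<in> sets borel" and "0 \<le> X" "0 \<le> Y"
  shows "sup_bd E (X * Y)"
  unfolding sup_bd_def
proof (intro allI impI)
  fix F G :: "real \<Rightarrow> ennreal" assume m[measurable]: "F \<in> borel_measurable borel" "G \<in> borel_measurable borel"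
  have [measurable]: "(\<lambda>p. F (fst p)) \<in> borel_measurable (borel :: (real \<times> real) measure)"
     "(\<lambda>p. G (snd p)) \<in> borel_measurable (borel :: (real \<times> real) measure)"
    by (simp_all add: borel_prod[symmetric])
  have "(form_on E F G)\<^sup>2 = (\<integral>\<^sup>+p. (F (fst p) * indicator E p) * (G (snd p) * indicator E p) \<partial>lborel)\<^sup>2"
    by (intro arg_cong[where f = "\<lambda>x. x\<^sup>2"] nn_integral_cong) (auto simp: indicator_def)
  also have "\<dots> \<le> (\<integral>\<^sup>+p. (F (fst p) * indicator E p)\<^sup>2 \<partial>lborel) * (\<integral>\<^sup>+p. (G (snd p) * indicator E p)\<^sup>2 \<partial>lborel)"
    by (rule Cauchy_Schwarz_nn_integral) measurable
  also have "\<dots> \<le> (ennreal Y * (nnsq F)) * (ennreal X * (nnsq G))"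
    by (intro mult_mono slice1_integral_le slice2_integral_le assms m) auto
  also have "\<dots> = ennreal (X * Y) * ((nnsq F) * (nnsq G))"
    using assms by (simp add: ennreal_mult mult_ac)
  finally show "(form_on E F G)\<^sup>2 \<le> \<dots>" .
qed

text \<open>
  With \<open>w\<close> the inner integral, writing \<open>\<parallel>w\<parallel>\<^sup>2\<close> as \<open>w\<close> tested against itself gives a trilinear form, where
  Cauchy-Schwarz on the plane only needs the slice in one of the two directions; \<open>E\<close> is bounded so that \<open>\<parallel>w\<parallel>\<close> is finite
  and can be cancelled.
\<close>

lemma sq_bd_slice:
  assumes sl: "slice1_le E X \<or> slice2_le E X" and E: "E \<in> sets borel" and bE: "E \<subseteq> {-R..R} \<times> {-R..R}"
  shows "sq_bd E X"
  unfolding sq_bd_def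
proof (intro allI impI)
  fix F G :: "real \<Rightarrow> ennreal" assume m[measurable]: "F \<in> borel_measurable borel" "G \<in> borel_measurable borel"
    and fin: "(nnsq F) < \<infinity>" "(nnsq G) < \<infinity>"
  have [measurable]: "E \<in> sets (borel \<Otimes>\<^sub>M borel)" using E unfolding borel_prod .
  define w where "w \<zeta> = (conv_on E F G \<zeta>)" for \<zeta>
  have [measurable]: "w \<in> borel_measurable borel" unfolding w_def[abs_def] by measurable
  define W where "W = (\<integral>\<^sup>+\<zeta>. (w \<zeta>)\<^sup>2 \<partial>lborel)"
  define NF NG where "NF = (nnsq F)" and "NG = (nnsq G)"
  have "W \<le> (\<integral>\<^sup>+\<zeta>. (NF * NG) * indicator {- (2 * R)..2 * R} \<zeta> \<partial>lborel)"
    unfolding W_def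
  proof (rule nn_integral_mono)
    fix \<zeta>
    show "(w \<zeta>)\<^sup>2 \<le> (NF * NG) * indicator {- (2 * R)..2 * R} \<zeta>"
    proof (cases "\<zeta> \<in> {- (2 * R)..2 * R}")
      case False
      then have "(\<zeta> - \<eta>, \<eta>) \<notin> E" for \<eta> using bE by (auto dest!: subsetD)
      then have "w \<zeta> = 0" by (simp add: w_def indicator_def)
      then show ?thesis by simp
    next
      case True
      have "w \<zeta> \<le> (\<integral>\<^sup>+\<eta>. F (\<zeta> - \<eta>) * G \<eta> \<partial>lborel)"
        unfolding w_def by (intro nn_integral_mono) (auto simp: indicator_def)
      then have "(w \<zeta>)\<^sup>2 \<le> (\<integral>\<^sup>+\<eta>. F (\<zeta> - \<eta>) * G \<eta> \<partial>lborel)\<^sup>2" by (rule power_mono) simp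
      also have "\<dots> \<le> (\<integral>\<^sup>+\<eta>. (F (\<zeta> - \<eta>))\<^sup>2 \<partial>lborel) * NG"
        unfolding NG_def by (rule Cauchy_Schwarz_nn_integral) measurable
      also have "(\<integral>\<^sup>+\<eta>. (F (\<zeta> - \<eta>))\<^sup>2 \<partial>lborel) = NF"
        unfolding NF_def by (subst nn_integral_real_affine[where c = "-1" and t = \<zeta> and f = "\<lambda>x. (F x)\<^sup>2"]) simp_all
      finally show ?thesis using True by simp
    qed
  qed
  also have "\<dots> < \<infinity>"
    using fin by (subst nn_integral_cmult_indicator) (auto simp: NF_def NG_def ennreal_mult_less_top emeasure_lborel_Icc_eq)
  finally have Wfin: "W < \<infinity>" .
  have "W = (\<integral>\<^sup>+\<zeta>. \<integral>\<^sup>+\<eta>. w \<zeta> * (F (\<zeta> - \<eta>) * G \<eta> * indicator E (\<zeta> - \<eta>, \<eta>)) \<partial>lborel \<partial>lborel)"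
    unfolding W_def power2_eq_square by (subst (2) w_def) (simp add: nn_integral_cmult)
  also have "\<dots> = (\<integral>\<^sup>+p. w (fst p + snd p) * (F (fst p) * G (snd p) * indicator E p) \<partial>lborel)"
    by (subst nn_integral_shear[symmetric]) (simp_all add: borel_prod[symmetric])
  finally have Weq: "W = (\<integral>\<^sup>+p. w (fst p + snd p) * (F (fst p) * G (snd p) * indicator E p) \<partial>lborel)" .
  \<comment> \<open>At fixed \<xi>, translation invariance makes the \<eta>-integral of w(\<xi> +
    \<eta>)^2 equal to \<open>W\<close>. This pairing costs no slice, so the indicator can stay
    entirely with the other factor.\<close>
  have shift1: "(\<integral>\<^sup>+p. (w (fst p + snd p) * F (fst p))\<^sup>2 \<partial>lborel) = NF * W"
  proof -
    have "(\<integral>\<^sup>+p. (w (fst p + snd p) * F (fst p))\<^sup>2 \<partial>lborel) = (\<integral>\<^sup>+\<xi>. \<integral>\<^sup>+\<eta>. (F \<xi>)\<^sup>2 * (w (\<xi> + \<eta>))\<^sup>2 \<partial>lborel \<partial>lborel)"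
      unfolding lborel_prod[symmetric] by (subst lborel.nn_integral_fst[symmetric]) (simp_all add: power_mult_distrib mult.commute)
    also have "\<dots> = (\<integral>\<^sup>+\<xi>. (F \<xi>)\<^sup>2 * W \<partial>lborel)"
    proof (rule nn_integral_cong)
      fix \<xi>
      have "W = (\<integral>\<^sup>+\<eta>. (w (\<xi> + \<eta>))\<^sup>2 \<partial>lborel)"
        unfolding W_def by (subst nn_integral_real_affine[where c = 1 and t = \<xi>]) simp_all
      then show "(\<integral>\<^sup>+\<eta>. (F \<xi>)\<^sup>2 * (w (\<xi> + \<eta>))\<^sup>2 \<partial>lborel) = (F \<xi>)\<^sup>2 * W" by (simp add: nn_integral_cmult)
    qed
    finally show ?thesis by (simp add: nn_integral_multc NF_def)
  qed
  have shift2: "(\<integral>\<^sup>+p. (w (fst p + snd p) * G (snd p))\<^sup>2 \<partial>lborel) = NG * W"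
  proof -
    have "(\<integral>\<^sup>+p. (w (fst p + snd p) * G (snd p))\<^sup>2 \<partial>lborel) = (\<integral>\<^sup>+\<eta>. \<integral>\<^sup>+\<xi>. (G \<eta>)\<^sup>2 * (w (\<eta> + \<xi>))\<^sup>2 \<partial>lborel \<partial>lborel)"
      unfolding lborel_prod[symmetric] by (subst lborel_pair.nn_integral_snd[symmetric]) (simp_all add: power_mult_distrib mult.commute add.commute)
    also have "\<dots> = (\<integral>\<^sup>+\<eta>. (G \<eta>)\<^sup>2 * W \<partial>lborel)"
    proof (rule nn_integral_cong)
      fix \<eta>
      have "W = (\<integral>\<^sup>+\<xi>. (w (\<eta> + \<xi>))\<^sup>2 \<partial>lborel)"
        unfolding W_def by (subst nn_integral_real_affine[where c = 1 and t = \<eta>]) simp_all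
      then show "(\<integral>\<^sup>+\<xi>. (G \<eta>)\<^sup>2 * (w (\<eta> + \<xi>))\<^sup>2 \<partial>lborel) = (G \<eta>)\<^sup>2 * W" by (simp add: nn_integral_cmult)
    qed
    finally show ?thesis by (simp add: nn_integral_multc NG_def)
  qed
  have [measurable]: "(\<lambda>p. F (fst p)) \<in> borel_measurable (borel :: (real \<times> real) measure)"
     "(\<lambda>p. G (snd p)) \<in> borel_measurable (borel :: (real \<times> real) measure)"
     "(\<lambda>p. w (fst p + snd p)) \<in> borel_measurable (borel :: (real \<times> real) measure)" "E \<in> sets borel"
    using E by (simp_all add: borel_prod[symmetric])
  have "W * W \<le> W * (ennreal X * (NF * NG))"
    using sl
  proof
    assume s: "slice1_le E X"
    have "W * W = (\<integral>\<^sup>+p. (w (fst p + snd p) * F (fst p)) * (G (snd p) * indicator E p) \<partial>lborel)\<^sup>2"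
      unfolding power2_eq_square Weq by (simp add: mult.assoc)
    also have "\<dots> \<le> (\<integral>\<^sup>+p. (w (fst p + snd p) * F (fst p))\<^sup>2 \<partial>lborel) * (\<integral>\<^sup>+p. (G (snd p) * indicator E p)\<^sup>2 \<partial>lborel)"
      by (rule Cauchy_Schwarz_nn_integral) measurable
    also have "\<dots> \<le> (NF * W) * (ennreal X * NG)"
      unfolding shift1 NG_def by (intro mult_left_mono slice1_integral_le s E) auto
    finally show ?thesis by (simp add: mult_ac)
  next
    assume s: "slice2_le E X"
    have "W * W = (\<integral>\<^sup>+p. (w (fst p + snd p) * G (snd p)) * (F (fst p) * indicator E p) \<partial>lborel)\<^sup>2"
      unfolding power2_eq_square Weq by (simp add: mult_ac)
    also have "\<dots> \<le> (\<integral>\<^sup>+p. (w (fst p + snd p) * G (snd p))\<^sup>2 \<partial>lborel) * (\<integral>\<^sup>+p. (F (fst p) * indicator E p)\<^sup>2 \<partial>lborel)"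
      by (rule Cauchy_Schwarz_nn_integral) measurable
    also have "\<dots> \<le> (NG * W) * (ennreal X * NF)"
      unfolding shift2 NF_def by (intro mult_left_mono slice2_integral_le s E) auto
    finally show ?thesis by (simp add: mult_ac)
  qed
  then have "W \<le> ennreal X * (NF * NG)"
    using Wfin by (cases "W = 0") (auto simp: ennreal_mult_le_mult_iff)
  then show "(\<integral>\<^sup>+\<zeta>. (conv_on E F G \<zeta>)\<^sup>2 \<partial>lborel)
       \<le> ennreal X * ((nnsq F) * (nnsq G))"
    by (simp add: W_def w_def NF_def NG_def)
qed

subsection \<open>Sublevel sets of the phase\<close>

text \<open>Any point of the set can serve as centre. The resulting interval bounds the measure with
  no information on the number of components of the set.\<close>

lemma pairwise_close_subset:
  fixes S :: "real set"
  assumes "\<And>x y. x \<in> S \<Longrightarrow> y \<in> S \<Longrightarrow> x < y \<Longrightarrow> y - x \<le> d" "0 \<le> d"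
  obtains z where "S \<subseteq> {z - d..z + d}"
proof (cases "S = {}")
  case False
  then obtain z where z: "z \<in> S" by blast
  have "S \<subseteq> {z - d..z + d}"
  proof
    fix x assume x: "x \<in> S"
    show "x \<in> {z - d..z + d}"
      using assms(1)[OF x z] assms(1)[OF z x] assms(2) by (cases x z rule: linorder_cases) auto
  qed
  then show thesis by (rule that)
qed (auto intro: that)

lemma emeasure_Icc_centered: "0 \<le> d \<Longrightarrow> emeasure lborel {z - d..z + d :: real} = ennreal (2 * d)"
  by (simp add: emeasure_lborel_Icc_eq)

lemma emeasure_le_pairwise_close:
  fixes S :: "real set"
  assumes "\<And>x y. x \<in> S \<Longrightarrow> y \<in> S \<Longrightarrow> x < y \<Longrightarrow> y - x \<le> d" "0 \<le> d"
  shows "emeasure lborel S \<le> ennreal (2 * d)"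
proof -
  obtain z where "S \<subseteq> {z - d..z + d}" using pairwise_close_subset[OF assms] by blast
  then have "emeasure lborel S \<le> emeasure lborel {z - d..z + d}" by (rule emeasure_mono) simp
  then show ?thesis using assms(2) by (simp add: emeasure_Icc_centered)
qed

text \<open>Values at two points of the set differ by at most 2 l, so by the mean value theorem the
  points are within 2 l / c; enclosing the set in an interval doubles this.\<close>

lemma sublevel_measure_deriv:
  fixes h :: "real \<Rightarrow> real"
  assumes der: "\<And>x. x \<in> {u<..<v} \<Longrightarrow> (h has_real_derivative h' x) (at x)"
    and c: "0 < c" "\<And>x. x \<in> {u<..<v} \<Longrightarrow> c \<le> \<bar>h' x\<bar>" and l: "0 < l"
  shows "emeasure lborel {x \<in> {u<..<v}. \<bar>h x\<bar> < l} \<le> ennreal (4 / c * l)"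
proof -
  have "emeasure lborel {x \<in> {u<..<v}. \<bar>h x\<bar> < l} \<le> ennreal (2 * (2 * l / c))"
  proof (rule emeasure_le_pairwise_close)
    fix x y assume xy: "x \<in> {x \<in> {u<..<v}. \<bar>h x\<bar> < l}" "y \<in> {x \<in> {u<..<v}. \<bar>h x\<bar> < l}" "x < y"
    obtain z where z: "x < z" "z < y" "h y - h x = (y - x) * h' z"
      using MVT2[OF \<open>x < y\<close>, of h h'] der xy by auto
    have "c * (y - x) \<le> \<bar>h' z\<bar> * (y - x)" using c(2)[of z] z xy by (intro mult_right_mono) auto
    also have "\<dots> = \<bar>h y - h x\<bar>" using z by (simp add: abs_mult)
    also have "\<dots> \<le> 2 * l" using xy by auto
    finally show "y - x \<le> 2 * l / c" using c(1) by (simp add: field_simps)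
  qed (use c l in auto)
  then show ?thesis by simp
qed

text \<open>Starting from h'(x) >= 0, the derivative at z is at least c (z - x). The mean value
  theorem for h minus the parabola (c/2)(z - x)^2 integrates this once more.\<close>

lemma convex_growth:
  fixes h :: "real \<Rightarrow> real"
  assumes der: "\<And>x. x \<in> {u<..<v} \<Longrightarrow> (h has_real_derivative h' x) (at x)"
    and der2: "\<And>x. x \<in> {u<..<v} \<Longrightarrow> (h' has_real_derivative h'' x) (at x)"
    and c: "\<And>x. x \<in> {u<..<v} \<Longrightarrow> c \<le> h'' x"
    and x: "x \<in> {u<..<v}" and y: "y \<in> {u<..<v}" and "x < y" and pos: "0 \<le> h' x"
  shows "c / 2 * (y - x)\<^sup>2 \<le> h y - h x"
proof -
  have lower: "c * (z - x) \<le> h' z" if z: "x < z" "z < y" for z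
  proof -
    obtain w where w: "x < w" "w < z" "h' z - h' x = (z - x) * h'' w"
      using MVT2[OF z(1), of h' h''] der2 x y z by auto
    have "c * (z - x) \<le> (z - x) * h'' w"
      using mult_right_mono[OF c[of w], of "z - x"] w z x y by (simp add: mult.commute)
    then show ?thesis using w(3) pos by linarith
  qed
  have "\<exists>z>x. z < y \<and> (h y - c / 2 * (y - x)\<^sup>2) - (h x - c / 2 * (x - x)\<^sup>2) = (y - x) * (h' z - c * (z - x))"
  proof (rule MVT2[OF \<open>x < y\<close>])
    fix z assume "x \<le> z" "z \<le> y"
    then have "z \<in> {u<..<v}" using x y by auto
    then show "((\<lambda>z. h z - c / 2 * (z - x)\<^sup>2) has_real_derivative (h' z - c * (z - x))) (at z)"
      by (auto intro!: derivative_eq_intros der)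
  qed
  then obtain z where z: "x < z" "z < y" "(h y - c / 2 * (y - x)\<^sup>2) - h x = (y - x) * (h' z - c * (z - x))"
    by auto
  have "0 \<le> (y - x) * (h' z - c * (z - x))" using lower[OF z(1,2)] \<open>x < y\<close> by simp
  then show ?thesis using z(3) by simp
qed

text \<open>Split by the sign of h'. On each side quadratic growth gives (c/2) d^2 <= 2 l for points
  at distance d, so d <= 2 sqrt(l/c); the two enclosing intervals of length 4 sqrt(l/c) account for
  the 8.\<close>

lemma sublevel_measure_convex:
  fixes h :: "real \<Rightarrow> real"
  assumes der: "\<And>x. x \<in> {u<..<v} \<Longrightarrow> (h has_real_derivative h' x) (at x)"
    and der2: "\<And>x. x \<in> {u<..<v} \<Longrightarrow> (h' has_real_derivative h'' x) (at x)"
    and c: "0 < c" "\<And>x. x \<in> {u<..<v} \<Longrightarrow> c \<le> h'' x" and l: "0 < l"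
  shows "emeasure lborel {x \<in> {u<..<v}. \<bar>h x\<bar> < l} \<le> ennreal (8 / sqrt c * sqrt l)"
proof -
  let ?S = "{x \<in> {u<..<v}. \<bar>h x\<bar> < l}"
  let ?I = "\<lambda>z. {z - 2 * sqrt (l / c)..z + 2 * sqrt (l / c)}"
  let ?A = "{x \<in> {u<..<v}. \<bar>h x\<bar> < l \<and> 0 \<le> h' x}" and ?B = "{x \<in> {u<..<v}. \<bar>h x\<bar> < l \<and> h' x \<le> 0}"
  have close: "y - x \<le> 2 * sqrt (l / c)" if "c / 2 * (y - x)\<^sup>2 \<le> \<bar>h y - h x\<bar>" "\<bar>h x\<bar> < l" "\<bar>h y\<bar> < l" for x y
  proof -
    have "c / 2 * (y - x)\<^sup>2 \<le> 2 * l" using that by linarith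
    then have "(y - x)\<^sup>2 \<le> 4 * (l / c)" using c(1) by (simp add: field_simps)
    then have "y - x \<le> sqrt (4 * (l / c))" by (rule real_le_rsqrt)
    then show ?thesis by (simp only: real_sqrt_mult) simp
  qed
  obtain z1 where A: "?A \<subseteq> ?I z1"
  proof (rule pairwise_close_subset)
    fix x y assume xy: "x \<in> ?A" "y \<in> ?A" "x < y"
    have "c / 2 * (y - x)\<^sup>2 \<le> h y - h x"
      by (rule convex_growth[where u = u and v = v and h' = h' and h'' = h'']) (use assms xy in auto)
    then have "c / 2 * (y - x)\<^sup>2 \<le> \<bar>h y - h x\<bar>" by linarith
    then show "y - x \<le> 2 * sqrt (l / c)" by (rule close) (use xy in auto)
  qed (use c l in auto)
  obtain z2 where B: "?B \<subseteq> ?I z2"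
  proof (rule pairwise_close_subset)
    fix x y assume xy: "x \<in> ?B" "y \<in> ?B" "x < y"
    \<comment> \<open>The reflection x to -x preserves convexity and reverses the sign of the first
      derivative, reducing to the case already treated.\<close>
    have "c / 2 * (- x - - y)\<^sup>2 \<le> h (- (- x)) - h (- (- y))"
    proof (rule convex_growth[where u = "- v" and v = "- u" and h = "\<lambda>x. h (- x)" and h' = "\<lambda>x. - h' (- x)" and h'' = "\<lambda>x. h'' (- x)"])
      fix z assume z: "z \<in> {- v<..<- u}"
      then have z': "- z \<in> {u<..<v}" by auto
      show "((\<lambda>x. h (- x)) has_real_derivative - h' (- z)) (at z)"
        using DERIV_mirror[of h "h' (- z)" z] der[OF z'] by simp
      show "((\<lambda>x. - h' (- x)) has_real_derivative h'' (- z)) (at z)"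
        using DERIV_minus[OF iffD1[OF DERIV_mirror der2[OF z']]] by simp
      show "c \<le> h'' (- z)" by (rule c(2)[OF z'])
    qed (use xy in auto)
    then have "c / 2 * (y - x)\<^sup>2 \<le> h x - h y" by (simp add: power2_commute)
    then have "c / 2 * (y - x)\<^sup>2 \<le> \<bar>h y - h x\<bar>" by linarith
    then show "y - x \<le> 2 * sqrt (l / c)" by (rule close) (use xy in auto)
  qed (use c l in auto)
  have "?S \<subseteq> ?I z1 \<union> ?I z2"
  proof
    fix x assume "x \<in> ?S"
    then have "x \<in> ?A \<or> x \<in> ?B" by auto
    then show "x \<in> ?I z1 \<union> ?I z2"
      using A B by blast
  qed
  then have "emeasure lborel ?S
    \<le> emeasure lborel (?I z1 \<union> ?I z2)"
    by (rule emeasure_mono) simp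
  also have "\<dots> \<le> emeasure lborel (?I z1) + emeasure lborel (?I z2)"
    by (rule emeasure_subadditive) simp_all
  also have "\<dots> = ennreal (2 * (2 * sqrt (l / c))) + ennreal (2 * (2 * sqrt (l / c)))"
    using c l by (subst (1 2) emeasure_Icc_centered) simp_all
  also have "\<dots> = ennreal (8 / sqrt c * sqrt l)"
    using c l by (subst ennreal_plus[symmetric]) (auto simp: real_sqrt_divide)
  finally show ?thesis .
qed

section \<open>Local power laws for slices and their globalisation by compactness\<close>

definition nbox :: "real \<times> real \<Rightarrow> real \<Rightarrow> (real \<times> real) set" where
  "nbox p r = {fst p - r<..<fst p + r} \<times> {snd p - r<..<snd p + r}"

definition sublevel :: "(real \<times> real \<Rightarrow> real) \<Rightarrow> real \<Rightarrow> (real \<times> real) set" where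
  "sublevel \<phi> l = {p. \<bar>\<phi> p\<bar> < l}"

text \<open>Only slices in the first variable are measured, uniformly in the second; the other
  direction is reached by exchanging the arguments of \<open>\<phi>\<close>.\<close>

definition loc_slice :: "(real \<times> real \<Rightarrow> real) \<Rightarrow> real \<times> real \<Rightarrow> real \<Rightarrow> bool" where
  "loc_slice \<phi> p \<alpha> \<longleftrightarrow> (\<exists>r>0. \<exists>C\<ge>0. \<forall>l>0. slice1_le (nbox p r \<inter> sublevel \<phi> l) (C * l powr \<alpha>))"

lemma open_nbox: "open (nbox p r)" unfolding nbox_def by (intro open_Times) auto

lemma mem_nbox: "0 < r \<Longrightarrow> p \<in> nbox p r" by (cases p) (auto simp: nbox_def)

lemma continuous_nbox:
  fixes D :: "real \<times> real \<Rightarrow> real"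
  assumes cont: "continuous_on UNIV D" and "open V" "D p \<in> V"
  obtains r where "r > 0" "\<And>z. z \<in> nbox p r \<Longrightarrow> D z \<in> V"
proof -
  have "open (D -` V)" using open_vimage[OF assms(2) cont] .
  then obtain e where e: "e > 0" "ball p e \<subseteq> D -` V"
    using assms(3) by (meson openE vimage_eq)
  have "nbox p (e / 2) \<subseteq> ball p e"
  proof
    fix z assume z: "z \<in> nbox p (e / 2)"
    have "dist p z \<le> dist (fst p) (fst z) + dist (snd p) (snd z)"
      unfolding dist_prod_def by (rule order_trans[OF sqrt_sum_squares_le_sum_abs]) simp
    also have "\<dots> < e" using z by (cases z) (auto simp: nbox_def dist_real_def abs_real_def)
    finally show "z \<in> ball p e" by simp
  qed
  then show thesis using e by (intro that[of "e / 2"]) auto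
qed

lemma slice1_nbox: "slice1_le (nbox p r \<inter> A) (2 * \<bar>r\<bar>)"
  unfolding slice1_le_def
proof
  fix \<eta>
  have "emeasure lborel {\<xi>. (\<xi>, \<eta>) \<in> nbox p r \<inter> A} \<le> emeasure lborel {fst p - \<bar>r\<bar>..fst p + \<bar>r\<bar>}"
    by (rule emeasure_mono) (auto simp: nbox_def)
  also have "\<dots> = ennreal (2 * \<bar>r\<bar>)" by (simp add: emeasure_lborel_Icc_eq)
  finally show "emeasure lborel {\<xi>. (\<xi>, \<eta>) \<in> nbox p r \<inter> A} \<le> ennreal (2 * \<bar>r\<bar>)" .
qed

lemma loc_slice_0: "loc_slice \<phi> p 0"
proof -
  have "slice1_le (nbox p 1 \<inter> sublevel \<phi> l) (2 * l powr 0)" if "0 < l" for l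
    using slice1_nbox[of p 1] that by simp
  then show ?thesis unfolding loc_slice_def by (intro exI[of _ 1] exI[of _ 2] conjI) auto
qed

text \<open>Every exponent is allowed: near \<open>p\<close> the set is empty for l <=
  |\<phi>(p)|/2, and for larger l the trivial bound 2 r is absorbed by the constant.\<close>

lemma loc_slice_nonzero:
  assumes cont: "continuous_on UNIV \<phi>" and nz: "\<phi> p \<noteq> 0" and "0 \<le> \<alpha>"
  shows "loc_slice \<phi> p \<alpha>"
proof -
  let ?c = "\<bar>\<phi> p\<bar> / 2"
  have c: "?c > 0" using nz by simp
  obtain r where r: "r > 0" "\<And>z. z \<in> nbox p r \<Longrightarrow> \<bar>\<phi> z\<bar> \<in> {?c<..}"
    using continuous_nbox[of "\<lambda>z. \<bar>\<phi> z\<bar>" "{?c<..}" p] continuous_on_rabs[OF cont] c by auto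
  have "slice1_le (nbox p r \<inter> sublevel \<phi> l) (2 * r / ?c powr \<alpha> * l powr \<alpha>)" if l: "0 < l" for l
  proof (cases "l \<le> ?c")
    case True
    then have "nbox p r \<inter> sublevel \<phi> l = {}" using r(2) by (force simp: sublevel_def)
    then show ?thesis by (simp add: slice1_le_def)
  next
    case False
    then have "?c powr \<alpha> \<le> l powr \<alpha>" using c assms(3) by (intro powr_mono2) auto
    then have "2 * r \<le> 2 * r / ?c powr \<alpha> * l powr \<alpha>" using c r by (simp add: field_simps)
    then have "ennreal (2 * \<bar>r\<bar>) \<le> ennreal (2 * r / ?c powr \<alpha> * l powr \<alpha>)" using r by (intro ennreal_leI) simp
    then show ?thesis using slice1_nbox[of p r] unfolding slice1_le_def by (meson order_trans)
  qed
  then show ?thesis unfolding loc_slice_def using r c by (intro exI[of _ r] exI[of _ "2 * r / ?c powr \<alpha>"] conjI) auto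
qed

lemma loc_sliceI:
  assumes "0 < r" "0 \<le> C"
    and "\<And>l \<eta>. 0 < l \<Longrightarrow> \<eta> \<in> {snd p - r<..<snd p + r} \<Longrightarrow>
      emeasure lborel {\<xi> \<in> {fst p - r<..<fst p + r}. \<bar>\<phi> (\<xi>, \<eta>)\<bar> < l} \<le> ennreal (C * l powr \<alpha>)"
  shows "loc_slice \<phi> p \<alpha>"
  unfolding loc_slice_def slice1_le_def
proof (rule exI[of _ r], rule conjI[OF assms(1)], rule exI[of _ C], rule conjI[OF assms(2)], intro allI impI)
  fix l \<eta> :: real assume l: "0 < l"
  have "{\<xi>. (\<xi>, \<eta>) \<in> nbox p r \<inter> sublevel \<phi> l} =
    (if \<eta> \<in> {snd p - r<..<snd p + r} then {\<xi> \<in> {fst p - r<..<fst p + r}. \<bar>\<phi> (\<xi>, \<eta>)\<bar> < l} else {})"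
    by (auto simp: nbox_def sublevel_def)
  then show "emeasure lborel {\<xi>. (\<xi>, \<eta>) \<in> nbox p r \<inter> sublevel \<phi> l} \<le> ennreal (C * l powr \<alpha>)"
    using assms(3)[OF l, of \<eta>]
    by (cases "\<eta> \<in> {snd p - r<..<snd p + r}") (simp_all only: if_True if_False emeasure_empty zero_le simp_thms)
qed

lemma loc_slice_order1:
  assumes der: "\<And>x y. ((\<lambda>s. \<phi> (s, y)) has_real_derivative D (x, y)) (at x)"
    and cont: "continuous_on UNIV D" and nz: "D p \<noteq> 0"
  shows "loc_slice \<phi> p 1"
proof -
  let ?c = "\<bar>D p\<bar> / 2"
  have c: "?c > 0" using nz by simp
  obtain r where r: "r > 0" "\<And>z. z \<in> nbox p r \<Longrightarrow> \<bar>D z\<bar> \<in> {?c<..}"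
    using continuous_nbox[of "\<lambda>z. \<bar>D z\<bar>" "{?c<..}" p] continuous_on_rabs[OF cont] c by auto
  show ?thesis
  proof (rule loc_sliceI[OF r(1), of "4 / ?c"])
    fix l \<eta> :: real assume l: "0 < l" and \<eta>: "\<eta> \<in> {snd p - r<..<snd p + r}"
    have "?c \<le> \<bar>D (x, \<eta>)\<bar>" if "x \<in> {fst p - r<..<fst p + r}" for x
      using r(2)[of "(x, \<eta>)"] that \<eta> by (simp add: nbox_def)
    from sublevel_measure_deriv[OF der c this l]
    show "emeasure lborel {\<xi> \<in> {fst p - r<..<fst p + r}. \<bar>\<phi> (\<xi>, \<eta>)\<bar> < l} \<le> ennreal (4 / ?c * l powr 1)"
      using l by simp
  qed (use c in simp)
qed

lemma loc_slice_order2_pos: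
  assumes der: "\<And>x y. ((\<lambda>s. \<phi> (s, y)) has_real_derivative D (x, y)) (at x)"
    and der2: "\<And>x y. ((\<lambda>s. D (s, y)) has_real_derivative DD (x, y)) (at x)"
    and cont: "continuous_on UNIV DD" and pos: "DD p > 0"
  shows "loc_slice \<phi> p (1/2)"
proof -
  let ?c = "DD p / 2"
  have c: "?c > 0" using pos by simp
  obtain r where r: "r > 0" "\<And>z. z \<in> nbox p r \<Longrightarrow> DD z \<in> {?c<..}"
    using continuous_nbox[of DD "{?c<..}" p] cont c by auto
  show ?thesis
  proof (rule loc_sliceI[OF r(1), of "8 / sqrt ?c"])
    fix l \<eta> :: real assume l: "0 < l" and \<eta>: "\<eta> \<in> {snd p - r<..<snd p + r}"
    have "?c \<le> DD (x, \<eta>)" if "x \<in> {fst p - r<..<fst p + r}" for x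
      using r(2)[of "(x, \<eta>)"] that \<eta> by (simp add: nbox_def)
    from sublevel_measure_convex[OF der der2 c this l]
    show "emeasure lborel {\<xi> \<in> {fst p - r<..<fst p + r}. \<bar>\<phi> (\<xi>, \<eta>)\<bar> < l} \<le> ennreal (8 / sqrt ?c * l powr (1/2))"
      using l by (simp add: powr_half_sqrt)
  qed (use c in simp)
qed

text \<open>The sign of the second derivative is immaterial since \<open>\<phi>\<close> and its
  negative have the same sublevel sets.\<close>

lemma loc_slice_order2:
  assumes der: "\<And>x y. ((\<lambda>s. \<phi> (s, y)) has_real_derivative D (x, y)) (at x)"
    and der2: "\<And>x y. ((\<lambda>s. D (s, y)) has_real_derivative DD (x, y)) (at x)"
    and cont: "continuous_on UNIV DD" and nz: "DD p \<noteq> 0"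
  shows "loc_slice \<phi> p (1/2)"
proof (cases "DD p > 0")
  case True then show ?thesis using loc_slice_order2_pos[OF der der2 cont] by blast
next
  case False
  have "loc_slice (\<lambda>z. - \<phi> z) p (1/2)"
    by (rule loc_slice_order2_pos[where D = "\<lambda>z. - D z" and DD = "\<lambda>z. - DD z"])
       (use False nz in \<open>auto intro!: DERIV_minus der der2 continuous_on_minus cont\<close>)
  then show ?thesis by (simp add: loc_slice_def sublevel_def)
qed

text \<open>\<open>\<delta>\<close> and \<open>\<gamma>\<close> are exponents for the squared sup
  and L2 norms. The cap \<open>L\<close> on l allows different points to be given the same, possibly
  lowered, exponents at the price of a constant.\<close>

definition loc_bd :: "(real \<times> real \<Rightarrow> real) \<Rightarrow> real \<Rightarrow> real \<Rightarrow> real \<Rightarrow> (real \<times> real) set \<Rightarrow> bool" where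
  "loc_bd \<phi> L \<delta> \<gamma> U \<longleftrightarrow> (\<exists>C>0. \<forall>l>0. l \<le> L \<longrightarrow>
     sup_bd (U \<inter> sublevel \<phi> l) (C * l powr \<delta>) \<and> sq_bd (U \<inter> sublevel \<phi> l) (C * l powr \<gamma>))"

lemma slice1_mono:
  assumes "slice1_le E X" "E' \<subseteq> E" "X \<le> X'" "E \<in> sets borel" shows "slice1_le E' X'"
  unfolding slice1_le_def
proof
  fix \<eta>
  have [measurable]: "E \<in> sets (borel \<Otimes>\<^sub>M borel)" using assms(4) unfolding borel_prod .
  have "emeasure lborel {\<xi>. (\<xi>, \<eta>) \<in> E'} \<le> emeasure lborel {\<xi>. (\<xi>, \<eta>) \<in> E}"
    using assms(2) by (intro emeasure_mono) auto
  also have "\<dots> \<le> ennreal X" using assms(1) by (auto simp: slice1_le_def)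
  also have "\<dots> \<le> ennreal X'" by (intro ennreal_leI assms(3))
  finally show "emeasure lborel {\<xi>. (\<xi>, \<eta>) \<in> E'} \<le> ennreal X'" .
qed

lemma sublevel_borel:
  assumes [measurable]: "\<phi> \<in> borel_measurable borel" shows "sublevel \<phi> l \<in> sets borel"
  unfolding sublevel_def by measurable

text \<open>The sup bound uses the product of the two slice lengths, so exponents add; the L2 bound
  needs one direction only and takes the better exponent.\<close>

lemma loc_bd_of_slices:
  assumes \<phi>: "continuous_on UNIV \<phi>"
    and s1: "loc_slice \<phi> p \<alpha>" and s2: "loc_slice (\<lambda>z. \<phi> (snd z, fst z)) (snd p, fst p) \<beta>"
    and L: "0 < L" and "\<delta> \<le> \<alpha> + \<beta>" "\<gamma> \<le> max \<alpha> \<beta>"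
  shows "\<exists>U. open U \<and> p \<in> U \<and> loc_bd \<phi> L \<delta> \<gamma> U"
proof -
  have [measurable]: "\<phi> \<in> borel_measurable borel" by (rule borel_measurable_continuous_onI[OF \<phi>])
  obtain r1 C1 where 1: "r1 > 0" "C1 \<ge> 0" "\<And>l. l > 0 \<Longrightarrow> slice1_le (nbox p r1 \<inter> sublevel \<phi> l) (C1 * l powr \<alpha>)"
    using s1 unfolding loc_slice_def by blast
  obtain r2 C2 where 2: "r2 > 0" "C2 \<ge> 0"
    "\<And>l. l > 0 \<Longrightarrow> slice1_le (nbox (snd p, fst p) r2 \<inter> sublevel (\<lambda>z. \<phi> (snd z, fst z)) l) (C2 * l powr \<beta>)"
    using s2 unfolding loc_slice_def by blast
  define r where "r = min r1 r2"
  define U where "U = nbox p r"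
  have r: "r > 0" "r \<le> r1" "r \<le> r2" using 1 2 by (auto simp: r_def)
  have U: "open U" "p \<in> U" unfolding U_def by (auto simp: open_nbox mem_nbox r)
  have meas: "V \<inter> sublevel \<phi> l \<in> sets borel" if "open V" for V l using that by (auto simp: sublevel_borel)
  have sl1: "slice1_le (U \<inter> sublevel \<phi> l) (C1 * l powr \<alpha>)" if "l > 0" for l
    by (rule slice1_mono[OF 1(3)[OF that]]) (use r in \<open>auto simp: U_def nbox_def meas open_nbox[unfolded nbox_def]\<close>)
  have sl2: "slice2_le (U \<inter> sublevel \<phi> l) (C2 * l powr \<beta>)" if "l > 0" for l
    unfolding slice2_le_def
  proof
    fix \<xi>
    let ?E = "nbox (snd p, fst p) r2 \<inter> sublevel (\<lambda>z. \<phi> (snd z, fst z)) l"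
    have "(\<lambda>z. \<phi> (snd z, fst z)) \<in> borel_measurable borel"
      by (rule borel_measurable_continuous_onI) (auto intro!: continuous_intros continuous_on_compose2[OF \<phi>])
    then have "?E \<in> sets borel" by (auto simp: sublevel_borel open_nbox)
    then have [measurable]: "?E \<in> sets (borel \<Otimes>\<^sub>M borel)" unfolding borel_prod .
    have "{\<eta>. (\<eta>, \<xi>) \<in> ?E} \<in> sets borel" by measurable
    then have "emeasure lborel {\<eta>. (\<xi>, \<eta>) \<in> U \<inter> sublevel \<phi> l} \<le> emeasure lborel {\<eta>. (\<eta>, \<xi>) \<in> ?E}"
      using r by (intro emeasure_mono) (auto simp: U_def nbox_def sublevel_def)
    also have "\<dots> \<le> ennreal (C2 * l powr \<beta>)" using 2(3)[OF that] unfolding slice1_le_def by blast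
    finally show "emeasure lborel {\<eta>. (\<xi>, \<eta>) \<in> U \<inter> sublevel \<phi> l} \<le> ennreal (C2 * l powr \<beta>)" .
  qed
  obtain R where R: "U \<subseteq> {-R..R} \<times> {-R..R}"
  proof
    show "U \<subseteq> {-(\<bar>fst p\<bar> + \<bar>snd p\<bar> + r)..\<bar>fst p\<bar> + \<bar>snd p\<bar> + r} \<times> {-(\<bar>fst p\<bar> + \<bar>snd p\<bar> + r)..\<bar>fst p\<bar> + \<bar>snd p\<bar> + r}"
      by (auto simp: U_def nbox_def)
  qed
  \<comment> \<open>Lowers an exponent on the bounded range l <= L.\<close>
  have pw: "l powr x \<le> (L powr (x - y)) * l powr y" if "0 < l" "l \<le> L" "y \<le> x" for l x y
  proof -
    have "l powr x = l powr (x - y) * l powr y" by (simp add: powr_add[symmetric])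
    also have "\<dots> \<le> L powr (x - y) * l powr y" using that by (intro mult_right_mono powr_mono2) auto
    finally show ?thesis .
  qed
  define K where "K = C1 * C2 * L powr (\<alpha> + \<beta> - \<delta>)"
  define C where "C = K + (C1 * L powr (\<alpha> - \<gamma>) + C2 * L powr (\<beta> - \<gamma>)) + 1"
  have K0: "K \<ge> 0" using 1 2 by (simp add: K_def)
  have C0: "C > 0" "K \<le> C" "C1 * L powr (\<alpha> - \<gamma>) \<le> C" "C2 * L powr (\<beta> - \<gamma>) \<le> C"
    using K0 1(2) 2(2) mult_nonneg_nonneg[OF 1(2) powr_ge_zero[of L "\<alpha> - \<gamma>"]] mult_nonneg_nonneg[OF 2(2) powr_ge_zero[of L "\<beta> - \<gamma>"]]
    unfolding C_def by linarith+
  have "sup_bd (U \<inter> sublevel \<phi> l) (C * l powr \<delta>) \<and> sq_bd (U \<inter> sublevel \<phi> l) (C * l powr \<gamma>)"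
    if l: "0 < l" "l \<le> L" for l
  proof
    have "sup_bd (U \<inter> sublevel \<phi> l) ((C1 * l powr \<alpha>) * (C2 * l powr \<beta>))"
      by (rule sup_bd_slices[OF sl1[OF l(1)] sl2[OF l(1)] meas[OF U(1)]]) (use 1 2 in auto)
    moreover have "(C1 * l powr \<alpha>) * (C2 * l powr \<beta>) \<le> C * l powr \<delta>"
    proof -
      have "(C1 * l powr \<alpha>) * (C2 * l powr \<beta>) = C1 * C2 * l powr (\<alpha> + \<beta>)" by (simp add: powr_add)
      also have "\<dots> \<le> C1 * C2 * (L powr (\<alpha> + \<beta> - \<delta>) * l powr \<delta>)"
        by (intro mult_left_mono pw l assms) (use 1 2 in auto)
      also have "\<dots> = K * l powr \<delta>" by (simp add: K_def)
      also have "\<dots> \<le> C * l powr \<delta>" by (intro mult_right_mono C0) simp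
      finally show ?thesis .
    qed
    ultimately show "sup_bd (U \<inter> sublevel \<phi> l) (C * l powr \<delta>)" by (rule sup_bd_mono[OF _ order_refl])
    show "sq_bd (U \<inter> sublevel \<phi> l) (C * l powr \<gamma>)"
    proof (cases "\<alpha> \<ge> \<beta>")
      case True
      have A: "sq_bd (U \<inter> sublevel \<phi> l) (C1 * l powr \<alpha>)"
        by (rule sq_bd_slice[OF disjI1[OF sl1[OF l(1)]] meas[OF U(1)]]) (use R in auto)
      have B: "C1 * l powr \<alpha> \<le> C1 * (L powr (\<alpha> - \<gamma>) * l powr \<gamma>)"
        by (intro mult_left_mono pw l) (use assms True 1 in auto)
      have D: "C1 * (L powr (\<alpha> - \<gamma>) * l powr \<gamma>) \<le> C * l powr \<gamma>"
        unfolding mult.assoc[symmetric] by (intro mult_right_mono C0) simp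
      show ?thesis by (rule sq_bd_mono[OF A order_refl order_trans[OF B D]])
    next
      case False
      have A: "sq_bd (U \<inter> sublevel \<phi> l) (C2 * l powr \<beta>)"
        by (rule sq_bd_slice[OF disjI2[OF sl2[OF l(1)]] meas[OF U(1)]]) (use R in auto)
      have B: "C2 * l powr \<beta> \<le> C2 * (L powr (\<beta> - \<gamma>) * l powr \<gamma>)"
        by (intro mult_left_mono pw l) (use assms False 2 in auto)
      have D: "C2 * (L powr (\<beta> - \<gamma>) * l powr \<gamma>) \<le> C * l powr \<gamma>"
        unfolding mult.assoc[symmetric] by (intro mult_right_mono C0) simp
      show ?thesis by (rule sq_bd_mono[OF A order_refl order_trans[OF B D]])
    qed
  qed
  then have "loc_bd \<phi> L \<delta> \<gamma> U" unfolding loc_bd_def using C0(1) by blast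
  with U show ?thesis by blast
qed

lemma loc_bd_mono: "loc_bd \<phi> L \<delta> \<gamma> U \<Longrightarrow> V \<subseteq> U \<Longrightarrow> loc_bd \<phi> L \<delta> \<gamma> V"
  unfolding loc_bd_def by (meson Int_mono order_refl sq_bd_mono sup_bd_mono)

lemma loc_bd_Un:
  assumes \<phi>: "\<phi> \<in> borel_measurable borel" and "open U" "open V" "loc_bd \<phi> L \<delta> \<gamma> U" "loc_bd \<phi> L \<delta> \<gamma> V"
  shows "loc_bd \<phi> L \<delta> \<gamma> (U \<union> V)"
proof -
  obtain C D where C: "C > 0" "\<And>l. l > 0 \<Longrightarrow> l \<le> L \<Longrightarrow> sup_bd (U \<inter> sublevel \<phi> l) (C * l powr \<delta>) \<and> sq_bd (U \<inter> sublevel \<phi> l) (C * l powr \<gamma>)"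
    and D: "D > 0" "\<And>l. l > 0 \<Longrightarrow> l \<le> L \<Longrightarrow> sup_bd (V \<inter> sublevel \<phi> l) (D * l powr \<delta>) \<and> sq_bd (V \<inter> sublevel \<phi> l) (D * l powr \<gamma>)"
    using assms(4,5) unfolding loc_bd_def by blast
  have meas: "U \<inter> sublevel \<phi> l \<in> sets borel" "V \<inter> sublevel \<phi> l \<in> sets borel" for l
    using assms by (auto simp: sublevel_borel)
  have "sup_bd ((U \<union> V) \<inter> sublevel \<phi> l) ((2 * C + 2 * D) * l powr \<delta>) \<and> sq_bd ((U \<union> V) \<inter> sublevel \<phi> l) ((2 * C + 2 * D) * l powr \<gamma>)"
    if l: "0 < l" "l \<le> L" for l
    using sup_bd_Un[OF conjunct1[OF C(2)[OF l]] conjunct1[OF D(2)[OF l]] _ _ meas]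
      sq_bd_Un[OF conjunct2[OF C(2)[OF l]] conjunct2[OF D(2)[OF l]] _ _ meas] C(1) D(1)
    by (simp add: Int_Un_distrib2 algebra_simps)
  then show ?thesis unfolding loc_bd_def using C(1) D(1) by (intro exI[of _ "2 * C + 2 * D"]) auto
qed

lemma loc_bd_empty: "loc_bd \<phi> L \<delta> \<gamma> {}"
  unfolding loc_bd_def sup_bd_def sq_bd_def by (intro exI[of _ 1]) simp

text \<open>A finite subcover makes the constants uniform over the support.\<close>

lemma loc_bd_compact:
  assumes \<phi>: "\<phi> \<in> borel_measurable borel" and S: "compact S"
    and loc: "\<And>p. p \<in> S \<Longrightarrow> \<exists>U. open U \<and> p \<in> U \<and> loc_bd \<phi> L \<delta> \<gamma> U"
  shows "loc_bd \<phi> L \<delta> \<gamma> S"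
proof -
  obtain U where U: "\<And>p. p \<in> S \<Longrightarrow> open (U p)" "\<And>p. p \<in> S \<Longrightarrow> p \<in> U p" "\<And>p. p \<in> S \<Longrightarrow> loc_bd \<phi> L \<delta> \<gamma> (U p)"
    using loc by metis
  obtain T where T: "T \<subseteq> S" "finite T" "S \<subseteq> (\<Union>p\<in>T. U p)"
    using compactE_image[OF S, of S U] U by blast
  \<comment> \<open>Openness is carried through the induction because \<open>loc_bd_Un\<close> uses
    it for measurability of the pieces.\<close>
  have fin: "open (\<Union>p\<in>T'. U p) \<and> loc_bd \<phi> L \<delta> \<gamma> (\<Union>p\<in>T'. U p)" if "finite T'" "T' \<subseteq> S" for T'
    using that
  proof (induction T')
    case empty then show ?case by (simp add: loc_bd_empty)
  next
    case (insert p T')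
    then have *: "open (\<Union>p\<in>T'. U p)" "loc_bd \<phi> L \<delta> \<gamma> (\<Union>p\<in>T'. U p)" "p \<in> S" by auto
    have "loc_bd \<phi> L \<delta> \<gamma> (U p \<union> (\<Union>p\<in>T'. U p))"
      by (rule loc_bd_Un[OF \<phi> U(1)[OF *(3)] *(1) U(3)[OF *(3)] *(2)])
    then show ?case using open_Un[OF U(1)[OF *(3)] *(1)] by simp
  qed
  show ?thesis by (rule loc_bd_mono[OF conjunct2[OF fin[OF T(2,1)]] T(3)])
qed

subsection \<open>Summation over dyadic pieces\<close>

text \<open>Positive arguments come from \<open>powr_convex\<close>. When one argument is 0, the
  inequality reduces to (s z)^q <= s z^q for 0 < s < 1.\<close>

lemma convex_on_powr_nonneg:
  assumes "1 \<le> q" shows "convex_on {0..} (\<lambda>x::real. x powr q)"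
proof (rule convex_onI)
  fix t x y :: real assume t: "0 < t" "t < 1" and xy: "x \<in> {0..}" "y \<in> {0..}"
  have scale: "(s * z) powr q \<le> s * z powr q" if "0 < s" "s < 1" "0 \<le> z" for s z
  proof -
    have "s powr q \<le> s powr 1" using that assms by (intro powr_mono') auto
    then show ?thesis using that by (simp add: powr_mult mult_right_mono)
  qed
  show "((1 - t) *\<^sub>R x + t *\<^sub>R y) powr q \<le> (1 - t) * x powr q + t * y powr q"
  proof (cases "x = 0 \<or> y = 0")
    case True
    then show ?thesis using scale[of t y] scale[of "1 - t" x] t xy by auto
  next
    case False
    then show ?thesis using convex_onD[OF powr_convex[OF assms], of t x y] t xy by auto
  qed
qed simp

text \<open>Jensen with the weights N_i / D, where D is the sum of the N_i: each normalised term (D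
  / N_i) |u_i| has q-th power integral at most D^q, and the weights sum to 1.\<close>

lemma minkowski_finite:
  fixes u :: "'i \<Rightarrow> real \<Rightarrow> complex"
  assumes I: "finite I" "I \<noteq> {}" and [measurable]: "\<And>i. i \<in> I \<Longrightarrow> u i \<in> borel_measurable borel"
    and N: "\<And>i. i \<in> I \<Longrightarrow> 0 < N i" and q: "1 \<le> q"
    and le: "\<And>i. i \<in> I \<Longrightarrow> (\<integral>\<^sup>+x. ennreal (cmod (u i x) powr q) \<partial>lborel) \<le> ennreal (N i powr q)"
  shows "(\<integral>\<^sup>+x. ennreal (cmod (\<Sum>i\<in>I. u i x) powr q) \<partial>lborel) \<le> ennreal ((\<Sum>i\<in>I. N i) powr q)"
proof -
  define D where "D = (\<Sum>i\<in>I. N i)"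
  have D: "D > 0" unfolding D_def using I N by (intro sum_pos) auto
  define w where "w i = N i / D * (D / N i) powr q" for i
  have w0: "w i \<ge> 0" if "i \<in> I" for i using N[OF that] D by (simp add: w_def)
  have pt: "cmod (\<Sum>i\<in>I. u i x) powr q \<le> (\<Sum>i\<in>I. w i * cmod (u i x) powr q)" for x
  proof -
    have "cmod (\<Sum>i\<in>I. u i x) powr q \<le> (\<Sum>i\<in>I. cmod (u i x)) powr q"
      using q by (intro powr_mono2 norm_sum) auto
    also have "(\<Sum>i\<in>I. cmod (u i x)) = (\<Sum>i\<in>I. (N i / D) *\<^sub>R (D / N i * cmod (u i x)))"
      using N D by (intro sum.cong refl) (simp add: field_simps less_imp_neq[symmetric])
    also have "\<dots> powr q \<le> (\<Sum>i\<in>I. N i / D * (D / N i * cmod (u i x)) powr q)"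
    proof (rule convex_on_sum[OF I convex_on_powr_nonneg[OF q]])
      show "(\<Sum>i\<in>I. N i / D) = 1" using D by (simp add: sum_divide_distrib[symmetric] D_def)
      show "0 \<le> N i / D" "D / N i * cmod (u i x) \<in> {0..}" if "i \<in> I" for i
        using N[OF that] D by simp_all
    qed
    also have "\<dots> = (\<Sum>i\<in>I. w i * cmod (u i x) powr q)"
    proof (intro sum.cong refl)
      fix i assume "i \<in> I"
      then have "(D / N i * cmod (u i x)) powr q = (D / N i) powr q * cmod (u i x) powr q"
        by (simp only: powr_mult)
      then show "N i / D * (D / N i * cmod (u i x)) powr q = w i * cmod (u i x) powr q"
        by (simp only: w_def mult.assoc)
    qed
    finally show ?thesis .
  qed
  have "(\<integral>\<^sup>+x. ennreal (cmod (\<Sum>i\<in>I. u i x) powr q) \<partial>lborel) \<le> (\<integral>\<^sup>+x. (\<Sum>i\<in>I. ennreal (w i) * ennreal (cmod (u i x) powr q)) \<partial>lborel)"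
  proof (rule nn_integral_mono)
    fix x
    have "(\<Sum>i\<in>I. ennreal (w i) * ennreal (cmod (u i x) powr q)) = ennreal (\<Sum>i\<in>I. w i * cmod (u i x) powr q)"
      using w0 by (subst sum_ennreal[symmetric]) (auto simp: ennreal_mult)
    then show "ennreal (cmod (\<Sum>i\<in>I. u i x) powr q) \<le> (\<Sum>i\<in>I. ennreal (w i) * ennreal (cmod (u i x) powr q))"
      using pt[of x] by (simp add: ennreal_leI)
  qed
  also have "\<dots> = (\<Sum>i\<in>I. ennreal (w i) * (\<integral>\<^sup>+x. ennreal (cmod (u i x) powr q) \<partial>lborel))"
    by (subst nn_integral_sum) (auto simp: nn_integral_cmult)
  also have "\<dots> \<le> (\<Sum>i\<in>I. ennreal (w i) * ennreal (N i powr q))"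
    by (intro sum_mono mult_left_mono le) auto
  also have "\<dots> = ennreal (\<Sum>i\<in>I. w i * N i powr q)"
    using w0 by (subst sum_ennreal[symmetric]) (auto simp: ennreal_mult)
  also have "(\<Sum>i\<in>I. w i * N i powr q) = (\<Sum>i\<in>I. N i / D * D powr q)"
    using N D by (intro sum.cong refl) (simp add: w_def powr_divide less_imp_le less_imp_neq[symmetric])
  also have "\<dots> = D powr q"
    using D by (simp add: sum_distrib_right[symmetric] sum_divide_distrib[symmetric] D_def[symmetric])
  finally show ?thesis unfolding D_def .
qed

text \<open>Of the q powers of |u|, q - 2 are estimated by the sup bound and 2 are
  integrated.\<close>

lemma Lq_interpolation:
  fixes u :: "real \<Rightarrow> complex"
  assumes [measurable]: "u \<in> borel_measurable borel" and A: "\<And>x. cmod (u x) \<le> A" and B: "sqint u \<le> ennreal B"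
    and q: "2 \<le> q" and "0 \<le> B"
  shows "(\<integral>\<^sup>+x. ennreal (cmod (u x) powr q) \<partial>lborel) \<le> ennreal (A powr (q - 2) * B)"
proof -
  have "(\<integral>\<^sup>+x. ennreal (cmod (u x) powr q) \<partial>lborel) \<le> (\<integral>\<^sup>+x. ennreal (A powr (q - 2)) * ennreal ((cmod (u x))\<^sup>2) \<partial>lborel)"
  proof (rule nn_integral_mono)
    fix x
    have "cmod (u x) powr q \<le> A powr (q - 2) * (cmod (u x))\<^sup>2"
    proof (cases "u x = 0")
      case False
      then have "cmod (u x) powr q = cmod (u x) powr (q - 2) * (cmod (u x))\<^sup>2"
        using powr_add[of "cmod (u x)" "q - 2" 2] by (simp add: powr_numeral)
      also have "\<dots> \<le> A powr (q - 2) * (cmod (u x))\<^sup>2"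
        using q A by (intro mult_right_mono powr_mono2) auto
      finally show ?thesis .
    qed simp
    then show "ennreal (cmod (u x) powr q) \<le> ennreal (A powr (q - 2)) * ennreal ((cmod (u x))\<^sup>2)"
      by (simp add: ennreal_mult[symmetric] ennreal_leI)
  qed
  also have "\<dots> = ennreal (A powr (q - 2)) * sqint u" unfolding sqint_def by (rule nn_integral_cmult) measurable
  also have "\<dots> \<le> ennreal (A powr (q - 2)) * ennreal B" by (intro mult_left_mono B) auto
  also have "\<dots> = ennreal (A powr (q - 2) * B)" using assms by (simp add: ennreal_mult)
  finally show ?thesis .
qed

text \<open>The sup and L2 bounds share the factors \<open>X i\<close> and \<open>Q\<close> and
  differ only in the power of \<open>Y i\<close>, so interpolation changes nothing but that
  power.\<close>

lemma Lq_norm_le_sum: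
  fixes u :: "'i \<Rightarrow> real \<Rightarrow> complex"
  assumes q: "2 \<le> q" and I: "finite I" "I \<noteq> {}"
    and h[measurable]: "h \<in> borel_measurable borel" and hu: "AE x in lborel. cmod (h x) = cmod (\<Sum>i\<in>I. u i x)"
    and um[measurable]: "\<And>i. i \<in> I \<Longrightarrow> u i \<in> borel_measurable borel"
    and pos: "\<And>i. i \<in> I \<Longrightarrow> 0 < X i" "\<And>i. i \<in> I \<Longrightarrow> 0 < Y i" and Q: "0 \<le> Q"
    and A: "\<And>i x. i \<in> I \<Longrightarrow> cmod (u i x) \<le> X i * Y i powr \<delta> * Q"
    and B: "\<And>i. i \<in> I \<Longrightarrow> sqint (u i) \<le> ennreal ((X i * Y i powr \<gamma> * Q)\<^sup>2)"
  shows "Lq_norm_le q h ((\<Sum>i\<in>I. X i * Y i powr ((1 - 2 * qinv q) * \<delta> + 2 * qinv q * \<gamma>)) * Q)"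
proof (cases "q = \<infinity>")
  case True
  have "AE x in lborel. cmod (h x) \<le> (\<Sum>i\<in>I. X i * Y i powr \<delta>) * Q"
    using hu
  proof eventually_elim
    fix x assume "cmod (h x) = cmod (\<Sum>i\<in>I. u i x)"
    also have "\<dots> \<le> (\<Sum>i\<in>I. X i * Y i powr \<delta> * Q)" by (intro sum_norm_le A)
    finally show "cmod (h x) \<le> (\<Sum>i\<in>I. X i * Y i powr \<delta>) * Q" by (simp add: sum_distrib_right)
  qed
  then show ?thesis using True by (simp add: Lq_norm_le_def qinv_def)
next
  case False
  define r where "r = real_of_ereal q"
  have r: "2 \<le> r" "q = ereal r" using q False by (cases q; simp add: r_def)+
  have qi: "qinv q = 1 / r" using r by (simp add: qinv_def)
  let ?e = "(1 - 2 * qinv q) * \<delta> + 2 * qinv q * \<gamma>"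
  have "(\<integral>\<^sup>+x. ennreal (cmod (h x) powr r) \<partial>lborel) = (\<integral>\<^sup>+x. ennreal (cmod (\<Sum>i\<in>I. u i x) powr r) \<partial>lborel)"
    using hu by (intro nn_integral_cong_AE) (auto elim!: eventually_mono)
  also have "\<dots> \<le> ennreal (((\<Sum>i\<in>I. X i * Y i powr ?e) * Q) powr r)"
  \<comment> \<open>\<open>minkowski_finite\<close> takes positive norm bounds; for
    \<open>Q = 0\<close> the sup bound makes every piece vanish identically.\<close>
  proof (cases "Q = 0")
    case True
    then have "u i x = 0" if "i \<in> I" for i x using A[OF that, of x] by simp
    then show ?thesis using True by simp
  next
    case False
    with Q have Q: "0 < Q" by simp
    have "(\<integral>\<^sup>+x. ennreal (cmod (\<Sum>i\<in>I. u i x) powr r) \<partial>lborel) \<le> ennreal ((\<Sum>i\<in>I. X i * Y i powr ?e * Q) powr r)"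
    proof (rule minkowski_finite[OF I um])
      fix i assume i: "i \<in> I"
      note p = pos[OF i]
      show "0 < X i * Y i powr ?e * Q" using p Q by simp
      have "(\<integral>\<^sup>+x. ennreal (cmod (u i x) powr r) \<partial>lborel) \<le> ennreal ((X i * Y i powr \<delta> * Q) powr (r - 2) * (X i * Y i powr \<gamma> * Q)\<^sup>2)"
        by (rule Lq_interpolation[OF um[OF i] A[OF i] B[OF i] r(1)]) simp
      also have "(X i * Y i powr \<delta> * Q) powr (r - 2) * (X i * Y i powr \<gamma> * Q)\<^sup>2 = (X i * Y i powr ?e * Q) powr r"
      proof -
        have "(X i * Y i powr \<gamma> * Q)\<^sup>2 = (X i * Y i powr \<gamma> * Q) powr 2" using p Q by (simp add: powr_numeral)
        \<comment> \<open>Multiplying the interpolated exponent by r recovers r - 2 copies of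
          \<open>\<delta>\<close> and 2 copies of \<open>\<gamma>\<close>, as in
          \<open>Lq_interpolation\<close>.\<close>
        moreover have "r * ((1 - 2 / r) * \<delta> + 2 / r * \<gamma>) = (r - 2) * \<delta> + 2 * \<gamma>" using r by (simp add: field_simps)
        ultimately show ?thesis
          using p Q r unfolding qi
          by (simp add: powr_def exp_add[symmetric] ln_mult algebra_simps del: powr_numeral)
      qed
      finally show "(\<integral>\<^sup>+x. ennreal (cmod (u i x) powr r) \<partial>lborel) \<le> ennreal ((X i * Y i powr ?e * Q) powr r)" .
    qed (use r in auto)
    then show ?thesis by (simp add: sum_distrib_right)
  qed
  finally show ?thesis using False by (simp add: Lq_norm_le_def r_def)
qed

lemma Lq_norm_le_mono:
  assumes "Lq_norm_le q h B" "B \<le> B'" "0 \<le> B" "2 \<le> q" shows "Lq_norm_le q h B'"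
proof (cases "q = \<infinity>")
  case True
  then show ?thesis using assms by (auto simp: Lq_norm_le_def elim!: eventually_mono)
next
  case False
  have "0 \<le> real_of_ereal q" using assms(4) False by (cases q) auto
  then have "ennreal (B powr real_of_ereal q) \<le> ennreal (B' powr real_of_ereal q)"
    using assms by (intro ennreal_leI powr_mono2) auto
  then show ?thesis using assms False by (auto simp: Lq_norm_le_def intro: order_trans)
qed

lemma bilin_sum:
  assumes "L2 F" "L2 G" "finite I" "\<And>i. i \<in> I \<Longrightarrow> box_symbol (M i)" "\<And>p. N p = (\<Sum>i\<in>I. M i p)"
  shows "bilin F G N \<zeta> = (\<Sum>i\<in>I. bilin F G (M i) \<zeta>)"
  unfolding bilin_def assms(5) sum_distrib_left
  by (rule Bochner_Integration.integral_sum) (intro bilin_integrable assms)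

lemma fourier_int_sum:
  assumes "\<And>i. i \<in> I \<Longrightarrow> integrable lborel (f i)"
  shows "fourier_int (\<lambda>x. \<Sum>i\<in>I. f i x) \<xi> = (\<Sum>i\<in>I. fourier_int (f i) \<xi>)"
  unfolding fourier_int_def sum_distrib_left
  by (rule Bochner_Integration.integral_sum) (intro fourier_int_integrable assms)

text \<open>The symbol is replaced by its size \<open>k\<close> times an indicator, so only
  \<open>sup_bd\<close> and \<open>sq_bd\<close> of the set remain. Those control squares, hence the
  square roots; the 2 pi is that of Plancherel.\<close>

lemma dyadic_piece_bounds:
  assumes F: "L2 F" and G: "L2 G" and M: "box_symbol M" and E: "E \<in> sets borel"
    and le: "\<And>p. cmod (M p) \<le> k * indicator E p" and k: "0 \<le> k"
    and sup: "sup_bd E K" and sq: "sq_bd E K'" and K: "0 \<le> K" "0 \<le> K'"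
    and \<theta>: "\<theta> \<in> borel_measurable borel" "\<And>\<zeta>. cmod (\<theta> \<zeta>) = 1"
  defines "u \<equiv> \<lambda>x. fourier_int (\<lambda>\<zeta>. \<theta> \<zeta> * bilin F G M \<zeta>) (- x)"
  shows "cmod (u x) \<le> k * sqrt K * (L2norm F * L2norm G)"
    and "sqint u \<le> ennreal (2 * pi * (k * sqrt K' * (L2norm F * L2norm G))\<^sup>2)"
proof -
  have [measurable]: "F \<in> borel_measurable borel" "G \<in> borel_measurable borel" "E \<in> sets (borel \<Otimes>\<^sub>M borel)"
    using F G E unfolding borel_prod by (auto simp: L2_iff)
  let ?F = "\<lambda>x. ennreal (cmod (F x))" and ?G = "\<lambda>x. ennreal (cmod (G x))"
  have nF: "nnsq ?F = ennreal ((L2norm F)\<^sup>2)"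
    using sqint_L2norm[OF F] by (simp add: sqint_def ennreal_power)
  have nG: "nnsq ?G = ennreal ((L2norm G)\<^sup>2)"
    using sqint_L2norm[OF G] by (simp add: sqint_def ennreal_power)
  have le': "ennreal (cmod (M p)) \<le> ennreal k * indicator E p" for p
    using le[of p] k by (auto simp: indicator_def ennreal_leI split: if_splits)
  have "ennreal (cmod (u x)) \<le> form_abs M F G"
    unfolding u_def by (rule fourier_int_bound_and_sqint(1)[OF F G M \<theta>])
  also have "\<dots> \<le> (\<integral>\<^sup>+p. ennreal k * (?F (fst p) * ?G (snd p) * indicator E p) \<partial>lborel)"
    using le' by (intro nn_integral_mono) (subst mult.left_commute, intro mult_left_mono, auto)
  also have "\<dots> = ennreal k * (form_on E ?F ?G)"
    by (rule nn_integral_cmult) (simp add: borel_prod[symmetric])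
  finally have "(ennreal (cmod (u x)))\<^sup>2 \<le> (ennreal k * (form_on E ?F ?G))\<^sup>2"
    by (rule power_mono) simp
  also have "\<dots> = (ennreal k)\<^sup>2 * (form_on E ?F ?G)\<^sup>2" by (simp add: power_mult_distrib)
  also have "\<dots> \<le> (ennreal k)\<^sup>2 * (ennreal K * (nnsq ?F * nnsq ?G))"
    by (intro mult_left_mono sup[unfolded sup_bd_def, rule_format]) simp_all
  also have "\<dots> = ennreal ((k * sqrt K * (L2norm F * L2norm G))\<^sup>2)"
    unfolding nF nG using k K by (simp add: ennreal_power ennreal_mult power_mult_distrib mult.assoc)
  finally have "(cmod (u x))\<^sup>2 \<le> (k * sqrt K * (L2norm F * L2norm G))\<^sup>2"
    by (simp add: ennreal_power)
  then show "cmod (u x) \<le> k * sqrt K * (L2norm F * L2norm G)"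
    by (rule power2_le_imp_le) (use k K in simp)
  have "sqint u \<le> ennreal (2 * pi) * (\<integral>\<^sup>+\<zeta>. (conv_abs M F G \<zeta>)\<^sup>2 \<partial>lborel)"
    unfolding u_def by (rule fourier_int_bound_and_sqint(2)[OF F G M \<theta>])
  also have "\<dots> \<le> ennreal (2 * pi) * (\<integral>\<^sup>+\<zeta>. (ennreal k)\<^sup>2 * (conv_on E ?F ?G \<zeta>)\<^sup>2 \<partial>lborel)"
  proof (intro mult_left_mono nn_integral_mono)
    fix \<zeta>
    have "(conv_abs M F G \<zeta>)
      \<le> (\<integral>\<^sup>+\<eta>. ennreal k * (?F (\<zeta> - \<eta>) * ?G \<eta> * indicator E (\<zeta> - \<eta>, \<eta>)) \<partial>lborel)"
      using le' by (intro nn_integral_mono) (subst mult.left_commute, intro mult_left_mono, auto)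
    also have "\<dots> = ennreal k * (conv_on E ?F ?G \<zeta>)"
      by (rule nn_integral_cmult) measurable
    finally show "(conv_abs M F G \<zeta>)\<^sup>2
      \<le> (ennreal k)\<^sup>2 * (conv_on E ?F ?G \<zeta>)\<^sup>2"
      unfolding power_mult_distrib[symmetric] by (rule power_mono) simp
  qed simp
  also have "\<dots> = ennreal (2 * pi) * ((ennreal k)\<^sup>2 * (\<integral>\<^sup>+\<zeta>. (conv_on E ?F ?G \<zeta>)\<^sup>2 \<partial>lborel))"
    by (subst nn_integral_cmult) simp_all
  also have "\<dots> \<le> ennreal (2 * pi) * ((ennreal k)\<^sup>2 * (ennreal K' * (nnsq ?F * nnsq ?G)))"
    by (intro mult_left_mono sq[unfolded sq_bd_def, rule_format]) (simp_all only: nF nG, simp_all)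
  also have "\<dots> = ennreal (2 * pi * (k * sqrt K' * (L2norm F * L2norm G))\<^sup>2)"
    unfolding nF nG using k K by (simp add: ennreal_power ennreal_mult power_mult_distrib mult.assoc)
  finally show "sqint u \<le> ennreal (2 * pi * (k * sqrt K' * (L2norm F * L2norm G))\<^sup>2)" .
qed

text \<open>L^q has weight 2/q on the L2 side; \<open>\<delta>\<close> and \<open>\<gamma>\<close>
  are halved because they are exponents of squared norms.\<close>

definition interp_exp :: "ereal \<Rightarrow> real \<Rightarrow> real \<Rightarrow> real" where
  "interp_exp q \<delta> \<gamma> = (1 - 2 * qinv q) * (\<delta> / 2) + 2 * qinv q * (\<gamma> / 2)"

lemma L2norm_FT: "L2 f \<Longrightarrow> L2norm (FT f) = sqrt (2 * pi) * L2norm f"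
proof -
  assume f: "L2 f"
  have F: "fourier_L2 f (FT f)" by (rule fourier_L2_FT[OF f])
  then have "L2 (FT f)" by (simp add: fourier_L2_iff)
  from fourier_L2_norm[OF F] have "ennreal ((L2norm (FT f))\<^sup>2) = ennreal (2 * pi * (L2norm f)\<^sup>2)"
    unfolding sqint_L2norm[OF f] sqint_L2norm[OF \<open>L2 (FT f)\<close>] by (simp add: ennreal_mult')
  then have "(L2norm (FT f))\<^sup>2 = 2 * pi * (L2norm f)\<^sup>2" by simp
  then have "L2norm (FT f) = sqrt (2 * pi * (L2norm f)\<^sup>2)" by (metis L2norm_nonneg real_sqrt_unique)
  then show ?thesis by (simp add: real_sqrt_mult)
qed

text \<open>
  The weight \<open>W i\<close> bounds, up to constants, the symbol on the \<open>i\<close>-th dyadic piece. It is \<open>2 ^ i\<close>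
  for \<open>t \<ge> 1\<close>; for \<open>t < 1\<close> there is a single piece, of weight \<open>t\<close>.
\<close>

lemma sol_bound:
  fixes a b c :: "real \<Rightarrow> real" and m :: "real \<times> real \<Rightarrow> complex"
  defines "\<phi> \<equiv> phase a b c"
  assumes a[measurable]: "a \<in> borel_measurable borel" and \<phi>: "continuous_on UNIV \<phi>"
    and m: "box_symbol m" and Km: "0 < Km" "\<And>p. cmod (m p) \<le> Km" and S: "compact S" "\<And>p. p \<notin> S \<Longrightarrow> m p = 0"
    and L: "0 < L" "\<And>p. p \<in> S \<Longrightarrow> \<bar>\<phi> p\<bar> < L" and loc: "loc_bd \<phi> L \<delta> \<gamma> S" and q: "2 \<le> q"
  obtains \<kappa> where "0 < \<kappa>"
    "\<And>f g t J W. L2 f \<Longrightarrow> L2 g \<Longrightarrow> 0 < t \<Longrightarrow> (\<And>i. i \<le> J \<Longrightarrow> 0 < W i) \<Longrightarrow> (\<And>i. i < J \<Longrightarrow> 2 ^ i \<le> W i) \<Longrightarrow> t \<le> 2 * W J \<Longrightarrow>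
       Lq_norm_le q (sol a b c m f g t) (\<kappa> * (\<Sum>i\<le>J. W i * ((1/2) ^ i) powr interp_exp q \<delta> \<gamma>) * (L2norm f * L2norm g))"
proof -
  have [measurable]: "\<phi> \<in> borel_measurable borel" by (rule borel_measurable_continuous_onI[OF \<phi>])
  obtain C where C: "C > 0" "\<And>l. l > 0 \<Longrightarrow> l \<le> L \<Longrightarrow> sup_bd (S \<inter> sublevel \<phi> l) (C * l powr \<delta>)"
     "\<And>l. l > 0 \<Longrightarrow> l \<le> L \<Longrightarrow> sq_bd (S \<inter> sublevel \<phi> l) (C * l powr \<gamma>)"
    using loc unfolding loc_bd_def by blast
  \<comment> \<open>The 2 serves the last piece, where t <= 2 W_J; the 4/L serves the others, where
    |\<phi>| is at least L 2^-i / 2 and so 2/|\<phi>| <= (4/L) 2^i.\<close>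
  define c0 where "c0 = Km * (2 + 4 / L)"
  define \<kappa>1 where "\<kappa>1 = c0 * sqrt C * L powr (\<delta> / 2) * (2 * pi)"
  \<comment> \<open>The trailing 2 pi, shared with \<open>\<kappa>1\<close>, comes from the norms of
    the two transforms; the leading sqrt(2 pi) comes from Plancherel for the output.\<close>
  define \<kappa>2 where "\<kappa>2 = sqrt (2 * pi) * (c0 * sqrt C * L powr (\<gamma> / 2) * (2 * pi))"
  define \<kappa> where "\<kappa> = max \<kappa>1 \<kappa>2"
  have c0: "c0 > 0" using Km L by (simp add: c0_def add_pos_pos)
  have "\<kappa>1 > 0" using c0 C L by (simp add: \<kappa>1_def)
  then have \<kappa>: "\<kappa> > 0" "\<kappa>1 \<le> \<kappa>" "\<kappa>2 \<le> \<kappa>" by (auto simp: \<kappa>_def)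
  show thesis
  proof (rule that[OF \<kappa>(1)])
    fix f g t J W
    assume f: "L2 f" and g: "L2 g" and t: "0 < (t::real)" and W: "\<And>i. i \<le> J \<Longrightarrow> 0 < (W i :: real)"
      "\<And>i. i < J \<Longrightarrow> 2 ^ i \<le> W i" "t \<le> 2 * W J"
    define Q where "Q = L2norm f * L2norm g"
    have Q: "Q \<ge> 0" by (simp add: Q_def)
    have F: "L2 (FT f)" and G: "L2 (FT g)" using fourier_L2_FT f g by (auto simp: fourier_L2_iff)
    have FG: "L2norm (FT f) * L2norm (FT g) = 2 * pi * Q"
    proof -
      have "L2norm (FT f) * L2norm (FT g) = (sqrt (2 * pi) * sqrt (2 * pi)) * Q"
        by (simp only: L2norm_FT[OF f] L2norm_FT[OF g] Q_def mult_ac)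
      then show ?thesis by (simp only: real_sqrt_mult_self) simp
    qed
    define N where "N = time_symbol m \<phi> t"
    have N: "box_symbol N" unfolding N_def using t by (intro box_symbol_time_symbol m) auto
    define y where "y i = (1/2 :: real) ^ i" for i :: nat
    have y: "0 < y i" "y i \<le> 1" "y (Suc i) = y i / 2" for i by (auto simp: y_def power_le_one)
    define E where "E i = S \<inter> sublevel \<phi> (L * y i)" for i
    have E_sets[measurable]: "E i \<in> sets borel" for i
      using S by (auto simp: E_def sublevel_borel borel_compact)
    have E_sub: "E (Suc i) \<subseteq> E i" for i
    proof -
      have "L * y (Suc i) \<le> L * y i" using L y(1)[of i] by (simp add: y(3))
      then show ?thesis by (auto simp: E_def sublevel_def)
    qed
    \<comment> \<open>Differences of nested indicators telescope to that of \<open>E 0\<close>,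
      which contains all of \<open>S\<close>. The last index keeps the whole of \<open>E J\<close>,
      where \<open>\<phi>\<close> may vanish and only the bound by t is available.\<close>
    define M where "M i p = (indicator (E i) p - (if i < J then indicator (E (Suc i)) p else 0)) * N p" for i p
    have M_sum: "N p = (\<Sum>i\<le>J. M i p)" for p
    proof -
      have "(\<Sum>i\<le>J. M i p) = (\<Sum>i\<le>J. indicator (E i) p - (if i < J then indicator (E (Suc i)) p else 0)) * N p"
        by (simp add: M_def sum_distrib_right)
      also have "(\<Sum>i\<le>J. indicator (E i) p - (if i < J then indicator (E (Suc i)) p else 0 :: complex))
        = (\<Sum>i<J. indicator (E i) p - indicator (E (Suc i)) p) + indicator (E J) p"
        unfolding lessThan_Suc_atMost[symmetric] by simp
      also have "\<dots> = indicator (E 0) p"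
        using sum_lessThan_telescope'[of "\<lambda>i. indicator (E i) p :: complex" J] by simp
      also have "indicator (E 0) p * N p = N p"
        using L(2)[of p] S(2)[of p] by (cases "p \<in> S") (auto simp: E_def sublevel_def y_def N_def time_symbol_def)
      finally show ?thesis by simp
    qed
    have M_le: "cmod (M i p) \<le> (c0 * W i) * indicator (E i) p" if i: "i \<le> J" for i p
    proof (cases "p \<in> E i")
      case False
      then show ?thesis using E_sub[of i] by (auto simp: M_def indicator_def)
    next
      case True
      consider "i < J" "p \<in> E (Suc i)" | "i < J" "p \<notin> E (Suc i)" | "i = J" using i by linarith
      then show ?thesis
      proof cases
        case 1
        then show ?thesis using True c0 W(1)[OF i] by (simp add: M_def)
      next
        case 2
        have big: "L * y i / 2 \<le> \<bar>\<phi> p\<bar>" using 2 True by (auto simp: E_def sublevel_def y(3))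
        have pos: "0 < L * y i / 2" using L y(1)[of i] by simp
        have "cmod (N p) \<le> cmod (m p) * (2 / \<bar>\<phi> p\<bar>)"
          unfolding N_def using t big pos by (intro time_symbol_norm_le2) auto
        also have "\<dots> \<le> Km * (2 / (L * y i / 2))"
          using Km big pos by (intro mult_mono divide_left_mono) auto
        also have "\<dots> = Km * (4 / L) * 2 ^ i" using L by (simp add: y_def power_one_over field_simps)
        also have "\<dots> \<le> c0 * W i"
        proof (rule mult_mono)
          show "Km * (4 / L) \<le> c0" using Km(1) by (simp add: c0_def distrib_left)
        qed (use c0 W(2)[OF 2(1)] in auto)
        finally show ?thesis using True 2 by (simp add: M_def)
      next
        case 3
        have "cmod (N p) \<le> cmod (m p) * t" unfolding N_def using t by (intro time_symbol_norm_le1) auto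
        also have "\<dots> \<le> Km * (2 * W J)" using Km t W(3) by (intro mult_mono) auto
        also have "\<dots> \<le> c0 * W i" using Km L W(1)[of J] 3 by (simp add: c0_def algebra_simps)
        finally show ?thesis using True 3 by (simp add: M_def)
      qed
    qed
    have M_box: "box_symbol (M i)" for i
    proof -
      obtain K R where KR: "\<And>p. cmod (N p) \<le> K \<and> (\<bar>fst p\<bar> > R \<or> \<bar>snd p\<bar> > R \<longrightarrow> N p = 0)"
        using N unfolding box_symbol_def by blast
      have [measurable]: "N \<in> borel_measurable borel" using N by (simp add: box_symbol_def)
      have "M i \<in> borel_measurable borel" unfolding M_def[abs_def] by measurable
      moreover have "cmod (M i p) \<le> K" for p
        using KR[of p] E_sub[of i] by (auto simp: M_def indicator_def intro: order_trans[OF norm_ge_zero])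
      moreover have "\<bar>fst p\<bar> > R \<or> \<bar>snd p\<bar> > R \<longrightarrow> M i p = 0" for p using KR[of p] by (auto simp: M_def)
      ultimately show ?thesis unfolding box_symbol_def by blast
    qed
    define \<theta> where "\<theta> \<zeta> = exp (\<i> * of_real (t * a \<zeta>))" for \<zeta>
    have \<theta>[measurable]: "\<theta> \<in> borel_measurable borel" unfolding \<theta>_def[abs_def] by measurable
    have \<theta>1: "cmod (\<theta> \<zeta>) = 1" for \<zeta> by (simp add: \<theta>_def)
    define u where "u i x = fourier_int (\<lambda>\<zeta>. \<theta> \<zeta> * bilin (FT f) (FT g) (M i) \<zeta>) (- x)" for i x
    have t0: "0 \<le> t" using t by simp
    note sol = sol_AE_eq[OF f g m t0 a, of b c, folded \<phi>_def N_def, OF \<open>\<phi> \<in> borel_measurable borel\<close>]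
    have int: "integrable lborel (\<lambda>\<zeta>. \<theta> \<zeta> * bilin (FT f) (FT g) (M i) \<zeta>)" for i
      by (rule Bochner_Integration.integrable_bound[OF integrable_bilin[OF F G M_box[of i]]])
         (use bilin_measurable[OF F G M_box[of i]] in \<open>auto simp: norm_mult \<theta>1\<close>)
    have split: "fourier_int (\<lambda>\<zeta>. \<theta> \<zeta> * bilin (FT f) (FT g) N \<zeta>) (- x) = (\<Sum>i\<le>J. u i x)" for x
    proof -
      have "bilin (FT f) (FT g) N \<zeta> = (\<Sum>i\<le>J. bilin (FT f) (FT g) (M i) \<zeta>)" for \<zeta>
        by (rule bilin_sum[OF F G _ M_box M_sum]) simp
      then have "(\<lambda>\<zeta>. \<theta> \<zeta> * bilin (FT f) (FT g) N \<zeta>) = (\<lambda>\<zeta>. \<Sum>i\<le>J. \<theta> \<zeta> * bilin (FT f) (FT g) (M i) \<zeta>)"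
        by (simp add: sum_distrib_left)
      then show ?thesis
        unfolding u_def using fourier_int_sum[where I = "{..J}" and \<xi> = "- x" and f = "\<lambda>i \<zeta>. \<theta> \<zeta> * bilin (FT f) (FT g) (M i) \<zeta>", OF int] by simp
    qed
    have "Lq_norm_le q (sol a b c m f g t) ((\<Sum>i\<in>{..J}. \<kappa> * W i * y i powr ((1 - 2 * qinv q) * (\<delta> / 2) + 2 * qinv q * (\<gamma> / 2))) * Q)"
    proof (rule Lq_norm_le_sum[OF q, where u = u])
      show "sol a b c m f g t \<in> borel_measurable borel" by (rule sol(1))
      show "AE x in lborel. cmod (sol a b c m f g t x) = cmod (\<Sum>i\<le>J. u i x)"
        using sol(2) unfolding \<theta>_def[symmetric] by eventually_elim (simp add: norm_mult split)
      fix i assume "i \<in> {..J}"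
      then have i: "i \<le> J" by simp
      show "u i \<in> borel_measurable borel"
        unfolding u_def[abs_def] using fourier_int_bound_and_sqint(3)[OF F G M_box \<theta> \<theta>1] .
      show "0 < \<kappa> * W i" "0 < y i" using \<kappa> W(1)[OF i] y by auto
      have l: "0 < L * y i" "L * y i \<le> L" using L y(1,2)[of i] by (auto simp: mult_le_cancel_left1)
      have sq: "sqrt (C * (L * y i) powr z) = sqrt C * (L powr (z / 2) * y i powr (z / 2))" for z
      proof -
        have "sqrt ((L * y i) powr z) = (L * y i) powr (z / 2)"
          using l by (simp add: powr_half_sqrt[symmetric] powr_powr)
        then show ?thesis using L y(1)[of i] by (simp add: real_sqrt_mult powr_mult)
      qed
      note sb = dyadic_piece_bounds[OF F G M_box E_sets M_le[OF i] _ C(2)[OF l, folded E_def] C(3)[OF l, folded E_def] _ _ \<theta> \<theta>1,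
          folded u_def, unfolded FG sq]
      have nn: "0 \<le> c0 * W i" using c0 W(1)[OF i] by simp
      show "cmod (u i x) \<le> \<kappa> * W i * y i powr (\<delta> / 2) * Q" for x
      proof -
        have "cmod (u i x) \<le> c0 * W i * (sqrt C * (L powr (\<delta> / 2) * y i powr (\<delta> / 2))) * (2 * pi * Q)"
          by (rule sb(1)) (use nn C in auto)
        also have "\<dots> = \<kappa>1 * (W i * y i powr (\<delta> / 2) * Q)" by (simp add: \<kappa>1_def)
        also have "\<dots> \<le> \<kappa> * (W i * y i powr (\<delta> / 2) * Q)"
          using \<kappa> W(1)[OF i] Q by (intro mult_right_mono) auto
        finally show ?thesis by (simp add: mult.assoc)
      qed
      show "sqint (u i) \<le> ennreal ((\<kappa> * W i * y i powr (\<gamma> / 2) * Q)\<^sup>2)"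
      proof -
        have "sqint (u i) \<le> ennreal (2 * pi * (c0 * W i * (sqrt C * (L powr (\<gamma> / 2) * y i powr (\<gamma> / 2))) * (2 * pi * Q))\<^sup>2)"
          by (rule sb(2)) (use nn C in auto)
        also have "2 * pi * (c0 * W i * (sqrt C * (L powr (\<gamma> / 2) * y i powr (\<gamma> / 2))) * (2 * pi * Q))\<^sup>2
          = (\<kappa>2 * (W i * y i powr (\<gamma> / 2) * Q))\<^sup>2"
          by (simp add: \<kappa>2_def power_mult_distrib)
        also have "\<dots> \<le> (\<kappa> * (W i * y i powr (\<gamma> / 2) * Q))\<^sup>2"
          using \<kappa> W(1)[OF i] Q c0 C by (intro power_mono mult_right_mono) (auto simp: \<kappa>2_def)
        finally show ?thesis by (simp add: mult.assoc ennreal_leI)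
      qed
    qed (use Q in auto)
    then show "Lq_norm_le q (sol a b c m f g t) (\<kappa> * (\<Sum>i\<le>J. W i * ((1/2) ^ i) powr interp_exp q \<delta> \<gamma>) * (L2norm f * L2norm g))"
      by (simp add: interp_exp_def y_def Q_def sum_distrib_left mult.assoc)
  qed
qed

section \<open>Dyadic sums and their growth in time\<close>

lemma dyadic_bracket:
  assumes "1 \<le> (t::real)" obtains J where "2 ^ J \<le> t" "t \<le> 2 * 2 ^ J"
proof -
  define J where "J = nat \<lfloor>log 2 t\<rfloor>"
  have l: "0 \<le> log 2 t" using assms by simp
  have "real J \<le> log 2 t" "log 2 t \<le> real J + 1" using l by (auto simp: J_def)
  then have "2 powr real J \<le> t" "t \<le> 2 powr (real J + 1)"
    using assms by (auto simp: powr_le_iff le_powr_iff less_imp_le)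
  then show thesis by (intro that[of J]) (auto simp: powr_realpow powr_add)
qed

text \<open>Separates the analysis from the arithmetic: \<open>small\<close> pays for the single
  piece used when t < 1, and \<open>large\<close> compares the geometric sum over about log t pieces
  with \<open>\<alpha>\<close>.\<close>

lemma estimateI:
  assumes sb: "0 < \<kappa>" "\<And>f g t J W. L2 f \<Longrightarrow> L2 g \<Longrightarrow> 0 < t \<Longrightarrow> (\<And>i. i \<le> J \<Longrightarrow> 0 < W i) \<Longrightarrow> (\<And>i. i < J \<Longrightarrow> 2 ^ i \<le> W i) \<Longrightarrow> t \<le> 2 * W J \<Longrightarrow>
       Lq_norm_le q (sol a b c m f g t) (\<kappa> * (\<Sum>i\<le>J. W i * ((1/2) ^ i) powr e) * (L2norm f * L2norm g))"
    and q: "2 \<le> q"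
    and small: "\<And>t. 0 < t \<Longrightarrow> t < 1 \<Longrightarrow> t \<le> \<alpha> t"
    and large: "0 < C" "\<And>t J. 1 \<le> t \<Longrightarrow> 2 ^ J \<le> t \<Longrightarrow> (\<Sum>i\<le>J. (2 powr (1 - e)) ^ i) \<le> C * \<alpha> t"
  shows "estimate a b c m q \<alpha>"
  unfolding estimate_def
proof (intro exI[of _ "\<kappa> * max 1 C"] conjI allI impI)
  show "0 < \<kappa> * max 1 C" using sb(1) by simp
  fix f g and t :: real assume f: "L2 f" and g: "L2 g" and t: "0 < t"
  have "\<exists>J W. (\<forall>i\<le>J. 0 < W i) \<and> (\<forall>i<J. 2 ^ i \<le> W i) \<and> t \<le> 2 * W J \<and> (\<Sum>i\<le>J. W i * ((1/2) ^ i) powr e) \<le> max 1 C * \<alpha> t"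
  proof (cases "t < 1")
    case True
    have "t \<le> \<alpha> t" by (rule small[OF t True])
    also have "\<dots> \<le> max 1 C * \<alpha> t" using t \<open>t \<le> \<alpha> t\<close> by (simp add: mult_le_cancel_right1)
    finally show ?thesis using t by (intro exI[of _ 0] exI[of _ "\<lambda>_. t"]) auto
  next
    case False
    then have t1: "1 \<le> t" by simp
    obtain J where J: "2 ^ J \<le> t" "t \<le> 2 * 2 ^ J" using dyadic_bracket[OF t1] .
    \<comment> \<open>With weights 2^i every term is a power of the one ratio 2^(1 - e), whose
      position relative to 1 decides the growth.\<close>
    have eq: "2 ^ i * ((1/2) ^ i) powr e = (2 powr (1 - e)) ^ i" for i
    proof -
      have "2 ^ i * ((1/2) ^ i) powr e = 2 powr real i * (2 powr (- real i)) powr e"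
        by (simp add: powr_realpow powr_minus power_one_over inverse_eq_divide)
      also have "\<dots> = 2 powr (real i * (1 - e))" by (simp add: powr_powr powr_add[symmetric] algebra_simps)
      finally show ?thesis by (simp add: powr_powr powr_realpow[symmetric] mult.commute)
    qed
    \<comment> \<open>Nonnegativity of \<open>\<alpha>\<close> is deduced, not assumed: a positive
      multiple of it dominates a sum of nonnegative terms.\<close>
    have "0 \<le> (\<Sum>i\<le>J. (2 powr (1 - e)) ^ i)" by (intro sum_nonneg) auto
    with large(2)[OF t1 J(1)] have "0 \<le> C * \<alpha> t" by linarith
    then have "0 \<le> \<alpha> t" using large(1) by (simp add: zero_le_mult_iff)
    then have "C * \<alpha> t \<le> max 1 C * \<alpha> t" by (intro mult_right_mono) auto
    with large(2)[OF t1 J(1)] show ?thesis using J by (intro exI[of _ J] exI[of _ "\<lambda>i. 2 ^ i"]) (simp add: eq)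
  qed
  then obtain J W where W: "\<And>i. i \<le> J \<Longrightarrow> 0 < W i" "\<And>i. i < J \<Longrightarrow> 2 ^ i \<le> W i" "t \<le> 2 * W J"
    and le: "(\<Sum>i\<le>J. W i * ((1/2) ^ i) powr e) \<le> max 1 C * \<alpha> t" by blast
  show "Lq_norm_le q (sol a b c m f g t) (\<kappa> * max 1 C * \<alpha> t * L2norm f * L2norm g)"
  proof (rule Lq_norm_le_mono[OF sb(2)[OF f g t W] _ _ q])
    have "\<kappa> * (\<Sum>i\<le>J. W i * ((1/2) ^ i) powr e) * (L2norm f * L2norm g) \<le> \<kappa> * (max 1 C * \<alpha> t) * (L2norm f * L2norm g)"
      using sb(1) by (intro mult_right_mono mult_left_mono le) auto
    then show "\<kappa> * (\<Sum>i\<le>J. W i * ((1/2) ^ i) powr e) * (L2norm f * L2norm g) \<le> \<kappa> * max 1 C * \<alpha> t * L2norm f * L2norm g"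
      by (simp add: mult.assoc)
    have "0 \<le> W i * ((1/2) ^ i) powr e" if "i \<le> J" for i using W(1)[OF that] by simp
    then have "0 \<le> (\<Sum>i\<le>J. W i * ((1/2) ^ i) powr e)" by (intro sum_nonneg) simp
    then show "0 \<le> \<kappa> * (\<Sum>i\<le>J. W i * ((1/2) ^ i) powr e) * (L2norm f * L2norm g)"
      using sb(1) by simp
  qed
qed

text \<open>Case e < 1: up to a constant the sum is its last term (2^J)^s, which is at most
  t^s.\<close>

lemma geometric_sum_growing:
  fixes s t :: real
  assumes s: "0 < s" and t: "1 \<le> t" "2 ^ J \<le> t"
  shows "(\<Sum>i\<le>J. (2 powr s) ^ i) \<le> (2 powr s / (2 powr s - 1)) * t powr s"
proof -
  let ?x = "2 powr s"
  have x: "1 < ?x" using s by simp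
  then have x': "0 \<le> ?x - 1" by linarith
  have "(\<Sum>i\<le>J. ?x ^ i) = (?x ^ Suc J - 1) / (?x - 1)"
    using x s geometric_sum[of ?x "Suc J"] by (simp add: lessThan_Suc_atMost)
  also have "\<dots> \<le> ?x * ?x ^ J / (?x - 1)" using x by (intro divide_right_mono) auto
  also have "?x ^ J = (2 ^ J) powr s" by (simp add: powr_realpow[symmetric] powr_powr mult.commute)
  also have "?x * (2 ^ J) powr s / (?x - 1) \<le> ?x * t powr s / (?x - 1)"
    by (intro divide_right_mono[OF _ x'] mult_left_mono powr_mono2) (use s t in auto)
  finally show ?thesis by simp
qed

lemma le_japanese: "\<bar>x\<bar> \<le> japanese x" "1 \<le> japanese x"
  unfolding japanese_def by (rule real_le_rsqrt, simp)+

text \<open>Case e = 1: the sum counts its J + 1 terms. J is at most ln t / ln 2, and the extra 1 is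
  absorbed because \<open>japanese\<close> is at least 1.\<close>

lemma geometric_sum_critical:
  fixes t :: real
  assumes t: "1 \<le> t" "2 ^ J \<le> t"
  shows "(\<Sum>i\<le>J. (2 powr (0::real)) ^ i) \<le> (1 / ln 2 + 1) * japanese (ln t)"
proof -
  have "ln (2 ^ J) \<le> ln t" using t by (subst ln_le_cancel_iff) auto
  then have "real J * ln 2 \<le> ln t" by (simp add: ln_realpow)
  then have "real J \<le> 1 / ln 2 * ln t" by (simp add: field_simps)
  also have "\<dots> \<le> 1 / ln 2 * japanese (ln t)" using le_japanese(1)[of "ln t"] by (intro mult_left_mono) auto
  finally show ?thesis using le_japanese(2)[of "ln t"] by (simp add: distrib_right)
qed

text \<open>Case e > 1: the full geometric series converges, so the bound is independent of J and
  hence of t.\<close>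

lemma geometric_sum_decaying:
  fixes s :: real
  assumes "s < 0" shows "(\<Sum>i\<le>J. (2 powr s) ^ i) \<le> 1 / (1 - 2 powr s)"
proof -
  have x: "2 powr s < 1" using assms by (simp add: powr_less_one)
  have "(\<Sum>i\<le>J. (2 powr s) ^ i) = (1 - (2 powr s) ^ Suc J) / (1 - 2 powr s)"
    using x assms by (simp add: sum_gp0)
  also have "\<dots> \<le> 1 / (1 - 2 powr s)" using x by (intro divide_right_mono) auto
  finally show ?thesis .
qed

subsection \<open>The phase of the problem\<close>

lemma smooth1D:
  assumes "smooth1 a"
  shows "continuous_on UNIV a" "(a has_real_derivative deriv a x) (at x)"
    "(deriv a has_real_derivative deriv (deriv a) x) (at x)"
    "continuous_on UNIV (deriv a)" "continuous_on UNIV (deriv (deriv a))"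
proof -
  have d: "((deriv ^^ n) a) differentiable (at x)" for n x using assms by (simp add: smooth1_def)
  have d0: "a differentiable (at x)" for x using d[of 0] by simp
  have d1: "deriv a differentiable (at x)" for x using d[of 1] by simp
  have d2: "deriv (deriv a) differentiable (at x)" for x using d[of 2] by (simp add: numeral_2_eq_2)
  show "continuous_on UNIV a" "continuous_on UNIV (deriv a)" "continuous_on UNIV (deriv (deriv a))"
    using d0 d1 d2 by (auto intro!: continuous_at_imp_continuous_on differentiable_imp_continuous_within)
  show "(a has_real_derivative deriv a x) (at x)" "(deriv a has_real_derivative deriv (deriv a) x) (at x)"
    using d0 d1 by (simp_all add: DERIV_deriv_iff_real_differentiable)
qed

text \<open>One formula serves both partial derivatives: \<open>phase_D a c\<close> at the exchanged
  point is the derivative of the phase in the second variable.\<close>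

definition phase_D :: "(real \<Rightarrow> real) \<Rightarrow> (real \<Rightarrow> real) \<Rightarrow> real \<times> real \<Rightarrow> real" where
  "phase_D a b p = - deriv a (fst p + snd p) + deriv b (fst p)"

definition phase_DD :: "(real \<Rightarrow> real) \<Rightarrow> (real \<Rightarrow> real) \<Rightarrow> real \<times> real \<Rightarrow> real" where
  "phase_DD a b p = - deriv (deriv a) (fst p + snd p) + deriv (deriv b) (fst p)"

text \<open>The symmetry that reduces slices in \<eta> to slices in \<xi>.\<close>

lemma phase_swap: "(\<lambda>z. phase a b c (snd z, fst z)) = phase a c b"
  by (auto simp: phase_def add.commute)

lemma DERIV_shift_arg:
  "(f has_real_derivative D) (at (x + y)) \<Longrightarrow> ((\<lambda>s. f (s + y)) has_real_derivative D) (at x)"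
  by (simp add: DERIV_shift)

lemma phase_continuous:
  assumes "smooth1 a" "smooth1 b" "smooth1 c" shows "continuous_on UNIV (phase a b c)"
  unfolding phase_def[abs_def]
  by (intro continuous_intros continuous_on_compose2[OF smooth1D(1)[OF assms(1)]]
      continuous_on_compose2[OF smooth1D(1)[OF assms(2)]] continuous_on_compose2[OF smooth1D(1)[OF assms(3)]]) auto

lemma phase_D_continuous:
  assumes "smooth1 a" "smooth1 b" shows "continuous_on UNIV (phase_D a b)"
  unfolding phase_D_def[abs_def]
  by (intro continuous_intros continuous_on_compose2[OF smooth1D(4)[OF assms(1)]]
      continuous_on_compose2[OF smooth1D(4)[OF assms(2)]]) auto

lemma phase_DD_continuous:
  assumes "smooth1 a" "smooth1 b" shows "continuous_on UNIV (phase_DD a b)"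
  unfolding phase_DD_def[abs_def]
  by (intro continuous_intros continuous_on_compose2[OF smooth1D(5)[OF assms(1)]]
      continuous_on_compose2[OF smooth1D(5)[OF assms(2)]]) auto

lemma phase_deriv_fst:
  assumes "smooth1 a" "smooth1 b"
  shows "((\<lambda>s. phase a b c (s, y)) has_real_derivative phase_D a b (x, y)) (at x)"
  unfolding phase_def phase_D_def fst_conv snd_conv
  using DERIV_shift_arg[OF smooth1D(2)[OF assms(1), of "x + y"]] smooth1D(2)[OF assms(2), of x]
  by (auto intro!: derivative_eq_intros)

lemma phase_deriv_snd:
  assumes "smooth1 a" "smooth1 c"
  shows "((\<lambda>s. phase a b c (x, s)) has_real_derivative phase_D a c (y, x)) (at y)"
proof -
  have "phase a b c (x, s) = phase a c b (s, x)" for s by (simp add: phase_def add.commute)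
  then show ?thesis using phase_deriv_fst[OF assms, of b x y] by simp
qed

lemma phase_D_deriv:
  assumes "smooth1 a" "smooth1 b"
  shows "((\<lambda>s. phase_D a b (s, y)) has_real_derivative phase_DD a b (x, y)) (at x)"
  unfolding phase_D_def phase_DD_def fst_conv snd_conv
  using DERIV_shift_arg[OF smooth1D(3)[OF assms(1), of "x + y"]] smooth1D(3)[OF assms(2), of x]
  by (auto intro!: derivative_eq_intros)

lemma pdx_eqI:
  fixes h :: "real \<times> real \<Rightarrow> real"
  assumes "\<And>x y. ((\<lambda>s. h (s, y)) has_real_derivative D (x, y)) (at x)" shows "pdx h = D"
proof
  fix p
  show "pdx h p = D p"
    unfolding pdx_def using assms[of "snd p" "fst p"]
    by (intro vector_derivative_at) (simp add: has_real_derivative_iff_has_vector_derivative)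
qed

lemma pdy_eqI:
  fixes h :: "real \<times> real \<Rightarrow> real"
  assumes "\<And>x y. ((\<lambda>s. h (x, s)) has_real_derivative D (x, y)) (at y)" shows "pdy h = D"
proof
  fix p
  show "pdy h p = D p"
    unfolding pdy_def using assms[of "fst p" "snd p"]
    by (intro vector_derivative_at) (simp add: has_real_derivative_iff_has_vector_derivative)
qed

lemma phase_partials:
  assumes "smooth1 a" "smooth1 b" "smooth1 c"
  shows "pdx (phase a b c) = phase_D a b"
    and "pdy (phase a b c) = (\<lambda>p. phase_D a c (snd p, fst p))"
    and "pdx (pdx (phase a b c)) = phase_DD a b"
    and "pdy (pdy (phase a b c)) = (\<lambda>p. phase_DD a c (snd p, fst p))"
proof -
  show x: "pdx (phase a b c) = phase_D a b"
    by (rule pdx_eqI[OF phase_deriv_fst[OF assms(1,2)]])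
  show y: "pdy (phase a b c) = (\<lambda>p. phase_D a c (snd p, fst p))"
    by (rule pdy_eqI) (simp add: phase_deriv_snd[OF assms(1,3)])
  show "pdx (pdx (phase a b c)) = phase_DD a b"
    unfolding x by (rule pdx_eqI[OF phase_D_deriv[OF assms(1,2)]])
  show "pdy (pdy (phase a b c)) = (\<lambda>p. phase_DD a c (snd p, fst p))"
    unfolding y by (rule pdy_eqI) (simp add: phase_D_deriv[OF assms(1,3)])
qed

lemma loc_slice_phase:
  assumes "smooth1 a" "smooth1 b" "smooth1 c"
  shows "phase a b c p \<noteq> 0 \<Longrightarrow> 0 \<le> \<alpha> \<Longrightarrow> loc_slice (phase a b c) p \<alpha>"
    and "phase_D a b p \<noteq> 0 \<Longrightarrow> loc_slice (phase a b c) p 1"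
    and "phase_DD a b p \<noteq> 0 \<Longrightarrow> loc_slice (phase a b c) p (1/2)"
  by (rule loc_slice_nonzero[OF phase_continuous[OF assms]]
      loc_slice_order1[OF phase_deriv_fst[OF assms(1,2)] phase_D_continuous[OF assms(1,2)]]
      loc_slice_order2[OF phase_deriv_fst[OF assms(1,2)] phase_D_deriv[OF assms(1,2)] phase_DD_continuous[OF assms(1,2)]];
      assumption)+

section \<open>From slice exponents on the support to estimates in time\<close>

abbreviation phase_slices ::
    "(real \<Rightarrow> real) \<Rightarrow> (real \<Rightarrow> real) \<Rightarrow> (real \<Rightarrow> real) \<Rightarrow> real \<times> real \<Rightarrow> real \<Rightarrow> real \<Rightarrow> bool" where
  "phase_slices a b c p \<delta> \<gamma> \<equiv> \<exists>\<beta> \<beta>'. loc_slice (phase a b c) p \<beta> \<and> loc_slice (phase a c b) (snd p, fst p) \<beta>' \<and>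
     \<delta> \<le> \<beta> + \<beta>' \<and> \<gamma> \<le> max \<beta> \<beta>'"

lemma smooth2_box_symbol:
  assumes "smooth2 m" "compact (Supp m)"
  shows "box_symbol m" "\<exists>K>0. \<forall>p. cmod (m p) \<le> K" "p \<notin> Supp m \<Longrightarrow> m p = 0"
proof -
  have out: "m p = 0" if "p \<notin> Supp m" for p
    using that closure_subset[of "{p. m p \<noteq> 0}"] by (auto simp: Supp_def)
  then show "p \<notin> Supp m \<Longrightarrow> m p = 0" .
  have "pds [] m differentiable (at p)" for p using assms(1) unfolding smooth2_def by blast
  then have cont: "continuous_on UNIV m"
    by (auto intro!: continuous_at_imp_continuous_on differentiable_imp_continuous_within)
  have "bounded (m ` Supp m)"
    by (intro compact_imp_bounded compact_continuous_image continuous_on_subset[OF cont] assms) auto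
  then obtain K where K: "K > 0" "\<And>p. p \<in> Supp m \<Longrightarrow> cmod (m p) \<le> K" unfolding bounded_pos by blast
  then have K': "cmod (m p) \<le> K" for p using out[of p] by (cases "p \<in> Supp m") auto
  with K show "\<exists>K>0. \<forall>p. cmod (m p) \<le> K" by blast
  obtain R where R: "\<And>p. p \<in> Supp m \<Longrightarrow> norm p \<le> R"
    using compact_imp_bounded[OF assms(2)] unfolding bounded_iff by blast
  have "m p = 0" if "\<bar>fst p\<bar> > R \<or> \<bar>snd p\<bar> > R" for p
  proof (rule out, rule notI)
    assume "p \<in> Supp m"
    then have "norm p \<le> R" by (rule R)
    then show False using that norm_fst_le[of "fst p" "snd p"] norm_snd_le[of "snd p" "fst p"] by auto
  qed
  then show "box_symbol m" unfolding box_symbol_def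
    using K' borel_measurable_continuous_onI[OF cont] by blast
qed

text \<open>Compactness of the support supplies uniform slice constants, a bound for
  \<open>m\<close>, and a strict bound \<open>L\<close> for the phase, so that the top dyadic set
  covers the whole support.\<close>

lemma estimate_of_slices:
  assumes a: "smooth1 a" and b: "smooth1 b" and c: "smooth1 c" and m: "smooth2 m" "compact (Supp m)" and q: "2 \<le> q"
    and slices: "\<And>p. p \<in> Supp m \<Longrightarrow> phase_slices a b c p \<delta> \<gamma>"
    and small: "\<And>t. 0 < t \<Longrightarrow> t < 1 \<Longrightarrow> t \<le> \<alpha> t"
    and large: "0 < C" "\<And>t J. 1 \<le> t \<Longrightarrow> 2 ^ J \<le> t \<Longrightarrow> (\<Sum>i\<le>J. (2 powr (1 - interp_exp q \<delta> \<gamma>)) ^ i) \<le> C * \<alpha> t"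
  shows "estimate a b c m q \<alpha>"
proof -
  let ?\<phi> = "phase a b c"
  have \<phi>: "continuous_on UNIV ?\<phi>" by (rule phase_continuous[OF a b c])
  obtain K where K: "K > 0" "\<And>p. cmod (m p) \<le> K" using smooth2_box_symbol(2)[OF m] by blast
  have "bounded (?\<phi> ` Supp m)"
    by (intro compact_imp_bounded compact_continuous_image continuous_on_subset[OF \<phi>] m) auto
  then obtain L where L: "L > 0" "\<And>p. p \<in> Supp m \<Longrightarrow> \<bar>?\<phi> p\<bar> < L"
    unfolding bounded_pos_less by auto
  have "loc_bd ?\<phi> L \<delta> \<gamma> (Supp m)"
  proof (rule loc_bd_compact[OF borel_measurable_continuous_onI[OF \<phi>] m(2)])
    fix p assume "p \<in> Supp m"
    then obtain \<beta> \<beta>' where "loc_slice (phase a b c) p \<beta>" "loc_slice (phase a c b) (snd p, fst p) \<beta>'" "\<delta> \<le> \<beta> + \<beta>'" "\<gamma> \<le> max \<beta> \<beta>'"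
      using slices by blast
    then show "\<exists>U. open U \<and> p \<in> U \<and> loc_bd ?\<phi> L \<delta> \<gamma> U"
      by (intro loc_bd_of_slices[OF \<phi> _ _ L(1)]) (simp_all add: phase_swap)
  qed
  from sol_bound[OF borel_measurable_continuous_onI[OF smooth1D(1)[OF a]] \<phi> smooth2_box_symbol(1)[OF m] K m(2) smooth2_box_symbol(3)[OF m] L this q]
  obtain \<kappa> where \<kappa>: "0 < \<kappa>" "\<And>f g t J W. L2 f \<Longrightarrow> L2 g \<Longrightarrow> 0 < t \<Longrightarrow> (\<And>i. i \<le> J \<Longrightarrow> 0 < W i) \<Longrightarrow> (\<And>i. i < J \<Longrightarrow> 2 ^ i \<le> W i) \<Longrightarrow> t \<le> 2 * W J \<Longrightarrow>
       Lq_norm_le q (sol a b c m f g t) (\<kappa> * (\<Sum>i\<le>J. W i * ((1/2) ^ i) powr interp_exp q \<delta> \<gamma>) * (L2norm f * L2norm g))"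
    by blast
  show ?thesis by (rule estimateI[OF \<kappa> q small large])
qed

lemma qinv_bounds:
  assumes "2 \<le> q" shows "0 \<le> qinv q" "qinv q \<le> 1/2" "q \<noteq> \<infinity> \<Longrightarrow> 0 < qinv q"
  using assms by (cases q; simp add: qinv_def field_simps)+

text \<open>The regime e < 1 with growth exponent s = 1 - e; the condition s <= 1 gives t <= t^s for
  short times.\<close>

lemma estimate_powr_of_slices:
  assumes "smooth1 a" "smooth1 b" "smooth1 c" "smooth2 m" "compact (Supp m)" "2 \<le> q"
    and slices: "\<And>p. p \<in> Supp m \<Longrightarrow> phase_slices a b c p \<delta> \<gamma>"
    and s: "0 < s" "s \<le> 1" "s = 1 - interp_exp q \<delta> \<gamma>"
  shows "estimate a b c m q (\<lambda>t. t powr s)"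
proof (rule estimate_of_slices[OF assms(1-6) slices])
  show "t \<le> t powr s" if "0 < t" "t < 1" for t
    using powr_mono'[of s 1 t] that s by simp
  show "0 < 2 powr s / (2 powr s - 1)" using s by simp
  show "(\<Sum>i\<le>J. (2 powr (1 - interp_exp q \<delta> \<gamma>)) ^ i) \<le> 2 powr s / (2 powr s - 1) * t powr s" if "1 \<le> t" "2 ^ J \<le> t" for t J
    using geometric_sum_growing[OF s(1) that] s(3) by simp
qed

section \<open>The six resonance geometries and their exponents\<close>

theorem theorem3p1:
  fixes a b c :: "real \<Rightarrow> real" and m :: "real \<times> real \<Rightarrow> complex" and q :: ereal
  assumes "smooth1 a" and "smooth1 b" and "smooth1 c"
    and "smooth2 m" and "compact (Supp m)"
    and "2 \<le> q"
  shows
    "estimate a b c m q (\<lambda>t. t)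
   \<and> (ResSet a b c m = {} \<longrightarrow> estimate a b c m q (\<lambda>t. 1))
   \<and> ((\<exists>p0. ResSet a b c m = {p0} \<and> vanish_order_two (phase a b c) p0) \<longrightarrow>
        estimate a b c m q (\<lambda>t. t powr (1/2 + qinv q / 2)))
   \<and> (vanish_order_one_on (phase a b c) (ResSet a b c m) \<and> non_characteristic (phase a b c) (ResSet a b c m) \<longrightarrow>
        estimate a b c m q (\<lambda>t. if q = \<infinity> then japanese (ln t) else t powr qinv q))
   \<and> (vanish_order_one_on (phase a b c) (ResSet a b c m) \<and> (\<forall>p\<in>ResSet a b c m. curvature (phase a b c) p \<noteq> 0) \<longrightarrow>
        estimate a b c m q (\<lambda>t. t powr (1/4 + qinv q / 2)))
   \<and> (vanish_order_one_on (phase a b c) (ResSet a b c m) \<longrightarrow>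
        estimate a b c m q (\<lambda>t. t powr (1/2)))"
proof -
  note sm = assms(1-5) assms(6)
  note loc = loc_slice_phase[OF assms(1,2,3)] loc_slice_phase[OF assms(1,3,2)] loc_slice_0
  let ?\<phi> = "phase a b c" and ?S = "ResSet a b c m"
  have swap: "phase a c b (snd p, fst p) = ?\<phi> p" for p using fun_cong[OF phase_swap[of a b c], of "(snd p, fst p)"] by simp
  have px: "pdx ?\<phi> p = phase_D a b p" "pdy ?\<phi> p = phase_D a c (snd p, fst p)"
    "pdx (pdx ?\<phi>) p = phase_DD a b p" "pdy (pdy ?\<phi>) p = phase_DD a c (snd p, fst p)" for p
    using phase_partials[OF assms(1,2,3), THEN fun_cong, of p] by simp_all
  \<comment> \<open>Off the zero set both slices may be given any exponent; 4 is at least every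
    \<open>\<delta>\<close> and \<open>\<gamma>\<close> used below.\<close>
  have off: "phase_slices a b c p \<delta> \<gamma>"
    if "p \<in> Supp m" "p \<notin> ?S" "\<delta> \<le> 4" "\<gamma> \<le> 4" for p \<delta> \<gamma>
  proof -
    have "?\<phi> p \<noteq> 0" using that by (simp add: ResSet_def)
    then show ?thesis using that loc(1)[of p 4] loc(4)[of "(snd p, fst p)" 4] by (intro exI[of _ 4]) (simp add: swap)
  qed
  note qb = qinv_bounds[OF assms(6)]
  have A: "estimate a b c m q (\<lambda>t. t)"
  \<comment> \<open>Trivial slices give e = 0, a geometric sum of ratio 2, and hence at most 2
    t.\<close>
  proof (rule estimate_of_slices[OF sm, where \<delta> = 0 and \<gamma> = 0 and C = 2])
    fix p assume "p \<in> Supp m"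
    show "phase_slices a b c p 0 0"
      by (intro exI[of _ 0]) (simp add: loc_slice_0)
  next
    fix t :: real and J :: nat assume "1 \<le> t" "2 ^ J \<le> t"
    then show "(\<Sum>i\<le>J. (2 powr (1 - interp_exp q 0 0)) ^ i) \<le> 2 * t"
      using geometric_sum_growing[of 1 t J] by (simp add: interp_exp_def)
  qed auto
  have B: "estimate a b c m q (\<lambda>t. 1)" if "?S = {}"
  proof (rule estimate_of_slices[OF sm, where \<delta> = 4 and \<gamma> = 4 and C = 2])
    show "phase_slices a b c p 4 4" if "p \<in> Supp m" for p
      using off[of p 4 4] that \<open>?S = {}\<close> by simp
    \<comment> \<open>Equal exponents make e independent of q; the ratio is then 1/2 and the series
      sums to at most 2.\<close>
    have "interp_exp q 4 4 = 2" by (simp add: interp_exp_def algebra_simps)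
    then show "(\<Sum>i\<le>J. (2 powr (1 - interp_exp q 4 4)) ^ i) \<le> 2 * 1" for t :: real and J
      using geometric_sum_decaying[of "-1" J] by (simp add: powr_minus)
  qed auto
  have C: "estimate a b c m q (\<lambda>t. t powr (1/2 + qinv q / 2))" if p0: "?S = {p0}" "vanish_order_two ?\<phi> p0" for p0
  proof (rule estimate_powr_of_slices[OF sm, where \<delta> = 1 and \<gamma> = "1/2"])
    have "hess_form ?\<phi> p0 v \<noteq> 0" if "v \<noteq> 0" for v
      using p0(2) that unfolding vanish_order_two_def hess_definite_def by (metis less_irrefl)
    \<comment> \<open>On the coordinate axes the Hessian form reduces to the pure second
      derivatives, so each direction has slice exponent 1/2: the sum is 1 and the maximum
      1/2.\<close>
    from this[of "(1, 0)"] this[of "(0, 1)"]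
    have "phase_DD a b p0 \<noteq> 0" "phase_DD a c (snd p0, fst p0) \<noteq> 0"
      by (simp_all add: hess_form_def px zero_prod_def)
    then have "loc_slice ?\<phi> p0 (1/2)" "loc_slice (phase a c b) (snd p0, fst p0) (1/2)" by (auto intro!: loc)
    then show "phase_slices a b c p 1 (1/2)" if "p \<in> Supp m" for p
      using off[of p 1 "1/2"] that p0(1) by (cases "p = p0") (auto intro!: exI[of _ "1/2"])
  qed (use qb in \<open>auto simp: interp_exp_def field_simps\<close>)
  have D: "estimate a b c m q (\<lambda>t. if q = \<infinity> then japanese (ln t) else t powr qinv q)"
    if "vanish_order_one_on ?\<phi> ?S" "non_characteristic ?\<phi> ?S"
  proof -
    have sl: "phase_slices a b c p 2 1" if p: "p \<in> Supp m" for p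
    proof (cases "p \<in> ?S")
      case True
      \<comment> \<open>The tangent is the rotated gradient: a vanishing \<xi>-derivative makes it
        horizontal, a vanishing \<eta>-derivative vertical. With both excluded, each slice has
        exponent 1.\<close>
      then have "phase_D a b p \<noteq> 0" "phase_D a c (snd p, fst p) \<noteq> 0"
        using \<open>non_characteristic ?\<phi> ?S\<close>
        by (auto simp: non_characteristic_def characteristic_at_def Defs.parallel_def tangent_dir_def px)
      then show ?thesis using loc by (intro exI[of _ 1]) auto
    next
      case False then show ?thesis using off[of p 2 1] p by auto
    qed
    show ?thesis
    \<comment> \<open>Here e = 1 - 1/q, so only the sup norm meets the critical sum.\<close>
    proof (cases "q = \<infinity>")
      case True
      have "estimate a b c m q (\<lambda>t. japanese (ln t))"
      proof (rule estimate_of_slices[OF sm sl])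
        show "t \<le> japanese (ln t)" if "0 < t" "t < 1" for t
          using le_japanese(2)[of "ln t"] that by linarith
        show "0 < 1 / ln 2 + (1::real)" by (simp add: add_pos_pos)
        show "(\<Sum>i\<le>J. (2 powr (1 - interp_exp q 2 1)) ^ i) \<le> (1 / ln 2 + 1) * japanese (ln t)" if "1 \<le> t" "2 ^ J \<le> t" for t J
          using geometric_sum_critical[OF that] True by (simp add: interp_exp_def qinv_def)
      qed
      then show ?thesis using True by simp
    next
      case False
      have "estimate a b c m q (\<lambda>t. t powr qinv q)"
        by (rule estimate_powr_of_slices[OF sm sl]) (use qb False in \<open>auto simp: interp_exp_def algebra_simps\<close>)
      then show ?thesis using False by simp
    qed
  qed
  have E: "estimate a b c m q (\<lambda>t. t powr (1/4 + qinv q / 2))"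
    if "vanish_order_one_on ?\<phi> ?S" "\<forall>p\<in>?S. curvature ?\<phi> p \<noteq> 0"
  proof (rule estimate_powr_of_slices[OF sm, where \<delta> = "3/2" and \<gamma> = 1])
    fix p assume p: "p \<in> Supp m"
    show "phase_slices a b c p (3/2) 1"
    proof (cases "p \<in> ?S")
      case True
      then have g: "phase_D a b p \<noteq> 0 \<or> phase_D a c (snd p, fst p) \<noteq> 0"
        using that(1) by (auto simp: vanish_order_one_on_def grad_zero_def px)
      have k: "curvature ?\<phi> p \<noteq> 0" using that(2) True by blast
      \<comment> \<open>Where one first derivative vanishes, the mixed term drops out of the
        curvature and what remains is the pure second derivative in that same direction times the
        square of the other first derivative. The slice exponents are then 1/2 and 1.\<close>
      consider "phase_D a b p \<noteq> 0" "phase_D a c (snd p, fst p) \<noteq> 0"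
        | "phase_D a b p = 0" "phase_D a c (snd p, fst p) \<noteq> 0" "phase_DD a b p \<noteq> 0"
        | "phase_D a b p \<noteq> 0" "phase_D a c (snd p, fst p) = 0" "phase_DD a c (snd p, fst p) \<noteq> 0"
        using g k by (cases "phase_D a b p = 0"; cases "phase_D a c (snd p, fst p) = 0") (auto simp: curvature_def px)
      then show ?thesis
      proof cases
        case 1 then show ?thesis using loc by (intro exI[of _ 1]) auto
      next
        case 2 then show ?thesis using loc by (intro exI[of _ "1/2"] exI[of _ 1]) auto
      next
        case 3 then show ?thesis using loc by (intro exI[of _ 1] exI[of _ "1/2"]) auto
      qed
    next
      case False then show ?thesis using off[of p "3/2" 1] p by auto
    qed
  qed (use qb in \<open>auto simp: interp_exp_def field_simps\<close>)
  have F: "estimate a b c m q (\<lambda>t. t powr (1/2))" if "vanish_order_one_on ?\<phi> ?S"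
  \<comment> \<open>One direction has exponent 1 and the other is bounded trivially. Sum and maximum
    are both 1, so e = 1/2 for every q.\<close>
  proof (rule estimate_powr_of_slices[OF sm, where \<delta> = 1 and \<gamma> = 1])
    fix p assume p: "p \<in> Supp m"
    show "phase_slices a b c p 1 1"
    proof (cases "p \<in> ?S")
      case True
      then have "phase_D a b p \<noteq> 0 \<or> phase_D a c (snd p, fst p) \<noteq> 0"
        using that(1) by (auto simp: vanish_order_one_on_def grad_zero_def px)
      then show ?thesis
      proof
        assume "phase_D a b p \<noteq> 0"
        then show ?thesis using loc by (intro exI[of _ 1] exI[of _ 0]) auto
      next
        assume "phase_D a c (snd p, fst p) \<noteq> 0"
        then show ?thesis using loc by (intro exI[of _ 0] exI[of _ 1]) auto
      qed
    next
      case False then show ?thesis using off[of p 1 1] p by auto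
    qed
  qed (auto simp: interp_exp_def algebra_simps)
  show ?thesis using A B C D E F by blast
qed

end
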